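(* Let $\mathcal{A}=\mathcal{A}^+\oplus\mathcal{A}^-=\mathcal{A}_0\oplus\mathcal{A}_1$ be an infinite-dimensional semi-finitely-filtered polarized $\mathbb{Z}_2$-graded associative algebra over $\mathbb{F}$ with bilinear form $\langle\cdot,\cdot\rangle$, let $\iota$ be a positive integer, and let $\{\varsigma_{i,j}\}$, $\{\varsigma_{i,-j}\}$, $I_i$, $\mathcal{P}$, $\bar{\mathcal{G}}$ and $\varsigma_{(f)}$ (for $f\in\mathcal{P}$) be as defined in the context. Take any $L_0\in\mathcal{A}^-_0+\mathcal{A}^{(\iota+1)}_0$, where $\mathcal A^-_0=\mathcal A^-\cap\mathcal A_0$ and $\mathcal A^{(\iota+1)}_0=\mathcal A^{(\iota+1)}\cap\mathcal A_0$, and set $$L=L_0+\sum_{i\in\mathbb{Z}_2,\,j\in I_i}x_{i,j}\varsigma_{i,j}\in\bar{\mathcal{G}}.$$ Take any central element $\kappa$ of $\mathcal{A}$ with $\kappa\in\mathcal{A}^-_0+\mathcal{A}^{(\iota+1)}_0$. For $f,g\in\mathcal{P}$ define $$\{f,g\}_1=\big\langle L,\,[\varsigma_{(f)},(\kappa\varsigma_{(g)})_+]-[(\kappa\varsigma_{(f)})_-,\varsigma_{(g)}]\big\rangle,$$ $$\{f,g\}_2=\big\langle (L\varsigma_{(f)})_-L-L(\varsigma_{(f)}L)_-,\,\varsigma_{(g)}\big\rangle .$$ Then $\{\cdot,\cdot\}_1$ and $\{\cdot,\cdot\}_2$ form a Poisson superpair on the algebra $\mathcal{P}$; that is, for all $\lambda_1,\lambda_2\in\mathbb{F}$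 the bracket $\lambda_1\{\cdot,\cdot\}_1+\lambda_2\{\cdot,\cdot\}_2$ is a Poisson superbracket on $\mathcal{P}$.
   Context: $\mathbb{F}$ is a field of characteristic not equal to two; all vector spaces and algebras are over $\mathbb{F}$. $\mathbb{N}$ is the set of nonnegative integers, and $\overline{m_1,m_2}=\{m_1,m_1+1,\dots,m_2\}$ if $m_1\le m_2$, $\emptyset$ otherwise. Polarized algebras. A $\mathbb{Z}_2$-graded associative algebra $\mathcal{A}=\mathcal{A}_0\oplus\mathcal{A}_1$ (not assumed unital) is polarized if it has a nondegenerate bilinear form $\langle\cdot,\cdot\rangle:\mathcal{A}\times\mathcal{A}\to\mathbb{F}$ with $\langle\mathcal{A}_0,\mathcal{A}_1\rangle=\{0\}$, $\langle u,v\rangle=(-1)^{i_1i_2}\langle v,u\rangle$ and $\langle uv,w\rangle=\langle u,vw\rangle$ for $u\in\mathcal{A}_{i_1},v\in\mathcal{A}_{i_2},w\in\mathcal{A}$, and contains two $\mathbb{Z}_2$-graded subalgebras $\mathcal{A}^+,\mathcal{A}^-$ with $\langle\mathcal{A}^+,\mathcal{A}^+\rangle=\langle\mathcal{A}^-,\mathcal{A}^-\rangle=\{0\}$ and $\mathcal{A}=\mathcal{A}^+\oplus\mathcal{A}^-$. Put $\mathcal{A}^\pm_i=\mathcal{A}^\pm\cap\mathcal{A}_i$. Define $\mathcal{A}^{(0)}=\{u\in\mathcal{A}^+\mid\mathcal{A}^-u\subset\mathcal{A}^-\}$ and inductively $\mathcal{A}^{(m+1)}=\{u\in\mathcal{A}^+\mid\mathcal{A}^-u\subset\mathcal{A}^{(m)}+\mathcal{A}^-\}$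 for $m\in\mathbb{N}$. The polarized algebra $\mathcal{A}$ is semi-finitely-filtered if $\mathcal{A}^+=\bigcup_{m=0}^\infty\mathcal{A}^{(m)}$ and $\dim\mathcal{A}^{(m)}<\infty$ for all $m\in\mathbb{N}$. Bases. Put $\mathcal{A}^{(m)}_i=\mathcal{A}^{(m)}\cap\mathcal{A}_i$ and $k_{i,m}=\dim\mathcal{A}^{(m)}_i$. Take a basis $\{\varsigma_{i,j}\mid j\in J_i\}$ of $\mathcal{A}^+_i$ ($i\in\mathbb{Z}_2$), where $J_i=\mathbb{N}+1$ or $J_i=\overline{1,n}$ for some $n$ (possibly empty), such that $\{\varsigma_{i,j}\mid j\in\overline{1,k_{i,m}}\}$ is a basis of $\mathcal{A}^{(m)}_i$ for all $m\in\mathbb{N}$. Take elements $\varsigma_{i,-j}\in\mathcal{A}^-_i$ ($j\in J_i$), assumed to exist, with $\langle\varsigma_{i_1,-j_1},\varsigma_{i_2,j_2}\rangle=\delta_{i_1,i_2}\delta_{j_1,j_2}$, such that each $u\in\mathcal{A}^-_i$ is written as a possibly infinite (formal, topological) sum $u=\sum_{j\in J_i}\lambda_{j}\varsigma_{i,-j}$ with $\lambda_j\in\mathbb{F}$ (so $\lambda_j=\langle u,\varsigma_{i,j}\rangle$). For the positive integer $\iota$, put $I_i=(-J_i)\cup\overline{1,k_{i,\iota}}$. The algebra $\mathcal{P}$. An associative algebra $\mathcal{B}=\mathcal{B}_0\oplus\mathcal{B}_1$ is super commutative if $uv=(-1)^{i_1i_2}vu$ for $u\in\mathcal{B}_{i_1},v\in\mathcal{B}_{i_2}$.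 $\mathcal{P}=\mathcal{P}_0\oplus\mathcal{P}_1$ is the super commutative algebra of supersymmetric polynomials in the variables $x_{i,j}$ ($i\in\mathbb{Z}_2$, $j\in I_i$), with $x_{0,j}$ even (commuting) and $x_{1,j}$ odd (anticommuting). $\partial_{i,j}$ is the superderivation of $\mathcal{P}$ of parity $i$, i.e. $\partial_{i,j}(fg)=\partial_{i,j}(f)g+(-1)^{ii'}f\partial_{i,j}(g)$ for $f\in\mathcal{P}_{i'}$, $g\in\mathcal P$, with $\partial_{i_1,j_1}(x_{i_2,j_2})=\delta_{i_1,i_2}\delta_{j_1,j_2}$. The algebra $\bar{\mathcal{G}}$. Let $\bar J_i=J_i\cup(-J_i)$. $\bar{\mathcal{G}}$ is the space of formal sums $\varsigma_\xi=\sum_{i\in\mathbb{Z}_2,\,j\in\bar J_i}\xi_{i,j}\varsigma_{i,j}$ with $\xi_{i,j}\in\mathcal{P}$, where only finitely many $\xi_{i,j}$ with $j>0$ are nonzero (arbitrary $\xi_{i,-j}$, $j\in J_i$, are allowed). It is graded by: $\varsigma_\xi\in\bar{\mathcal{G}}_p$ iff $\xi_{i,j}\in\mathcal{P}_{i+p}$ for all $i,j$. The algebra $\mathcal{A}$ is viewed inside $\bar{\mathcal{G}}$ by decomposing each element of $\mathcal{A}_i$ ($i\in\mathbb{Z}_2$) into its components in $\mathcal{A}^+_i$ and $\mathcal{A}^-_i$, writing the $\mathcal{A}^+_i$-component as a finite linear combination of the basis $\{\varsigma_{i,j}\mid j\in J_i\}$ and the $\mathcal{A}^-_i$-component $u$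 as the possibly infinite formal sum $\sum_{j\in J_i}\langle u,\varsigma_{i,j}\rangle\varsigma_{i,-j}$. For $\varsigma_\xi\in\bar{\mathcal{G}}$ and $\varsigma_\eta\in\bar{\mathcal{G}}_p$ the multiplication is $$\varsigma_\xi\varsigma_\eta=\sum_{i_1,i_2\in\mathbb{Z}_2,\,j_1\in\bar J_{i_1},\,j_2\in\bar J_{i_2}}(-1)^{i_1(i_2+p)}\xi_{i_1,j_1}\eta_{i_2,j_2}\,\varsigma_{i_1,j_1}\varsigma_{i_2,j_2}$$ (with each product $\varsigma_{i_1,j_1}\varsigma_{i_2,j_2}\in\mathcal{A}_{i_1+i_2}$ expanded by writing its $\mathcal{A}^+$-component in the basis $\{\varsigma_{i_1+i_2,j}\mid j\in J_{i_1+i_2}\}$ and its $\mathcal{A}^-$-component $u$ as the formal sum $\sum_{j\in J_{i_1+i_2}}\langle u,\varsigma_{i_1+i_2,j}\rangle\varsigma_{i_1+i_2,-j}$; each resulting coefficient is a finite sum), and the $\mathcal{P}$-valued bilinear form is $$\langle\varsigma_\xi,\varsigma_\eta\rangle=\sum_{i\in\mathbb{Z}_2,\,j\in J_i}(-1)^{i(i+p)}\big(\xi_{i,-j}\eta_{i,j}+(-1)^i\xi_{i,j}\eta_{i,-j}\big).$$ With these, $\bar{\mathcal{G}}$ is a $\mathbb{Z}_2$-graded associative algebra with supersymmetric associative form. For $u=\varsigma_\xi\in\bar{\mathcal{G}}$ put $u_\pm=\sum_{i\in\mathbb{Z}_2,\,j\in J_i}\xi_{i,\pm j}\varsigma_{i,\pm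 j}$. The superbracket on $\bar{\mathcal{G}}$ is $[u,v]=uv-(-1)^{i_1i_2}vu$ for $u\in\bar{\mathcal{G}}_{i_1},v\in\bar{\mathcal{G}}_{i_2}$. For $f=f_0+f_1$ with $f_0\in\mathcal{P}_0$, $f_1\in\mathcal{P}_1$: $$\varsigma_{(f)}=\sum_{i\in\mathbb{Z}_2,\,j\in J_i}\big((-1)^i\partial_{i,-j}(f_0)+\partial_{i,-j}(f_1)\big)\varsigma_{i,j}+\sum_{i\in\mathbb{Z}_2,\,j\in\overline{1,k_{i,\iota}}}\big(\partial_{i,j}(f_0)+(-1)^i\partial_{i,j}(f_1)\big)\varsigma_{i,-j}.$$ Poisson superbracket: an operation $\{\cdot,\cdot\}$ on a super commutative associative algebra $\mathcal{B}$ such that $(\mathcal{B},\{\cdot,\cdot\})$ is a Lie superalgebra and $\{u,vw\}=\{u,v\}w+(-1)^{i_1i_2}v\{u,w\}$ for $u\in\mathcal{B}_{i_1},v\in\mathcal{B}_{i_2},w\in\mathcal{B}$. A Poisson superpair is a pair of such brackets all of whose linear combinations are Poisson superbrackets. *)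

theory Defs
  imports
    "HOL.Vector_Spaces"
    "HOL-Library.Z2"
    "HOL-Library.Poly_Mapping"
    "HOL-Library.Set_Algebras"
begin

text \<open>The sign \<open>(-1)\<^sup>i\<close>, with \<^typ>\<open>bit\<close> as the index group \<open>\<int>\<^sub>2\<close>.\<close>

definition zsgn :: "bit \<Rightarrow> 'r::ring_1" where
  "zsgn i = (if i = 0 then 1 else - 1)"

lemma UNIV_bit: "(UNIV :: bit set) = {0, 1}"
  by (auto intro: bit.exhaust)

lemma zsgn_add: "zsgn (i + j) = (zsgn i * zsgn j :: 'r::ring_1)"
  by (cases i; cases j) (simp_all add: zsgn_def)

lemma zsgn_square: "zsgn i * zsgn i = (1 :: 'r::ring_1)"
  by (simp add: zsgn_def)

lemma zsgn_of_nat: "zsgn (of_nat n) = ((- 1) ^ n :: 'r::ring_1)"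
  by (induction n) (auto simp: zsgn_add zsgn_def)


section \<open>Supersymmetric polynomials\<close>

text \<open>
  The Grassmann algebra over a commutative ring \<open>'r\<close> with anticommuting generators
  \<open>\<theta>\<^sub>v\<close>: the function \<open>f\<close> stands for \<open>\<Sum>\<^sub>S f S \<cdot> \<theta>\<^sub>S\<close>, where \<open>\<theta>\<^sub>S\<close> is the product of the
  \<open>\<theta>\<^sub>v\<close>, \<open>v \<in> S\<close>, in increasing order.
\<close>

typedef (overloaded) ('v, 'r) grassmann =
  "{f :: 'v set \<Rightarrow> 'r::zero. finite {S. f S \<noteq> 0} \<and> (\<forall>S. infinite S \<longrightarrow> f S = 0)}"
  morphisms gcoeff Abs_grassmann
  by (rule exI[of _ "\<lambda>_. 0"]) simp

setup_lifting type_definition_grassmann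

lemma grassmann_eqI: "(\<And>S. finite S \<Longrightarrow> gcoeff f S = gcoeff g S) \<Longrightarrow> f = g"
  by transfer (metis ext)

lemma gcoeff_infinite [simp]: "infinite S \<Longrightarrow> gcoeff f S = 0"
  by transfer simp

instantiation grassmann :: (type, ab_group_add) ab_group_add
begin

lift_definition zero_grassmann :: "('a, 'b) grassmann" is "\<lambda>_. 0" by simp

lift_definition plus_grassmann :: "('a, 'b) grassmann \<Rightarrow> ('a, 'b) grassmann \<Rightarrow> ('a, 'b) grassmann"
  is "\<lambda>f g S. f S + g S"
proof safe
  fix f g :: "'a set \<Rightarrow> 'b"
  assume "finite {S. f S \<noteq> 0}" "finite {S. g S \<noteq> 0}"
  then have "finite ({S. f S \<noteq> 0} \<union> {S. g S \<noteq> 0})" by simp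
  then show "finite {S. f S + g S \<noteq> 0}" by (rule rev_finite_subset) auto
qed auto

lift_definition uminus_grassmann :: "('a, 'b) grassmann \<Rightarrow> ('a, 'b) grassmann"
  is "\<lambda>f S. - f S" by simp

lift_definition minus_grassmann :: "('a, 'b) grassmann \<Rightarrow> ('a, 'b) grassmann \<Rightarrow> ('a, 'b) grassmann"
  is "\<lambda>f g S. f S - g S"
proof safe
  fix f g :: "'a set \<Rightarrow> 'b"
  assume "finite {S. f S \<noteq> 0}" "finite {S. g S \<noteq> 0}"
  then have "finite ({S. f S \<noteq> 0} \<union> {S. g S \<noteq> 0})" by simp
  then show "finite {S. f S - g S \<noteq> 0}" by (rule rev_finite_subset) auto
qed auto

instance
  by standard (transfer, simp add: fun_eq_iff algebra_simps)+

end

text \<open>For disjoint \<open>T\<close> and \<open>U\<close>: \<open>\<theta>\<^sub>T \<theta>\<^sub>U = shuffle_sgn T U \<cdot> \<theta>\<^sub>T\<^sub>\<union>\<^sub>U\<close>.\<close>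

definition shuffle_sgn :: "'v::linorder set \<Rightarrow> 'v set \<Rightarrow> 'r::comm_ring_1" where
  "shuffle_sgn T U = (\<Prod>a\<in>T. \<Prod>b\<in>U. if b < a then - 1 else 1)"

lemma shuffle_sgn_empty [simp]: "shuffle_sgn {} U = 1" "shuffle_sgn T {} = 1"
  by (simp_all add: shuffle_sgn_def)

lemma shuffle_sgn_Un_left:
  "finite T \<Longrightarrow> finite T' \<Longrightarrow> T \<inter> T' = {} \<Longrightarrow>
    shuffle_sgn (T \<union> T') U = (shuffle_sgn T U * shuffle_sgn T' U :: 'r::comm_ring_1)"
  by (simp add: shuffle_sgn_def prod.union_disjoint)

lemma shuffle_sgn_Un_right:
  "finite U \<Longrightarrow> finite U' \<Longrightarrow> U \<inter> U' = {} \<Longrightarrow>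
    shuffle_sgn T (U \<union> U') = (shuffle_sgn T U * shuffle_sgn T U' :: 'r::comm_ring_1)"
  by (simp add: shuffle_sgn_def prod.union_disjoint prod.distrib)

lemma shuffle_sgn_square:
  "shuffle_sgn T U * shuffle_sgn T U = (1 :: 'r::comm_ring_1)" for T U :: "'v::linorder set"
proof -
  have "(if b < a then - 1 else 1) * (if b < a then - 1 else 1) = (1::'r)" for a b :: 'v
    by simp
  then show ?thesis by (simp add: shuffle_sgn_def flip: prod.distrib)
qed

lemma shuffle_sgn_cases:
  "shuffle_sgn T U = (1 :: 'r::comm_ring_1) \<or> shuffle_sgn T U = (- 1 :: 'r)"
proof -
  have prod: "prod h A \<in> {1, - 1}" if "\<And>x. h x \<in> {1, - 1}" for h :: "'c \<Rightarrow> 'r" and A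
  proof (induction A rule: infinite_finite_induct)
    case (insert x A)
    then show ?case using that[of x] by auto
  qed auto
  have "shuffle_sgn T U \<in> {1, - 1 :: 'r}"
    unfolding shuffle_sgn_def by (intro prod) auto
  then show ?thesis by simp
qed

lemma shuffle_sgn_swap:
  assumes "finite T" "finite U" "T \<inter> U = {}"
  shows "shuffle_sgn T U * shuffle_sgn U T = (zsgn (of_nat (card T) * of_nat (card U)) :: 'r::comm_ring_1)"
proof -
  have "shuffle_sgn U T = (\<Prod>a\<in>T. \<Prod>b\<in>U. if a < b then - 1 else (1::'r))"
    unfolding shuffle_sgn_def by (rule prod.swap)
  then have "shuffle_sgn T U * shuffle_sgn U T =
      (\<Prod>a\<in>T. \<Prod>b\<in>U. (if b < a then - 1 else 1) * (if a < b then - 1 else (1::'r)))"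
    by (simp add: shuffle_sgn_def prod.distrib)
  also have "\<dots> = (\<Prod>a\<in>T. \<Prod>b\<in>U. - 1)"
  proof (intro prod.cong refl)
    fix a b assume "a \<in> T" "b \<in> U"
    with assms(3) have "a \<noteq> b" by auto
    then show "(if b < a then - 1 else 1) * (if a < b then - 1 else (1::'r)) = - 1"
      by (cases a b rule: linorder_cases) auto
  qed
  also have "\<dots> = (- 1) ^ (card T * card U)"
    by (simp add: mult.commute flip: power_mult)
  also have "\<dots> = zsgn (of_nat (card T) * of_nat (card U))"
    by (metis of_nat_mult zsgn_of_nat)
  finally show ?thesis .
qed

instantiation grassmann :: (linorder, comm_ring_1) ring_1
begin

lift_definition one_grassmann :: "('a, 'b) grassmann" is "\<lambda>S. if S = {} then 1 else 0"
  by simp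

lift_definition times_grassmann :: "('a, 'b) grassmann \<Rightarrow> ('a, 'b) grassmann \<Rightarrow> ('a, 'b) grassmann"
  is "\<lambda>f g S. \<Sum>T\<in>Pow S. shuffle_sgn T (S - T) * f T * g (S - T)"
proof safe
  fix f g :: "'a set \<Rightarrow> 'b"
  assume fin: "finite {S. f S \<noteq> 0}" "finite {S. g S \<noteq> 0}"
  have "{S. (\<Sum>T\<in>Pow S. shuffle_sgn T (S - T) * f T * g (S - T)) \<noteq> 0}
      \<subseteq> (\<lambda>(T, U). T \<union> U) ` ({S. f S \<noteq> 0} \<times> {S. g S \<noteq> 0})"
  proof
    fix S assume "S \<in> {S. (\<Sum>T\<in>Pow S. shuffle_sgn T (S - T) * f T * g (S - T)) \<noteq> 0}"
    then obtain T where "T \<in> Pow S" "shuffle_sgn T (S - T) * f T * g (S - T) \<noteq> 0"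
      by (auto elim: sum.not_neutral_contains_not_neutral)
    then have "f T \<noteq> 0" "g (S - T) \<noteq> 0" "S = T \<union> (S - T)" by auto
    then show "S \<in> (\<lambda>(T, U). T \<union> U) ` ({S. f S \<noteq> 0} \<times> {S. g S \<noteq> 0})"
      by (intro image_eqI[of _ _ "(T, S - T)"]) auto
  qed
  with fin show "finite {S. (\<Sum>T\<in>Pow S. shuffle_sgn T (S - T) * f T * g (S - T)) \<noteq> 0}"
    by (meson finite_SigmaI finite_imageI finite_subset)
next
  fix f g :: "'a set \<Rightarrow> 'b" and S :: "'a set"
  assume "infinite S"
  then show "(\<Sum>T\<in>Pow S. shuffle_sgn T (S - T) * f T * g (S - T)) = 0"
    by simp
qed

instance
proof
  fix f g h :: "('a, 'b) grassmann"
  show "f * g * h = f * (g * h)"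
  proof (rule grassmann_eqI)
    fix S :: "'a set" assume S: "finite S"
    have fin: "finite T" if "T \<subseteq> S" for T using S that by (rule rev_finite_subset)
    let ?s = "shuffle_sgn :: 'a set \<Rightarrow> 'a set \<Rightarrow> 'b"
    have "gcoeff (f * g * h) S = (\<Sum>T\<in>Pow S. \<Sum>U\<in>Pow T.
        ?s T (S - T) * ?s U (T - U) * gcoeff f U * gcoeff g (T - U) * gcoeff h (S - T))"
      by (simp add: times_grassmann.rep_eq sum_distrib_left sum_distrib_right mult.assoc)
    also have "\<dots> = (\<Sum>(T, U)\<in>Sigma (Pow S) Pow.
        ?s T (S - T) * ?s U (T - U) * gcoeff f U * gcoeff g (T - U) * gcoeff h (S - T))"
      using S fin by (intro sum.Sigma) auto
    also have "\<dots> = (\<Sum>(U, V)\<in>Sigma (Pow S) (\<lambda>U. Pow (S - U)).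
        ?s U (S - U) * ?s V (S - U - V) * gcoeff f U * gcoeff g V * gcoeff h (S - U - V))"
    proof (rule sum.reindex_bij_witness[of _ "\<lambda>(U, V). (U \<union> V, U)" "\<lambda>(T, U). (U, T - U)"])
      fix p assume "p \<in> Sigma (Pow S) Pow"
      then obtain T U where p: "p = (T, U)" "U \<subseteq> T" "T \<subseteq> S" by auto
      have T: "T = U \<union> (T - U)" and SU: "S - U = (T - U) \<union> (S - T)"
        and ST: "S - U - (T - U) = S - T" using p by auto
      have 1: "?s T (S - T) = ?s U (S - T) * ?s (T - U) (S - T)"
        by (subst T, rule shuffle_sgn_Un_left) (use p fin S in auto)
      have 2: "?s U (S - U) = ?s U (T - U) * ?s U (S - T)"
        by (subst SU, rule shuffle_sgn_Un_right) (use p fin S in auto)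
      show "(case case p of (T, U) \<Rightarrow> (U, T - U) of (U, V) \<Rightarrow>
          ?s U (S - U) * ?s V (S - U - V) * gcoeff f U * gcoeff g V * gcoeff h (S - U - V)) =
        (case p of (T, U) \<Rightarrow>
          ?s T (S - T) * ?s U (T - U) * gcoeff f U * gcoeff g (T - U) * gcoeff h (S - T))"
        by (simp add: p(1) ST 1 2 algebra_simps)
    qed auto
    also have "\<dots> = (\<Sum>U\<in>Pow S. \<Sum>V\<in>Pow (S - U).
        ?s U (S - U) * ?s V (S - U - V) * gcoeff f U * gcoeff g V * gcoeff h (S - U - V))"
      using S by (intro sum.Sigma[symmetric]) auto
    also have "\<dots> = gcoeff (f * (g * h)) S"
      by (simp add: times_grassmann.rep_eq sum_distrib_left sum_distrib_right algebra_simps)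
    finally show "gcoeff (f * g * h) S = gcoeff (f * (g * h)) S" .
  qed
  show "1 * f = f"
  proof (rule grassmann_eqI)
    fix S :: "'a set" assume "finite S"
    then have "gcoeff (1 * f) S = (\<Sum>T\<in>Pow S. if T = {} then gcoeff f S else 0)"
      unfolding times_grassmann.rep_eq by (intro sum.cong) (auto simp: one_grassmann.rep_eq)
    with \<open>finite S\<close> show "gcoeff (1 * f) S = gcoeff f S" by simp
  qed
  show "f * 1 = f"
  proof (rule grassmann_eqI)
    fix S :: "'a set" assume "finite S"
    then have "gcoeff (f * 1) S = (\<Sum>T\<in>Pow S. if T = S then gcoeff f S else 0)"
      unfolding times_grassmann.rep_eq by (intro sum.cong) (auto simp: one_grassmann.rep_eq)
    with \<open>finite S\<close> show "gcoeff (f * 1) S = gcoeff f S" by simp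
  qed
  show "(f + g) * h = f * h + g * h" "f * (g + h) = f * g + f * h"
    by (transfer, simp add: algebra_simps sum.distrib)+
  have "gcoeff (0 :: ('a, 'b) grassmann) {} \<noteq> gcoeff 1 {}"
    by (simp add: zero_grassmann.rep_eq one_grassmann.rep_eq)
  then show "(0 :: ('a, 'b) grassmann) \<noteq> 1" by metis
qed

end

lift_definition gconst :: "'r::zero \<Rightarrow> ('v, 'r) grassmann" is "\<lambda>c S. if S = {} then c else 0"
proof safe
  fix c :: 'r
  show "finite {S :: 'v set. (if S = {} then c else 0) \<noteq> 0}"
    by (rule finite_subset[of _ "{{}}"]) auto
qed auto

lift_definition theta :: "'v \<Rightarrow> ('v, 'r::zero_neq_one) grassmann" is "\<lambda>v S. if S = {v} then 1 else 0"
  by auto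

lift_definition parity_part :: "bit \<Rightarrow> ('v, 'r::zero) grassmann \<Rightarrow> ('v, 'r) grassmann"
  is "\<lambda>p f S. if of_nat (card S) = p then f S else 0"
proof safe
  fix p :: bit and f :: "'v set \<Rightarrow> 'r"
  assume "finite {S. f S \<noteq> 0}"
  then show "finite {S. (if of_nat (card S) = p then f S else 0) \<noteq> 0}"
    by (rule rev_finite_subset) auto
qed auto

lemma parity_part_add: "parity_part 0 f + parity_part 1 f = (f :: ('v, 'r::ab_group_add) grassmann)"
  by transfer (auto simp: fun_eq_iff)

lemma super_commute:
  fixes f g :: "('v::linorder, 'r::comm_ring_1) grassmann"
  assumes f: "parity_part p f = f" and g: "parity_part q g = g"
  shows "f * g = zsgn (p * q) * (g * f)"
proof (rule grassmann_eqI)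
  fix S :: "'v set" assume S: "finite S"
  have zsgn_coeff: "gcoeff (zsgn i * h) S = zsgn i * gcoeff h S" for i and h :: "('v, 'r) grassmann"
    by (cases i) (simp_all add: zsgn_def uminus_grassmann.rep_eq)
  have fp: "of_nat (card T) = p" if "gcoeff f T \<noteq> 0" for T
    using that parity_part.rep_eq[of p f] f by (metis (full_types))
  have gq: "of_nat (card T) = q" if "gcoeff g T \<noteq> 0" for T
    using that parity_part.rep_eq[of q g] g by (metis (full_types))
  have "gcoeff (f * g) S = (\<Sum>T\<in>Pow S. shuffle_sgn T (S - T) * gcoeff f T * gcoeff g (S - T))"
    by (rule times_grassmann.rep_eq[THEN fun_cong])
  also have "\<dots> = (\<Sum>T\<in>Pow S. zsgn (p * q) * (shuffle_sgn (S - T) T * gcoeff g (S - T) * gcoeff f T))"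
  proof (intro sum.cong refl)
    fix T assume "T \<in> Pow S"
    with S have fin: "finite T" "finite (S - T)" by (auto intro: finite_subset)
    show "shuffle_sgn T (S - T) * gcoeff f T * gcoeff g (S - T) =
      zsgn (p * q) * (shuffle_sgn (S - T) T * gcoeff g (S - T) * gcoeff f T)"
    proof (cases "gcoeff f T = 0 \<or> gcoeff g (S - T) = 0")
      case False
      then have "of_nat (card T) = p" "of_nat (card (S - T)) = q"
        using fp gq by blast+
      then have "(zsgn (p * q) :: 'r) = shuffle_sgn T (S - T) * shuffle_sgn (S - T) T"
        using shuffle_sgn_swap[OF fin, where 'r = 'r] by (metis Diff_disjoint)
      then have "zsgn (p * q) * shuffle_sgn (S - T) T =
          (shuffle_sgn T (S - T) :: 'r) * (shuffle_sgn (S - T) T * shuffle_sgn (S - T) T)"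
        by (simp add: mult.assoc)
      also have "\<dots> = shuffle_sgn T (S - T)"
        by (simp add: shuffle_sgn_square)
      finally have "zsgn (p * q) * shuffle_sgn (S - T) T = (shuffle_sgn T (S - T) :: 'r)" .
      moreover have "zsgn (p * q) * (shuffle_sgn (S - T) T * gcoeff g (S - T) * gcoeff f T) =
          (zsgn (p * q) * shuffle_sgn (S - T) T) * gcoeff f T * gcoeff g (S - T)"
        by (simp only: mult_ac)
      ultimately show ?thesis by simp
    qed auto
  qed
  also have "\<dots> = (\<Sum>T\<in>Pow S. zsgn (p * q) * (shuffle_sgn T (S - T) * gcoeff g T * gcoeff f (S - T)))"
    by (rule sum.reindex_bij_witness[of _ "\<lambda>T. S - T" "\<lambda>T. S - T"]) (auto simp: double_diff)
  also have "\<dots> = gcoeff (zsgn (p * q) * (g * f)) S"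
    unfolding zsgn_coeff times_grassmann.rep_eq[of g f] sum_distrib_left ..
  finally show "gcoeff (f * g) S = gcoeff (zsgn (p * q) * (g * f)) S" .
qed

lemma sum_Pow_insert:
  assumes "finite S" "v \<notin> S"
  shows "(\<Sum>T\<in>Pow (insert v S). h T) = (\<Sum>T\<in>Pow S. h T + h (insert v T) :: 'b::comm_monoid_add)"
proof -
  have "(\<Sum>T\<in>Pow (insert v S). h T) = (\<Sum>T\<in>Pow S. h T) + (\<Sum>T\<in>insert v ` Pow S. h T)"
    unfolding Pow_insert using assms by (intro sum.union_disjoint) auto
  also have "(\<Sum>T\<in>insert v ` Pow S. h T) = (\<Sum>T\<in>Pow S. h (insert v T))"
    using assms by (subst sum.reindex) (auto simp: inj_on_def o_def)
  finally show ?thesis by (simp add: sum.distrib)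
qed

text \<open>\<open>\<partial>/\<partial>\<theta>\<^sub>v\<close>, acting from the left; recall \<open>\<theta>\<^sub>v \<theta>\<^sub>S = shuffle_sgn {v} S \<cdot> \<theta>\<^sub>S\<^sub>\<union>\<^sub>{\<^sub>v\<^sub>}\<close> for \<open>v \<notin> S\<close>.\<close>

lift_definition odd_deriv ::
    "'v::linorder \<Rightarrow> ('v, 'r::comm_ring_1) grassmann \<Rightarrow> ('v, 'r) grassmann"
  is "\<lambda>v f S. if v \<in> S then 0 else shuffle_sgn {v} S * f (insert v S)"
proof safe
  fix v :: 'v and f :: "'v set \<Rightarrow> 'r"
  assume "finite {S. f S \<noteq> 0}"
  then have "finite ((\<lambda>S. S - {v}) ` {S. f S \<noteq> 0})" by simp
  then show "finite {S. (if v \<in> S then 0 else shuffle_sgn {v} S * f (insert v S)) \<noteq> 0}"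
    by (rule rev_finite_subset) (auto split: if_splits intro!: image_eqI[of _ _ "insert v _"])
qed auto

lemma odd_deriv_mult:
  fixes f g :: "('v::linorder, 'r::comm_ring_1) grassmann"
  assumes f: "parity_part p f = f"
  shows "odd_deriv v (f * g) = odd_deriv v f * g + zsgn p * (f * odd_deriv v g)"
proof (rule grassmann_eqI)
  fix S :: "'v set" assume S: "finite S"
  let ?s = "shuffle_sgn :: 'v set \<Rightarrow> 'v set \<Rightarrow> 'r"
  have zsgn_coeff: "gcoeff (zsgn i * h) S = zsgn i * gcoeff h S" for i and h :: "('v, 'r) grassmann"
    by (cases i) (simp_all add: zsgn_def uminus_grassmann.rep_eq)
  have fp: "of_nat (card T) = p" if "gcoeff f T \<noteq> 0" for T
    using that parity_part.rep_eq[of p f] f by (metis (full_types))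
  have fin: "finite T" if "T \<subseteq> S" for T using S that by (rule rev_finite_subset)
  let ?F = "gcoeff f" and ?G = "gcoeff g"
  have swap: "?s T {v} * ?s {v} T = zsgn (of_nat (card T))" if "T \<subseteq> S" "v \<notin> T" for T
    using shuffle_sgn_swap[of T "{v}", where 'r = 'r] fin[OF that(1)] that(2) by simp
  have sq: "?s {v} T * (?s {v} T * a) = a" for T a
    using shuffle_sgn_square[of "{v}" T, where 'r = 'r] by (simp flip: mult.assoc)
  show "gcoeff (odd_deriv v (f * g)) S = gcoeff (odd_deriv v f * g + zsgn p * (f * odd_deriv v g)) S"
  proof (cases "v \<in> S")
    case False
    have "gcoeff (odd_deriv v (f * g)) S = ?s {v} S * gcoeff (f * g) (insert v S)"
      using False by (simp add: odd_deriv.rep_eq)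
    also have "\<dots> = (\<Sum>T\<in>Pow S.
        ?s {v} S * (?s T (insert v S - T) * ?F T * ?G (insert v S - T)) +
        ?s {v} S * (?s (insert v T) (insert v S - insert v T) * ?F (insert v T) * ?G (insert v S - insert v T)))"
      unfolding times_grassmann.rep_eq sum_Pow_insert[OF S False]
      by (simp add: sum_distrib_left distrib_left)
    also have "\<dots> = (\<Sum>T\<in>Pow S.
        zsgn p * (?s T (S - T) * ?F T * (?s {v} (S - T) * ?G (insert v (S - T)))) +
        ?s T (S - T) * (?s {v} T * ?F (insert v T)) * ?G (S - T))"
    proof (intro sum.cong refl)
      fix T assume "T \<in> Pow S"
      then have T: "T \<subseteq> S" and vT: "v \<notin> T" using False by auto
      have sets: "insert v S - T = insert v (S - T)" "insert v S - insert v T = S - T"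
        using False vT by auto
      have a: "?s {v} S = ?s {v} T * ?s {v} (S - T)"
        using shuffle_sgn_Un_right[of T "S - T" "{v}", where 'r = 'r] T fin[of T] fin[of "S - T"]
        by (auto simp: Un_absorb1)
      have b: "?s T (insert v (S - T)) = ?s T {v} * ?s T (S - T)"
        using shuffle_sgn_Un_right[of "{v}" "S - T" T, where 'r = 'r] False fin[of "S - T"] by auto
      have c: "?s (insert v T) (S - T) = ?s {v} (S - T) * ?s T (S - T)"
        using shuffle_sgn_Un_left[of "{v}" T "S - T", where 'r = 'r] vT fin[OF T] by auto
      have "?s {v} S * (?s T (insert v (S - T)) * ?F T * ?G (insert v (S - T))) =
          (?s T {v} * ?s {v} T) * (?s T (S - T) * ?F T * (?s {v} (S - T) * ?G (insert v (S - T))))"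
        unfolding a b by (simp add: mult_ac)
      also have "\<dots> = zsgn p * (?s T (S - T) * ?F T * (?s {v} (S - T) * ?G (insert v (S - T))))"
        unfolding swap[OF T vT] using fp[of T] by (cases "?F T = 0") auto
      finally have 1: "?s {v} S * (?s T (insert v (S - T)) * ?F T * ?G (insert v (S - T))) =
        zsgn p * (?s T (S - T) * ?F T * (?s {v} (S - T) * ?G (insert v (S - T))))" .
      have 2: "?s {v} S * (?s (insert v T) (S - T) * ?F (insert v T) * ?G (S - T)) =
          ?s T (S - T) * (?s {v} T * ?F (insert v T)) * ?G (S - T)"
        unfolding a c by (simp add: mult_ac sq shuffle_sgn_square)
      show "?s {v} S * (?s T (insert v S - T) * ?F T * ?G (insert v S - T)) +
          ?s {v} S * (?s (insert v T) (insert v S - insert v T) * ?F (insert v T) * ?G (insert v S - insert v T)) =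
        zsgn p * (?s T (S - T) * ?F T * (?s {v} (S - T) * ?G (insert v (S - T)))) +
          ?s T (S - T) * (?s {v} T * ?F (insert v T)) * ?G (S - T)"
        unfolding sets 1 2 ..
    qed
    also have "\<dots> = gcoeff (odd_deriv v f * g + zsgn p * (f * odd_deriv v g)) S"
      unfolding plus_grassmann.rep_eq zsgn_coeff times_grassmann.rep_eq[of f "odd_deriv v g"]
        times_grassmann.rep_eq[of "odd_deriv v f" g] odd_deriv.rep_eq
        sum_distrib_left sum.distrib[symmetric]
      by (intro sum.cong refl) (use False in auto)
    finally show ?thesis .
  next
    case True
    define R where "R = S - {v}"
    have R: "S = insert v R" "v \<notin> R" "finite R" using True S by (auto simp: R_def)
    have "gcoeff (odd_deriv v f * g + zsgn p * (f * odd_deriv v g)) S =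
      (\<Sum>T\<in>Pow R. (?s T (S - T) * (?s {v} T * ?F (insert v T)) * ?G (S - T)) +
        zsgn p * (?s (insert v T) (S - insert v T) * ?F (insert v T) * (?s {v} (R - T) * ?G (insert v (R - T)))))"
      unfolding plus_grassmann.rep_eq zsgn_coeff
      unfolding times_grassmann.rep_eq[of f "odd_deriv v g"]
        times_grassmann.rep_eq[of "odd_deriv v f" g] odd_deriv.rep_eq R(1)
        sum_Pow_insert[OF R(3,2)] sum_distrib_left sum.distrib[symmetric]
      by (intro sum.cong refl) (use R(2) in auto)
    also have "\<dots> = (\<Sum>T\<in>Pow R. 0)"
    proof (intro sum.cong refl)
      fix T assume "T \<in> Pow R"
      then have T: "T \<subseteq> S" "finite T" and vT: "v \<notin> T"
        using R by (auto intro: finite_subset)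
      have sets: "S - T = insert v (R - T)" "S - insert v T = R - T" using R vT by auto
      have b: "?s T (insert v (R - T)) = ?s T {v} * ?s T (R - T)"
        using shuffle_sgn_Un_right[of "{v}" "R - T" T, where 'r = 'r] R by auto
      have c: "?s (insert v T) (R - T) = ?s {v} (R - T) * ?s T (R - T)"
        using shuffle_sgn_Un_left[of "{v}" T "R - T", where 'r = 'r] vT T by auto
      have z: "?F (insert v T) = 0 \<or> zsgn p = - (zsgn (of_nat (card T)) :: 'r)"
        using fp[of "insert v T"] vT T by (cases "?F (insert v T) = 0") (auto simp: zsgn_add zsgn_def)
      have "?s T (S - T) * (?s {v} T * ?F (insert v T)) * ?G (S - T) =
          (?s T {v} * ?s {v} T) * (?s T (R - T) * ?F (insert v T) * ?G (insert v (R - T)))"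
        unfolding sets b by (simp add: mult_ac)
      moreover have "zsgn p * (?s (insert v T) (S - insert v T) * ?F (insert v T) *
            (?s {v} (R - T) * ?G (insert v (R - T)))) =
          zsgn p * (?s T (R - T) * ?F (insert v T) * ?G (insert v (R - T)))"
        unfolding sets c by (simp add: mult_ac sq shuffle_sgn_square)
      ultimately show "(?s T (S - T) * (?s {v} T * ?F (insert v T)) * ?G (S - T)) +
          zsgn p * (?s (insert v T) (S - insert v T) * ?F (insert v T) *
            (?s {v} (R - T) * ?G (insert v (R - T)))) = 0"
        using z unfolding swap[OF T(1) vT] by auto
    qed
    finally show ?thesis using True by (simp add: odd_deriv.rep_eq)
  qed
qed

text \<open>Extension of the partial derivative of commutative polynomials to Grassmann coefficients.\<close>

lift_definition poly_deriv ::
    "'v \<Rightarrow> (('v \<Rightarrow>\<^sub>0 nat) \<Rightarrow>\<^sub>0 'k) \<Rightarrow> ('v \<Rightarrow>\<^sub>0 nat) \<Rightarrow>\<^sub>0 'k::comm_semiring_1"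
  is "\<lambda>v p m. of_nat (Poly_Mapping.lookup m v + 1) * p (m + Poly_Mapping.single v 1)"
proof -
  fix v :: 'v and p :: "('v \<Rightarrow>\<^sub>0 nat) \<Rightarrow> 'k"
  assume "finite {m. p m \<noteq> 0}"
  then have "finite ((\<lambda>m. m - Poly_Mapping.single v 1) ` {m. p m \<noteq> 0})" by simp
  then show "finite {m. of_nat (Poly_Mapping.lookup m v + 1) * p (m + Poly_Mapping.single v 1) \<noteq> 0}"
    by (rule rev_finite_subset)
      (auto intro!: image_eqI[of _ _ "_ + Poly_Mapping.single v 1"])
qed

lemma poly_deriv_add: "poly_deriv v (p + q) = poly_deriv v p + poly_deriv v q"
  by (rule poly_mapping_eqI) (simp add: poly_deriv.rep_eq lookup_add algebra_simps)

lemma poly_deriv_zero [simp]: "poly_deriv v 0 = 0"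
  by (rule poly_mapping_eqI) (simp add: poly_deriv.rep_eq)

lemma poly_deriv_uminus:
  "poly_deriv v (- p) = - poly_deriv v (p :: ('v \<Rightarrow>\<^sub>0 nat) \<Rightarrow>\<^sub>0 'k::comm_ring_1)"
  by (rule poly_mapping_eqI) (simp add: poly_deriv.rep_eq)

lemma poly_deriv_sum: "poly_deriv v (\<Sum>x\<in>A. h x) = (\<Sum>x\<in>A. poly_deriv v (h x))"
  by (induction A rule: infinite_finite_induct) (simp_all add: poly_deriv_add)

lemma poly_deriv_single:
  "poly_deriv v (Poly_Mapping.single m a) =
    Poly_Mapping.single (m - Poly_Mapping.single v 1) (of_nat (Poly_Mapping.lookup m v) * a)"
proof (rule poly_mapping_eqI)
  fix n :: "'a \<Rightarrow>\<^sub>0 nat"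
  show "Poly_Mapping.lookup (poly_deriv v (Poly_Mapping.single m a)) n =
    Poly_Mapping.lookup (Poly_Mapping.single (m - Poly_Mapping.single v 1) (of_nat (Poly_Mapping.lookup m v) * a)) n"
  proof (cases "m = n + Poly_Mapping.single v 1")
    case True
    then show ?thesis by (simp add: poly_deriv.rep_eq lookup_add)
  next
    case False
    have "Poly_Mapping.lookup m v = 0" if "n = m - Poly_Mapping.single v 1"
    proof (rule ccontr)
      assume "Poly_Mapping.lookup m v \<noteq> 0"
      then have "m = n + Poly_Mapping.single v 1"
        unfolding that
        by (intro poly_mapping_eqI) (auto simp: lookup_add lookup_minus lookup_single when_def)
      with False show False by simp
    qed
    with False show ?thesis by (auto simp: poly_deriv.rep_eq lookup_single when_def)
  qed
qed

lemma poly_deriv_one [simp]: "poly_deriv v 1 = 0"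
  using poly_deriv_single[of v 0 1] by simp

lemma poly_mapping_induct_single [case_names zero single add]:
  assumes "P 0" "\<And>m a. P (Poly_Mapping.single m a)" "\<And>p q. P p \<Longrightarrow> P q \<Longrightarrow> P (p + q)"
  shows "P (p :: 'm \<Rightarrow>\<^sub>0 'k::monoid_add)"
proof (induction p rule: update_induct)
  case (update f a b)
  then have "Poly_Mapping.update a b f = f + Poly_Mapping.single a b"
    by (intro poly_mapping_eqI) (auto simp: lookup_update lookup_add lookup_single when_def in_keys_iff)
  with update assms show ?case by metis
qed (use assms in auto)

lemma poly_deriv_mult: "poly_deriv v (p * q) = poly_deriv v p * q + p * poly_deriv v q"
proof (induction p rule: poly_mapping_induct_single)
  case (single m a)
  show ?case
  proof (induction q rule: poly_mapping_induct_single)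
    case (single n b)
    let ?e = "Poly_Mapping.single v 1 :: 'a \<Rightarrow>\<^sub>0 nat"
    have sub: "k + l - ?e = (k - ?e) + l" if "Poly_Mapping.lookup k v \<noteq> 0" for k l :: "'a \<Rightarrow>\<^sub>0 nat"
      using that by (intro poly_mapping_eqI) (auto simp: lookup_add lookup_minus lookup_single when_def)
    have 1: "Poly_Mapping.single (m + n - ?e) (of_nat (Poly_Mapping.lookup m v) * (a * b)) =
        Poly_Mapping.single (m - ?e + n) (of_nat (Poly_Mapping.lookup m v) * a * b)"
      using sub[of m n] by (cases "Poly_Mapping.lookup m v = 0") (simp_all add: mult.assoc)
    have 2: "Poly_Mapping.single (m + n - ?e) (of_nat (Poly_Mapping.lookup n v) * (a * b)) =
        Poly_Mapping.single (m + (n - ?e)) (a * (of_nat (Poly_Mapping.lookup n v) * b))"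
      using sub[of n m] by (cases "Poly_Mapping.lookup n v = 0") (simp_all add: mult_ac add.commute)
    show ?case
      unfolding mult_single poly_deriv_single lookup_add of_nat_add distrib_right single_add 1 2 ..
  qed (simp_all add: poly_deriv_add algebra_simps)
qed (simp_all add: poly_deriv_add algebra_simps)

lift_definition even_deriv :: "'v \<Rightarrow> ('v, ('v \<Rightarrow>\<^sub>0 nat) \<Rightarrow>\<^sub>0 'k::comm_semiring_1) grassmann
    \<Rightarrow> ('v, ('v \<Rightarrow>\<^sub>0 nat) \<Rightarrow>\<^sub>0 'k) grassmann"
  is "\<lambda>v f S. poly_deriv v (f S)"
proof safe
  fix v :: 'v and f :: "'v set \<Rightarrow> ('v \<Rightarrow>\<^sub>0 nat) \<Rightarrow>\<^sub>0 'k"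
  assume "finite {S. f S \<noteq> 0}"
  then show "finite {S. poly_deriv v (f S) \<noteq> 0}"
    by (rule rev_finite_subset) auto
qed auto


type_synonym 'k superpoly = "(int, (int \<Rightarrow>\<^sub>0 nat) \<Rightarrow>\<^sub>0 'k) grassmann"

definition sp_var :: "bit \<Rightarrow> int \<Rightarrow> 'k::comm_ring_1 superpoly" where
  "sp_var i j = (if i = 0 then gconst (Poly_Mapping.single (Poly_Mapping.single j 1) 1) else theta j)"

definition sp_scale :: "'k::comm_ring_1 \<Rightarrow> 'k superpoly \<Rightarrow> 'k superpoly" where
  "sp_scale c f = gconst (Poly_Mapping.single 0 c) * f"

definition sp_deriv :: "bit \<Rightarrow> int \<Rightarrow> 'k::comm_ring_1 superpoly \<Rightarrow> 'k superpoly" where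
  "sp_deriv i j f = (if i = 0 then even_deriv j f else odd_deriv j f)"

text \<open>The parity \<open>p\<close> component of the algebra of polynomials in the \<open>sp_var i j\<close> with \<open>j \<in> I i\<close>.\<close>

definition superpolys :: "(bit \<Rightarrow> int set) \<Rightarrow> bit \<Rightarrow> 'k::comm_ring_1 superpoly set" where
  "superpolys I p = {f. parity_part p f = f \<and>
     (\<forall>S. gcoeff f S \<noteq> 0 \<longrightarrow> S \<subseteq> I 1 \<and> (\<forall>m\<in>Poly_Mapping.keys (gcoeff f S). Poly_Mapping.keys m \<subseteq> I 0))}"

lemma sp_deriv_var:
  "sp_deriv i j (sp_var i' j') = (if i = i' \<and> j = j' then 1 else 0)"
proof (rule grassmann_eqI)
  fix S :: "int set"
  show "gcoeff (sp_deriv i j (sp_var i' j' :: 'a superpoly)) S =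
      gcoeff (if i = i' \<and> j = j' then 1 else 0) S"
    by (cases i; cases i')
      (auto simp: sp_deriv_def sp_var_def even_deriv.rep_eq odd_deriv.rep_eq gconst.rep_eq theta.rep_eq
        one_grassmann.rep_eq zero_grassmann.rep_eq poly_deriv_single lookup_single when_def)
qed

lemma sp_deriv_mult:
  assumes "parity_part p f = f"
  shows "sp_deriv i j (f * g) = sp_deriv i j f * g + zsgn (i * p) * (f * sp_deriv i j g)"
proof (cases "i = 0")
  case True
  have "sp_deriv i j (f * g) = sp_deriv i j f * g + f * sp_deriv i j g"
  proof (rule grassmann_eqI)
    fix S :: "int set"
    have *: "poly_deriv j (shuffle_sgn T U * p * q) =
        shuffle_sgn T U * poly_deriv j p * q + shuffle_sgn T U * p * poly_deriv j q"
      for T U :: "int set" and p q :: "(int \<Rightarrow>\<^sub>0 nat) \<Rightarrow>\<^sub>0 'a"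
    proof -
      have "poly_deriv j (shuffle_sgn T U) = (0 :: (int \<Rightarrow>\<^sub>0 nat) \<Rightarrow>\<^sub>0 'a)"
      proof (rule disjE[OF shuffle_sgn_cases[of T U]])
        assume eq: "shuffle_sgn T U = (1 :: (int \<Rightarrow>\<^sub>0 nat) \<Rightarrow>\<^sub>0 'a)"
        show ?thesis unfolding eq by simp
      next
        assume eq: "shuffle_sgn T U = (- 1 :: (int \<Rightarrow>\<^sub>0 nat) \<Rightarrow>\<^sub>0 'a)"
        show ?thesis unfolding eq poly_deriv_uminus by simp
      qed
      then show ?thesis by (simp add: poly_deriv_mult distrib_right)
    qed
    show "gcoeff (sp_deriv i j (f * g)) S = gcoeff (sp_deriv i j f * g + f * sp_deriv i j g) S"
      using True
      by (simp add: sp_deriv_def even_deriv.rep_eq plus_grassmann.rep_eq times_grassmann.rep_eq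
          poly_deriv_sum * sum.distrib)
  qed
  with True show ?thesis by (simp add: zsgn_def)
next
  case False
  with assms show ?thesis by (simp add: sp_deriv_def odd_deriv_mult)
qed


section \<open>Poisson superpairs\<close>

text \<open>The algebra is \<open>A 0 \<oplus> A 1\<close>; this may be a proper subset of the ambient type.\<close>

locale z2_graded_algebra = vector_space sc
  for sc :: "'k::field \<Rightarrow> 'a::ring \<Rightarrow> 'a" +
  fixes A :: "bit \<Rightarrow> 'a set"
  assumes scale_mult_left: "sc c (x * y) = sc c x * y"
    and scale_mult_right: "sc c (x * y) = x * sc c y"
    and subspace_grade: "subspace (A i)"
    and grade_Int: "A 0 \<inter> A 1 = {0}"
    and grade_mult: "x \<in> A i \<Longrightarrow> y \<in> A j \<Longrightarrow> x * y \<in> A (i + j)"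

locale super_commutative_algebra = z2_graded_algebra sc B
  for sc :: "'k::field \<Rightarrow> 'b::ring \<Rightarrow> 'b" and B +
  assumes super_commutative: "u \<in> B i \<Longrightarrow> v \<in> B j \<Longrightarrow> u * v = sc (zsgn (i * j)) (v * u)"

locale lie_superalgebra = vector_space sc
  for sc :: "'k::field \<Rightarrow> 'b::ab_group_add \<Rightarrow> 'b" +
  fixes B :: "bit \<Rightarrow> 'b set" and br :: "'b \<Rightarrow> 'b \<Rightarrow> 'b"
  assumes subspace_component: "subspace (B i)"
    and component_Int: "B 0 \<inter> B 1 = {0}"
    and bracket_add_left: "u \<in> B 0 + B 1 \<Longrightarrow> v \<in> B 0 + B 1 \<Longrightarrow> w \<in> B 0 + B 1 \<Longrightarrow>
      br (u + v) w = br u w + br v w"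
    and bracket_add_right: "u \<in> B 0 + B 1 \<Longrightarrow> v \<in> B 0 + B 1 \<Longrightarrow> w \<in> B 0 + B 1 \<Longrightarrow>
      br u (v + w) = br u v + br u w"
    and bracket_scale_left: "u \<in> B 0 + B 1 \<Longrightarrow> v \<in> B 0 + B 1 \<Longrightarrow> br (sc c u) v = sc c (br u v)"
    and bracket_scale_right: "u \<in> B 0 + B 1 \<Longrightarrow> v \<in> B 0 + B 1 \<Longrightarrow> br u (sc c v) = sc c (br u v)"
    and bracket_grade: "u \<in> B i \<Longrightarrow> v \<in> B j \<Longrightarrow> br u v \<in> B (i + j)"
    and bracket_skew: "u \<in> B i \<Longrightarrow> v \<in> B j \<Longrightarrow> br u v = - sc (zsgn (i * j)) (br v u)"
    and bracket_jacobi: "u \<in> B i \<Longrightarrow> v \<in> B j \<Longrightarrow> w \<in> B k \<Longrightarrow>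
      br u (br v w) = br (br u v) w + sc (zsgn (i * j)) (br v (br u w))"

locale poisson_superbracket = super_commutative_algebra sc B + lie_superalgebra sc B br
  for sc :: "'k::field \<Rightarrow> 'b::ring \<Rightarrow> 'b" and B and br +
  assumes bracket_leibniz: "u \<in> B i \<Longrightarrow> v \<in> B j \<Longrightarrow> w \<in> B 0 + B 1 \<Longrightarrow>
    br u (v * w) = br u v * w + sc (zsgn (i * j)) (v * br u w)"

definition poisson_superpair ::
    "('k::field \<Rightarrow> 'b::ring \<Rightarrow> 'b) \<Rightarrow> (bit \<Rightarrow> 'b set) \<Rightarrow> ('b \<Rightarrow> 'b \<Rightarrow> 'b) \<Rightarrow> ('b \<Rightarrow> 'b \<Rightarrow> 'b) \<Rightarrow> bool" where
  "poisson_superpair sc B br1 br2 \<longleftrightarrow>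
    poisson_superbracket sc B br1 \<and> poisson_superbracket sc B br2 \<and>
    (\<forall>c1 c2. poisson_superbracket sc B (\<lambda>u v. sc c1 (br1 u v) + sc c2 (br2 u v)))"


section \<open>Polarized algebras\<close>

locale polarized_algebra = z2_graded_algebra sc A
  for sc :: "'k::field \<Rightarrow> 'a::ring \<Rightarrow> 'a" and A +
  fixes form :: "'a \<Rightarrow> 'a \<Rightarrow> 'k" and Ap Am :: "'a set"
  assumes grade_sum: "A 0 + A 1 = UNIV"
    and form_linear_left: "Vector_Spaces.linear sc (*) (\<lambda>u. form u v)"
    and form_linear_right: "Vector_Spaces.linear sc (*) (\<lambda>v. form u v)"
    and form_nondegenerate_left: "(\<And>v. form u v = 0) \<Longrightarrow> u = 0"
    and form_nondegenerate_right: "(\<And>u. form u v = 0) \<Longrightarrow> v = 0"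
    and form_grade: "u \<in> A 0 \<Longrightarrow> v \<in> A 1 \<Longrightarrow> form u v = 0"
    and form_supersymmetric: "u \<in> A i \<Longrightarrow> v \<in> A j \<Longrightarrow> form u v = zsgn (i * j) * form v u"
    and form_associative: "u \<in> A i \<Longrightarrow> v \<in> A j \<Longrightarrow> form (u * v) w = form u (v * w)"
    and subspace_pos: "subspace Ap" and subspace_neg: "subspace Am"
    and mult_pos: "u \<in> Ap \<Longrightarrow> v \<in> Ap \<Longrightarrow> u * v \<in> Ap"
    and mult_neg: "u \<in> Am \<Longrightarrow> v \<in> Am \<Longrightarrow> u * v \<in> Am"
    and graded_pos: "Ap = (Ap \<inter> A 0) + (Ap \<inter> A 1)"
    and graded_neg: "Am = (Am \<inter> A 0) + (Am \<inter> A 1)"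
    and isotropic_pos: "u \<in> Ap \<Longrightarrow> v \<in> Ap \<Longrightarrow> form u v = 0"
    and isotropic_neg: "u \<in> Am \<Longrightarrow> v \<in> Am \<Longrightarrow> form u v = 0"
    and polar_Int: "Ap \<inter> Am = {0}"
    and polar_sum: "Ap + Am = UNIV"
begin

primrec filt :: "nat \<Rightarrow> 'a set" where
  "filt 0 = {u \<in> Ap. \<forall>v\<in>Am. v * u \<in> Am}"
| "filt (Suc m) = {u \<in> Ap. \<forall>v\<in>Am. v * u \<in> filt m + Am}"

definition filt_dim :: "bit \<Rightarrow> nat \<Rightarrow> nat" where
  "filt_dim i m = dim (filt m \<inter> A i)"

definition pos_comp :: "'a \<Rightarrow> 'a" where
  "pos_comp u = (THE a. a \<in> Ap \<and> u - a \<in> Am)"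

definition neg_comp :: "'a \<Rightarrow> 'a" where
  "neg_comp u = (THE b. b \<in> Am \<and> u - b \<in> Ap)"

end

locale semi_finitely_filtered_algebra = polarized_algebra +
  assumes filt_exhaustive: "Ap = (\<Union>m. filt m)"
    and filt_finite_dim: "\<exists>S. finite S \<and> span S = filt m"

definition is_basis_family ::
    "('k::field \<Rightarrow> 'a::ab_group_add \<Rightarrow> 'a) \<Rightarrow> ('i \<Rightarrow> 'a) \<Rightarrow> 'i set \<Rightarrow> 'a set \<Rightarrow> bool" where
  "is_basis_family sc b K V \<longleftrightarrow>
    inj_on b K \<and> \<not> module.dependent sc (b ` K) \<and> module.span sc (b ` K) = V"

text \<open>
  \<open>s i j\<close> is the element \<open>\<varsigma>\<^sub>i\<^sub>,\<^sub>j\<close>; only the indices \<open>j \<in> J i\<close> and \<open>- j \<in> J i\<close> are relevant.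
\<close>

locale polarized_bases = semi_finitely_filtered_algebra sc A form Ap Am
  for sc :: "'k::field \<Rightarrow> 'a::ring \<Rightarrow> 'a" and A form Ap Am +
  fixes J :: "bit \<Rightarrow> int set" and s :: "bit \<Rightarrow> int \<Rightarrow> 'a"
  assumes J_cases: "J i = {1..} \<or> (\<exists>n::nat. J i = {1..int n})"
    and pos_basis: "is_basis_family sc (s i) (J i) (Ap \<inter> A i)"
    and filt_basis: "is_basis_family sc (s i) {1..int (filt_dim i m)} (filt m \<inter> A i)"
    and neg_mem: "j \<in> J i \<Longrightarrow> s i (- j) \<in> Am \<inter> A i"
    and dual: "j1 \<in> J i1 \<Longrightarrow> j2 \<in> J i2 \<Longrightarrow>
      form (s i1 (- j1)) (s i2 j2) = (if i1 = i2 \<and> j1 = j2 then 1 else 0)"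
begin

text \<open>
  The coefficient of \<open>s i j\<close> in \<open>u \<in> A k\<close>, where the component in \<open>Am\<close> is read as the formal
  sum of the \<open>form (neg_comp u) (s k j) \<cdot> s k (- j)\<close> over \<open>j \<in> J k\<close>.
\<close>

definition coord :: "bit \<Rightarrow> 'a \<Rightarrow> bit \<Rightarrow> int \<Rightarrow> 'k" where
  "coord k u i j =
    (if i \<noteq> k then 0
     else if j \<in> J k then representation (s k ` J k) (pos_comp u) (s k j)
     else if - j \<in> J k then form (neg_comp u) (s k (- j))
     else 0)"

text \<open>This reading loses no information: an element of \<open>Am\<close> is determined by its coefficients.\<close>

lemma neg_coefficients_inject:
  assumes u: "u \<in> Am \<inter> A k" and v: "v \<in> Am \<inter> A k"
    and eq: "\<And>j. j \<in> J k \<Longrightarrow> form u (s k j) = form v (s k j)"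
  shows "u = v"
proof -
  define w where "w = u - v"
  have w: "w \<in> Am" "w \<in> A k"
    using u v subspace_diff[OF subspace_neg] subspace_diff[OF subspace_grade] by (auto simp: w_def)
  interpret l: Vector_Spaces.linear sc "(*)" "\<lambda>u. form u b" for b by (rule form_linear_left)
  interpret r: Vector_Spaces.linear sc "(*)" "\<lambda>b. form a b" for a by (rule form_linear_right)
  have same: "form w a = 0" if "a \<in> Ap \<inter> A k" for a
  proof -
    from that pos_basis[of k] have "a \<in> span (s k ` J k)" by (simp add: is_basis_family_def)
    then show ?thesis
    proof (induction rule: span_induct_alt)
      case (step c x y)
      then show ?case using eq by (auto simp: r.add r.scale l.diff w_def)
    qed (simp add: r.zero)
  qed
  have other: "form w a = 0" if "a \<in> A j" "j \<noteq> k" for a j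
  proof (cases "k = 0")
    case True
    with that w form_grade show ?thesis by auto
  next
    case False
    with that have "form a w = 0" using w form_grade by auto
    then show ?thesis using form_supersymmetric[OF w(2) that(1)] by simp
  qed
  have pos: "form w a = 0" if "a \<in> Ap" for a
  proof -
    from that graded_pos have "a \<in> (Ap \<inter> A 0) + (Ap \<inter> A 1)" by blast
    then obtain a0 a1 where a: "a = a0 + a1" "a0 \<in> Ap \<inter> A 0" "a1 \<in> Ap \<inter> A 1"
      by (rule set_plus_elim)
    then have "form w a0 = 0" "form w a1 = 0"
      using same other by (cases "k = 0"; force)+
    then show ?thesis by (simp add: a(1) r.add)
  qed
  have "form w a = 0" for a
  proof -
    from polar_sum obtain a1 a2 where "a = a1 + a2" "a1 \<in> Ap" "a2 \<in> Am"
      by (metis UNIV_I set_plus_elim)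
    then show ?thesis using pos isotropic_neg w by (simp add: r.add)
  qed
  then have "w = 0" by (rule form_nondegenerate_left)
  then show ?thesis by (simp add: w_def)
qed

definition var_index :: "nat \<Rightarrow> bit \<Rightarrow> int set" where
  "var_index \<iota> i = uminus ` J i \<union> {1..int (filt_dim i \<iota>)}"

end

text \<open>
  A formal sum \<open>\<Sum>\<^sub>i\<^sub>,\<^sub>j \<xi> i j \<cdot> s i j\<close> is represented by its family of coefficients \<open>\<xi>\<close>; the
  families that stand for elements of the algebra of formal sums form \<open>gbar_space\<close> below.
\<close>

type_synonym 'k gbar = "bit \<Rightarrow> int \<Rightarrow> 'k superpoly"

definition gbar_part :: "bit \<Rightarrow> 'k::comm_ring_1 gbar \<Rightarrow> 'k gbar" where
  "gbar_part p \<xi> = (\<lambda>i j. parity_part (i + p) (\<xi> i j))"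

context polarized_bases
begin

definition gbar_space :: "nat \<Rightarrow> 'k gbar set" where
  "gbar_space \<iota> = {\<xi>. (\<forall>i j. \<xi> i j \<in> superpolys (var_index \<iota>) 0 + superpolys (var_index \<iota>) 1) \<and>
     (\<forall>i j. \<xi> i j \<noteq> 0 \<longrightarrow> j \<in> J i \<union> uminus ` J i) \<and>
     (\<forall>i. finite {j \<in> J i. \<xi> i j \<noteq> 0})}"

definition embed :: "bit \<Rightarrow> 'a \<Rightarrow> 'k gbar" where
  "embed k u = (\<lambda>i j. sp_scale (coord k u i j) 1)"

definition gbar_pos :: "'k gbar \<Rightarrow> 'k gbar" where
  "gbar_pos \<xi> = (\<lambda>i j. if j \<in> J i then \<xi> i j else 0)"

definition gbar_neg :: "'k gbar \<Rightarrow> 'k gbar" where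
  "gbar_neg \<xi> = (\<lambda>i j. if - j \<in> J i then \<xi> i j else 0)"

text \<open>
  Multiplication and form are defined for a second factor of parity \<open>p\<close> and extended additively.
  On \<open>gbar_space\<close> the sums have finite support (for the product because the filtration is by
  finite-dimensional spaces), so that \<^const>\<open>Sum_any\<close> is their actual value.
\<close>

definition gbar_mult_hom :: "bit \<Rightarrow> 'k gbar \<Rightarrow> 'k gbar \<Rightarrow> 'k gbar" where
  "gbar_mult_hom p \<xi> \<eta> = (\<lambda>i j. Sum_any (\<lambda>(i1, j1, i2, j2).
     sp_scale (coord (i1 + i2) (s i1 j1 * s i2 j2) i j)
       (zsgn (i1 * (i2 + p)) * (\<xi> i1 j1 * \<eta> i2 j2))
     when j1 \<in> J i1 \<union> uminus ` J i1 \<and> j2 \<in> J i2 \<union> uminus ` J i2))"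

definition gbar_mult :: "'k gbar \<Rightarrow> 'k gbar \<Rightarrow> 'k gbar" where
  "gbar_mult \<xi> \<eta> = (\<lambda>i j. \<Sum>p\<in>UNIV. gbar_mult_hom p \<xi> (gbar_part p \<eta>) i j)"

definition gbar_form_hom :: "bit \<Rightarrow> 'k gbar \<Rightarrow> 'k gbar \<Rightarrow> 'k superpoly" where
  "gbar_form_hom p \<xi> \<eta> = Sum_any (\<lambda>(i, j).
     zsgn (i * (i + p)) * (\<xi> i (- j) * \<eta> i j + zsgn i * (\<xi> i j * \<eta> i (- j)))
     when j \<in> J i)"

definition gbar_form :: "'k gbar \<Rightarrow> 'k gbar \<Rightarrow> 'k superpoly" where
  "gbar_form \<xi> \<eta> = (\<Sum>p\<in>UNIV. gbar_form_hom p \<xi> (gbar_part p \<eta>))"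

definition gbar_bracket :: "'k gbar \<Rightarrow> 'k gbar \<Rightarrow> 'k gbar" where
  "gbar_bracket \<xi> \<eta> = (\<lambda>i j. \<Sum>p\<in>UNIV. \<Sum>q\<in>UNIV.
     gbar_mult (gbar_part p \<xi>) (gbar_part q \<eta>) i j -
     zsgn (p * q) * gbar_mult (gbar_part q \<eta>) (gbar_part p \<xi>) i j)"

definition grad :: "nat \<Rightarrow> 'k superpoly \<Rightarrow> 'k gbar" where
  "grad \<iota> f = (\<lambda>i j.
     if j \<in> J i then
       zsgn i * sp_deriv i (- j) (parity_part 0 f) + sp_deriv i (- j) (parity_part 1 f)
     else if - j \<in> {1..int (filt_dim i \<iota>)} then
       sp_deriv i (- j) (parity_part 0 f) + zsgn i * sp_deriv i (- j) (parity_part 1 f)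
     else 0)"

definition lax :: "nat \<Rightarrow> 'a \<Rightarrow> 'k gbar" where
  "lax \<iota> L0 = (\<lambda>i j. embed 0 L0 i j + (if j \<in> var_index \<iota> i then sp_var i j else 0))"

text \<open>
  The inner differences of coefficient families are pointwise (\<^const>\<open>minus\<close> on functions). Only
  \<open>\<lbrace>\<cdot>,\<cdot>\<rbrace>\<^sub>1\<close> involves the central element \<open>\<kappa>\<close>.
\<close>

definition bracket1 :: "nat \<Rightarrow> 'a \<Rightarrow> 'a \<Rightarrow> 'k superpoly \<Rightarrow> 'k superpoly \<Rightarrow> 'k superpoly" where
  "bracket1 \<iota> L0 \<kappa> f g =
    gbar_form (lax \<iota> L0)
      (gbar_bracket (grad \<iota> f) (gbar_pos (gbar_mult (embed 0 \<kappa>) (grad \<iota> g))) -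
       gbar_bracket (gbar_neg (gbar_mult (embed 0 \<kappa>) (grad \<iota> f))) (grad \<iota> g))"

definition bracket2 :: "nat \<Rightarrow> 'a \<Rightarrow> 'k superpoly \<Rightarrow> 'k superpoly \<Rightarrow> 'k superpoly" where
  "bracket2 \<iota> L0 f g =
    gbar_form
      (gbar_mult (gbar_neg (gbar_mult (lax \<iota> L0) (grad \<iota> f))) (lax \<iota> L0) -
       gbar_mult (lax \<iota> L0) (gbar_neg (gbar_mult (grad \<iota> f) (lax \<iota> L0))))
      (grad \<iota> g)"

end

end

theory Submission
  imports Defs "HOL-Library.Function_Algebras"
begin

text \<open>
  Let \<open>L\<close> be the Lax element, a formal sum whose coefficients are constants and variables. For a
  formal sum \<open>X\<close> put \<open>V(X) = (L X)\<^sub>- L - L (X L)\<^sub>-\<close>. Then the second bracket of \<open>f\<close> and \<open>g\<close> is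
  the pairing of \<open>V(\<nabla>f)\<close> with \<open>\<nabla>g\<close>, where \<open>\<nabla>\<close> is \<^term>\<open>polarized_bases.grad\<close>, that is, the
  derivative of \<open>g\<close> along the vector field \<open>V(\<nabla>f)\<close>. This is the quadratic (Gelfand-Dickey) bracket
  of the splitting of the algebra into two isotropic subalgebras.

  Only the second bracket has to be studied. Replacing \<open>L\<^sub>0\<close> by \<open>L\<^sub>0 \<plusminus> \<kappa>\<close> replaces \<open>L\<close> by \<open>L \<plusminus> \<kappa>\<close>; since
  \<open>\<kappa>\<close> is central, the contribution quadratic in \<open>\<kappa>\<close> vanishes, and the linear one is plus or minus the
  first bracket (\<open>bracket1_difference\<close>). So, once the second bracket is known to be Poisson for every
  admissible \<open>L\<^sub>0\<close>, three members of the pencil of the two brackets are Poisson. The Jacobiator is a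
  quadratic form on the pencil, and in characteristic other than two it must then vanish identically
  (\<open>poisson_superpair_from_three\<close>).

  Skew symmetry of the second bracket follows from isotropy of the two subalgebras and cyclicity of the
  form, and the Leibniz rule from the description as a derivative. The Jacobiator is a superderivation in
  each argument, so it need only vanish on variables (\<open>jac_from_variables\<close>). Gradients of variables are
  constant, hence no second derivatives occur. Bracketing with a variable \<open>x\<close> is a superderivation of the
  coefficients and maps \<open>L\<close> to \<open>V(\<nabla>x)\<close>; here it matters that \<open>V(\<nabla>x)\<close> has no components other than
  those along the variables, which holds because multiplication by the negative subalgebra lowers the
  filtration (\<open>vfield_tangent\<close>). The Jacobi identity becomes a statement about traces of words
  in \<open>L X\<close>, \<open>L Y\<close>, \<open>L Z\<close> and \<open>X L\<close>, \<open>Y L\<close>, \<open>Z L\<close> with \<open>X\<close>, \<open>Y\<close>, \<open>Z\<close> constant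
  (\<open>jacobi_vfield\<close>): words that mix the two kinds combine in pairs to pure ones, and then the left
  products contribute the trace of \<open>u [v, w]\<close> with \<open>u = L X\<close>, \<open>v = L Y\<close>, \<open>w = L Z\<close>, the right products
  minus the corresponding trace, and these two traces agree by cyclicity.

  All this takes place in the algebra of formal sums, which are infinite in the negative direction. Its
  operations are finite for the following reason. The spaces \<open>wfilt m\<close> exhaust the algebra, contain the
  negative subalgebra and satisfy \<open>wfilt m * wfilt n \<subseteq> wfilt (m + n)\<close>, while an element of \<open>wfilt m\<close>
  pairs to zero with almost all negative basis elements. Hence a trace of a word of basis
  elements, with bounded positive indices, is nonzero only if the negative indices are bounded as well
  (\<open>ex_wordbound\<close>). Associativity of the form is then an identity between finite sums, and associativity
  of the product follows from it because the form is nondegenerate (\<open>gbar_mult_assoc\<close>).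
\<close>

text \<open>Sums and products of parities are kept as such instead of being turned into bit operations.\<close>

declare add_bit_eq_xor [simp del] mult_bit_eq_and [simp del]

lemma bit_add_self [simp]: "i + i = (0 :: bit)" "i + (i + j) = (j :: bit)" and bit_mult_self [simp]: "i * i = (i :: bit)"
  by (cases i; cases j; simp)+

section \<open>The algebra of supersymmetric polynomials\<close>

lemma grassmann_nonzeroE:
  assumes "f \<noteq> 0" obtains S where "finite S" "gcoeff f S \<noteq> 0"
  using assms grassmann_eqI[of f 0] by (auto simp: zero_grassmann.rep_eq)

lemma gcoeff_sum: "gcoeff (\<Sum>x\<in>X. h x) S = (\<Sum>x\<in>X. gcoeff (h x) S)"
  by (induction X rule: infinite_finite_induct) (auto simp: zero_grassmann.rep_eq plus_grassmann.rep_eq)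

lemma gcoeff_gconst_mult: "gcoeff (gconst c * f) S = c * gcoeff f S"
proof (cases "finite S")
  case True
  have "gcoeff (gconst c * f) S = (\<Sum>T\<in>Pow S. if T = {} then c * gcoeff f S else 0)"
    unfolding times_grassmann.rep_eq by (intro sum.cong) (auto simp: gconst.rep_eq)
  with True show ?thesis by simp
qed simp

lemma gcoeff_mult_gconst: "gcoeff (f * gconst c) S = gcoeff f S * c"
proof (cases "finite S")
  case True
  have "gcoeff (f * gconst c) S = (\<Sum>T\<in>Pow S. if T = S then gcoeff f S * c else 0)"
    unfolding times_grassmann.rep_eq by (intro sum.cong) (auto simp: gconst.rep_eq)
  with True show ?thesis by simp
qed simp

lemma gconst_mult_commute: "gconst c * f = f * gconst c"
  by (rule grassmann_eqI) (simp add: gcoeff_gconst_mult gcoeff_mult_gconst mult.commute)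

lemma gcoeff_sp_scale: "gcoeff (sp_scale c f) S = Poly_Mapping.single 0 c * gcoeff f S"
  by (simp add: sp_scale_def gcoeff_gconst_mult)

lemma gconst_add: "gconst (c + d :: 'a::ab_group_add) = gconst c + gconst d"
  by (rule grassmann_eqI) (simp add: gconst.rep_eq plus_grassmann.rep_eq)

lemma gconst_times: "gconst (c * d) = gconst c * gconst d"
  by (rule grassmann_eqI) (simp add: gcoeff_gconst_mult gconst.rep_eq)

lemma gconst_one: "gconst 1 = 1"
  by (rule grassmann_eqI) (simp add: gconst.rep_eq one_grassmann.rep_eq)

lemma gconst_zero: "gconst 0 = (0 :: ('v, 'a::ab_group_add) grassmann)"
  by (rule grassmann_eqI) (simp add: gconst.rep_eq zero_grassmann.rep_eq)

lemma sp_scale_add_right: "sp_scale c (f + g) = sp_scale c f + sp_scale c g"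
  and sp_scale_add_left: "sp_scale (c + d) f = sp_scale c f + sp_scale d f"
  and sp_scale_scale: "sp_scale c (sp_scale d f) = sp_scale (c * d) f"
  and sp_scale_one: "sp_scale 1 f = f"
  and sp_scale_mult_left: "sp_scale c f * g = sp_scale c (f * g)"
  and sp_scale_mult_right: "f * sp_scale c g = sp_scale c (f * g)"
  by (simp_all add: sp_scale_def distrib_left distrib_right single_add gconst_add mult.assoc
      flip: gconst_times mult_single)
    (simp_all add: mult.assoc gconst_one flip: gconst_times mult.assoc, simp_all add: gconst_mult_commute mult.assoc mult_single flip: single_one)


lemma sp_scale_zero_right [simp]: "sp_scale c 0 = 0"
  and sp_scale_zero_left [simp]: "sp_scale 0 f = 0"
  and sp_scale_minus_right: "sp_scale c (- f) = - sp_scale c f"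
  and sp_scale_minus_left: "sp_scale (- c) f = - sp_scale c f"
  and sp_scale_diff_right: "sp_scale c (f - g) = sp_scale c f - sp_scale c g"
  by (simp_all add: sp_scale_def gconst_zero right_diff_distrib single_uminus)
    (rule grassmann_eqI, simp add: gcoeff_gconst_mult uminus_grassmann.rep_eq)

lemma sp_scale_sum: "sp_scale c (\<Sum>x\<in>X. h x) = (\<Sum>x\<in>X. sp_scale c (h x))"
  by (simp add: sp_scale_def sum_distrib_left)

lemma sp_scale_zsgn [simp]: "sp_scale (zsgn i) f = zsgn i * f"
  by (cases i) (simp_all add: zsgn_def sp_scale_one sp_scale_minus_left)

lemma zsgn_left_commute: "f * (zsgn i * g) = zsgn i * (f * g :: 'r::ring_1)"
  by (cases i) (simp_all add: zsgn_def)

lemma zsgn_zsgn: "zsgn i * (zsgn i * f) = (f :: 'r::ring_1)"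
  by (cases i) (simp_all add: zsgn_def)

lemma parity_part_parity_part:
  "parity_part p (parity_part q f) = (if p = q then parity_part q f else 0)"
  by transfer auto

lemma parity_part_same [simp]: "parity_part p (parity_part p f) = parity_part p f"
  by transfer auto

lemma parity_part_plus: "parity_part p (f + g) = parity_part p f + parity_part p g"
  by (rule grassmann_eqI) (simp add: parity_part.rep_eq plus_grassmann.rep_eq)

lemma parity_part_zero [simp]: "parity_part p 0 = 0"
  by (rule grassmann_eqI) (simp add: parity_part.rep_eq zero_grassmann.rep_eq)

lemma parity_part_minus: "parity_part p (- f) = - parity_part p f"
  by (rule grassmann_eqI) (simp add: parity_part.rep_eq uminus_grassmann.rep_eq)

lemma parity_part_diff: "parity_part p (f - g) = parity_part p f - parity_part p g"
  by (rule grassmann_eqI) (simp add: parity_part.rep_eq minus_grassmann.rep_eq)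

lemma parity_part_zsgn: "parity_part p (zsgn i * f) = zsgn i * parity_part p f"
  by (cases i) (simp_all add: zsgn_def parity_part_minus)

lemma parity_part_scale: "parity_part p (sp_scale c f) = sp_scale c (parity_part p f)"
  by (rule grassmann_eqI) (simp add: parity_part.rep_eq gcoeff_sp_scale)

lemma parity_part_other: "parity_part p f = f \<Longrightarrow> parity_part q f = (if p = q then f else 0)"
  by (metis parity_part_parity_part)

lemma parity_part_mult:
  fixes f g :: "('v::linorder, 'r::comm_ring_1) grassmann"
  assumes "parity_part p f = f" "parity_part q g = g"
  shows "parity_part (p + q) (f * g) = f * g"
proof (rule grassmann_eqI)
  fix S :: "'v set" assume S: "finite S"
  have fp: "of_nat (card T) = p" if "gcoeff f T \<noteq> 0" for T
    using that parity_part.rep_eq[of p f] assms by (metis (full_types))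
  have gq: "of_nat (card T) = q" if "gcoeff g T \<noteq> 0" for T
    using that parity_part.rep_eq[of q g] assms by (metis (full_types))
  have "of_nat (card S) = p + q" if "gcoeff (f * g) S \<noteq> 0"
  proof -
    from that obtain T where T: "T \<in> Pow S" "shuffle_sgn T (S - T) * gcoeff f T * gcoeff g (S - T) \<noteq> 0"
      unfolding times_grassmann.rep_eq by (rule sum.not_neutral_contains_not_neutral)
    then have "of_nat (card T) = p" "of_nat (card (S - T)) = q"
      by (metis fp gq mult_zero_left mult_zero_right)+
    moreover have "card S = card T + card (S - T)"
      using T S by (metis PowD card_Diff_subset card_mono finite_subset le_add_diff_inverse)
    ultimately show ?thesis by simp
  qed
  then show "gcoeff (parity_part (p + q) (f * g)) S = gcoeff (f * g) S"
    unfolding parity_part.rep_eq by presburger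
qed

lemma parity_part_one: "parity_part p 1 = (if p = 0 then 1 else 0)"
  by (rule grassmann_eqI) (auto simp: parity_part.rep_eq one_grassmann.rep_eq zero_grassmann.rep_eq)

lemma parity_part_deriv: "sp_deriv i j (parity_part p f) = parity_part (p + i) (sp_deriv i j f)"
proof (rule grassmann_eqI)
  fix S :: "int set" assume S: "finite S"
  have "gcoeff (odd_deriv j (parity_part p f)) S = gcoeff (parity_part (p + 1) (odd_deriv j f)) S"
    using S by (cases p; cases "of_nat (card S) :: bit") 
      (auto simp: odd_deriv.rep_eq parity_part.rep_eq)
  then show "gcoeff (sp_deriv i j (parity_part p f)) S = gcoeff (parity_part (p + i) (sp_deriv i j f)) S"
    by (cases i) (auto simp: sp_deriv_def even_deriv.rep_eq parity_part.rep_eq)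
qed

lemma sp_deriv_add: "sp_deriv i j (f + g) = sp_deriv i j f + sp_deriv i j g"
  by (rule grassmann_eqI)
    (auto simp: sp_deriv_def even_deriv.rep_eq odd_deriv.rep_eq plus_grassmann.rep_eq poly_deriv_add algebra_simps)

lemma sp_deriv_zero [simp]: "sp_deriv i j 0 = 0"
  by (rule grassmann_eqI) (auto simp: sp_deriv_def even_deriv.rep_eq odd_deriv.rep_eq zero_grassmann.rep_eq)

lemma sp_deriv_scale_one [simp]: "sp_deriv i j (sp_scale c 1) = 0"
  by (rule grassmann_eqI)
    (auto simp: sp_deriv_def even_deriv.rep_eq odd_deriv.rep_eq zero_grassmann.rep_eq gcoeff_sp_scale
      one_grassmann.rep_eq poly_deriv_single)

lemma sp_deriv_scale: "sp_deriv i j (sp_scale c f) = sp_scale c (sp_deriv i j f)"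
proof -
  have "sp_deriv i j (sp_scale c 1 * f) = sp_scale c 1 * sp_deriv i j f"
    by (subst sp_deriv_mult[of 0]) (simp_all add: parity_part_scale parity_part_one zsgn_def)
  then show ?thesis by (simp add: sp_scale_mult_left)
qed

subsection \<open>Polynomials in a given set of variables\<close>

definition coeffs_in :: "'v set \<Rightarrow> (('v \<Rightarrow>\<^sub>0 nat) \<Rightarrow>\<^sub>0 'k::comm_ring_1) set" where
  "coeffs_in V = {p. \<forall>m\<in>Poly_Mapping.keys p. Poly_Mapping.keys m \<subseteq> V}"

lemma coeffs_in_zero [simp]: "0 \<in> coeffs_in V" and coeffs_in_one [simp]: "1 \<in> coeffs_in V"
  and coeffs_in_uminus: "p \<in> coeffs_in V \<Longrightarrow> - p \<in> coeffs_in V"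
  and coeffs_in_const: "Poly_Mapping.single 0 c \<in> coeffs_in V"
  by (auto simp: coeffs_in_def keys_minus split: if_splits)

lemma coeffs_in_add: "p \<in> coeffs_in V \<Longrightarrow> q \<in> coeffs_in V \<Longrightarrow> p + q \<in> coeffs_in V"
  using keys_add[of p q] by (auto simp: coeffs_in_def)

lemma coeffs_in_sum: "(\<And>x. x \<in> X \<Longrightarrow> h x \<in> coeffs_in V) \<Longrightarrow> (\<Sum>x\<in>X. h x) \<in> coeffs_in V"
  by (induction X rule: infinite_finite_induct) (auto intro: coeffs_in_add)

lemma coeffs_in_mult:
  assumes "p \<in> coeffs_in V" "q \<in> coeffs_in V" shows "p * q \<in> coeffs_in V"
  unfolding coeffs_in_def
proof safe
  fix m x assume m: "m \<in> Poly_Mapping.keys (p * q)" and x: "x \<in> Poly_Mapping.keys m"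
  from m keys_mult[of p q] obtain a b where ab: "m = a + b" "a \<in> Poly_Mapping.keys p" "b \<in> Poly_Mapping.keys q"
    by auto
  with x keys_add[of a b] assms show "x \<in> V" by (auto simp: coeffs_in_def)
qed

lemma coeffs_in_deriv:
  assumes "p \<in> coeffs_in V" shows "poly_deriv v p \<in> coeffs_in V"
  unfolding coeffs_in_def
proof safe
  fix m x assume m: "m \<in> Poly_Mapping.keys (poly_deriv v p)" and x: "x \<in> Poly_Mapping.keys m"
  have "m + Poly_Mapping.single v 1 \<in> Poly_Mapping.keys p"
    using m by (auto simp: in_keys_iff poly_deriv.rep_eq)
  moreover have "x \<in> Poly_Mapping.keys (m + Poly_Mapping.single v 1)"
    using x by (auto simp: in_keys_iff lookup_add)
  ultimately show "x \<in> V" using assms by (auto simp: coeffs_in_def)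
qed

lemma coeffs_in_deriv_zero:
  assumes "p \<in> coeffs_in V" "v \<notin> V" shows "poly_deriv v p = 0"
proof (rule poly_mapping_eqI)
  fix m
  have "v \<in> Poly_Mapping.keys (m + Poly_Mapping.single v (1::nat))" by (auto simp: in_keys_iff lookup_add)
  with assms have "m + Poly_Mapping.single v 1 \<notin> Poly_Mapping.keys p" by (auto simp: coeffs_in_def)
  then show "Poly_Mapping.lookup (poly_deriv v p) m = Poly_Mapping.lookup 0 m"
    by (simp add: poly_deriv.rep_eq in_keys_iff)
qed

text \<open>Both parities together (see \<open>superpolys_sum_eq\<close>), as a condition on each coefficient.\<close>

definition spolys :: "(bit \<Rightarrow> int set) \<Rightarrow> 'k::comm_ring_1 superpoly set" where
  "spolys I = {f. \<forall>S. gcoeff f S \<noteq> 0 \<longrightarrow> S \<subseteq> I 1 \<and> gcoeff f S \<in> coeffs_in (I 0)}"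

lemma superpolys_iff: "f \<in> superpolys I p \<longleftrightarrow> f \<in> spolys I \<and> parity_part p f = f"
  by (auto simp: superpolys_def spolys_def coeffs_in_def)

lemma spolys_coeff: "f \<in> spolys I \<Longrightarrow> gcoeff f S \<in> coeffs_in (I 0)"
  by (cases "gcoeff f S = 0") (auto simp: spolys_def)

lemma spolys_zero [simp]: "0 \<in> spolys I"
  by (simp add: spolys_def zero_grassmann.rep_eq)

lemma spolys_one [simp]: "1 \<in> spolys I"
  by (simp add: spolys_def one_grassmann.rep_eq)

lemma spolys_add: "f \<in> spolys I \<Longrightarrow> g \<in> spolys I \<Longrightarrow> f + g \<in> spolys I"
  unfolding spolys_def mem_Collect_eq plus_grassmann.rep_eq
  by (metis add.left_neutral add.right_neutral coeffs_in_add)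

lemma spolys_uminus: "f \<in> spolys I \<Longrightarrow> - f \<in> spolys I"
  by (auto simp: spolys_def uminus_grassmann.rep_eq coeffs_in_uminus)

lemma spolys_sum: "(\<And>x. x \<in> X \<Longrightarrow> h x \<in> spolys I) \<Longrightarrow> (\<Sum>x\<in>X. h x) \<in> spolys I"
  by (induction X rule: infinite_finite_induct) (auto intro: spolys_add)

lemma spolys_scale: "f \<in> spolys I \<Longrightarrow> sp_scale c f \<in> spolys I"
  by (auto simp: spolys_def gcoeff_sp_scale intro!: coeffs_in_mult coeffs_in_const dest!: mult_not_zero)

lemma spolys_zsgn: "f \<in> spolys I \<Longrightarrow> zsgn i * f \<in> spolys I"
  by (cases i) (auto simp: zsgn_def spolys_uminus)

lemma spolys_parity_part: "f \<in> spolys I \<Longrightarrow> parity_part p f \<in> spolys I"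
  by (auto simp: spolys_def parity_part.rep_eq)

lemma shuffle_sgn_coeffs_in: "shuffle_sgn T U \<in> coeffs_in V"
  using shuffle_sgn_cases[of T U] by (metis coeffs_in_one coeffs_in_uminus)

lemma spolys_mult:
  assumes f: "f \<in> spolys I" and g: "g \<in> spolys I" shows "f * g \<in> spolys I"
  unfolding spolys_def mem_Collect_eq
proof (intro allI impI conjI)
  fix S assume nz: "gcoeff (f * g) S \<noteq> 0"
  then obtain T where "T \<in> Pow S" and nz: "shuffle_sgn T (S - T) * gcoeff f T * gcoeff g (S - T) \<noteq> 0"
    unfolding times_grassmann.rep_eq by (rule sum.not_neutral_contains_not_neutral)
  have "gcoeff f T \<noteq> 0" "gcoeff g (S - T) \<noteq> 0"
    using nz by (metis mult_zero_left mult_zero_right)+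
  with f g have "T \<subseteq> I 1" "S - T \<subseteq> I 1" unfolding spolys_def by blast+
  then show "S \<subseteq> I 1" by blast
  show "gcoeff (f * g) S \<in> coeffs_in (I 0)"
    unfolding times_grassmann.rep_eq
    by (rule coeffs_in_sum, rule coeffs_in_mult, rule coeffs_in_mult, rule shuffle_sgn_coeffs_in,
      rule spolys_coeff[OF f], rule spolys_coeff[OF g])
qed

lemma spolys_deriv:
  assumes f: "f \<in> spolys I" shows "sp_deriv i j f \<in> spolys I"
  unfolding spolys_def mem_Collect_eq
proof (intro allI impI)
  fix S assume nz: "gcoeff (sp_deriv i j f) S \<noteq> 0"
  show "S \<subseteq> I 1 \<and> gcoeff (sp_deriv i j f) S \<in> coeffs_in (I 0)"
  proof (cases "i = 0")
    case True
    with nz have eq: "gcoeff (sp_deriv i j f) S = poly_deriv j (gcoeff f S)" and "gcoeff f S \<noteq> 0"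
      by (auto simp: sp_deriv_def even_deriv.rep_eq)
    then show ?thesis using f by (auto simp: spolys_def coeffs_in_deriv)
  next
    case False
    with nz have eq: "gcoeff (sp_deriv i j f) S = shuffle_sgn {j} S * gcoeff f (insert j S)"
      and "gcoeff f (insert j S) \<noteq> 0"
      by (auto simp: sp_deriv_def odd_deriv.rep_eq split: if_splits dest!: mult_not_zero)
    then show ?thesis using f
      by (auto simp: spolys_def intro!: coeffs_in_mult shuffle_sgn_coeffs_in)
  qed
qed

lemma spolys_var: "j \<in> I i \<Longrightarrow> sp_var i j \<in> spolys I"
  by (cases i) (auto simp: spolys_def sp_var_def gconst.rep_eq theta.rep_eq coeffs_in_def split: if_splits)

lemma parity_part_var: "parity_part p (sp_var i j) = (if p = i then sp_var i j else 0)"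
  by (rule grassmann_eqI; cases i; cases p)
    (auto simp: sp_var_def gconst.rep_eq theta.rep_eq parity_part.rep_eq zero_grassmann.rep_eq)

lemma superpolys_var: "j \<in> I i \<Longrightarrow> sp_var i j \<in> superpolys I i"
  by (simp add: superpolys_iff spolys_var parity_part_var)

lemma superpolys_const: "sp_scale c 1 \<in> superpolys I 0"
  by (simp add: superpolys_iff spolys_scale parity_part_scale parity_part_one)

lemma superpolys_add: "f \<in> superpolys I p \<Longrightarrow> g \<in> superpolys I p \<Longrightarrow> f + g \<in> superpolys I p"
  and superpolys_zero: "0 \<in> superpolys I p"
  and superpolys_scale: "f \<in> superpolys I p \<Longrightarrow> sp_scale c f \<in> superpolys I p"
  by (auto simp: superpolys_iff spolys_add parity_part_plus spolys_scale parity_part_scale)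

lemma superpolys_mult: "f \<in> superpolys I p \<Longrightarrow> g \<in> superpolys I q \<Longrightarrow> f * g \<in> superpolys I (p + q)"
  using parity_part_mult[of p f q g] by (simp add: superpolys_iff spolys_mult)

lemma sp_scale_sum_left: "sp_scale (\<Sum>x\<in>X. h x) f = (\<Sum>x\<in>X. sp_scale (h x) f)"
  by (induction X rule: infinite_finite_induct) (auto simp: sp_scale_add_left)

lemma superpolys_zsgn: "f \<in> superpolys I p \<Longrightarrow> zsgn i * f \<in> superpolys I p"
  using superpolys_scale[of f I p "zsgn i"] by simp

lemma superpolys_sum: "(\<And>x. x \<in> X \<Longrightarrow> h x \<in> superpolys I p) \<Longrightarrow> (\<Sum>x\<in>X. h x) \<in> superpolys I p"
  by (induction X rule: infinite_finite_induct) (auto intro: superpolys_add superpolys_zero)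

lemma superpolys_uminus: "f \<in> superpolys I p \<Longrightarrow> - f \<in> superpolys I p"
  using superpolys_scale[of f I p "- 1"] by (simp only: sp_scale_minus_left sp_scale_one)

lemma superpolys_deriv: "f \<in> superpolys I p \<Longrightarrow> sp_deriv i j f \<in> superpolys I (p + i)"
  using parity_part_deriv[of i j p f] spolys_deriv[of f I i j] by (simp only: superpolys_iff)

lemma superpolys_sum_eq: "superpolys I 0 + superpolys I 1 = spolys I"
proof safe
  fix f assume "f \<in> superpolys I 0 + superpolys I 1"
  then show "f \<in> spolys I" by (auto simp: superpolys_iff elim!: set_plus_elim intro: spolys_add)
next
  fix f :: "'a superpoly" assume "f \<in> spolys I"
  then have "parity_part 0 f + parity_part 1 f \<in> superpolys I 0 + superpolys I 1"
    by (intro set_plus_intro) (auto simp: superpolys_iff spolys_parity_part)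
  then show "f \<in> superpolys I 0 + superpolys I 1" by (simp add: parity_part_add)
qed

lemma finite_deriv_support: "finite {j. sp_deriv i j f \<noteq> 0}"
proof (cases i)
  case zero
  let ?K = "\<Union>S\<in>{S. gcoeff f S \<noteq> 0}. \<Union>m\<in>Poly_Mapping.keys (gcoeff f S). Poly_Mapping.keys m"
  have "finite {S. gcoeff f S \<noteq> 0}" using gcoeff[of f] by auto
  then have "finite ?K" by auto
  moreover have "{j. sp_deriv i j f \<noteq> 0} \<subseteq> ?K"
  proof safe
    fix j assume "sp_deriv i j f \<noteq> 0"
    then obtain S where "poly_deriv j (gcoeff f S) \<noteq> 0"
      using zero by (auto simp: sp_deriv_def even_deriv.rep_eq elim!: grassmann_nonzeroE)
    moreover then have "gcoeff f S \<noteq> 0" by auto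
    ultimately show "j \<in> ?K"
      using coeffs_in_deriv_zero[of "gcoeff f S" "\<Union>m\<in>Poly_Mapping.keys (gcoeff f S). Poly_Mapping.keys m" j]
      by (force simp: coeffs_in_def)
  qed
  ultimately show ?thesis by (rule rev_finite_subset)
next
  case one
  have "finite (\<Union>{S. gcoeff f S \<noteq> 0})"
    using gcoeff[of f] by (intro finite_Union) (use gcoeff_infinite in blast)+
  moreover have "{j. sp_deriv i j f \<noteq> 0} \<subseteq> \<Union>{S. gcoeff f S \<noteq> 0}"
  proof safe
    fix j assume "sp_deriv i j f \<noteq> 0"
    then obtain S where "gcoeff (odd_deriv j f) S \<noteq> 0"
      using one by (auto simp: sp_deriv_def elim!: grassmann_nonzeroE)
    then have "gcoeff f (insert j S) \<noteq> 0"
      unfolding odd_deriv.rep_eq by (metis mult_zero_right)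
    then show "j \<in> \<Union>{S. gcoeff f S \<noteq> 0}" by auto
  qed
  ultimately show ?thesis by (rule rev_finite_subset)
qed


subsection \<open>Generation by the variables\<close>

text \<open>The monomial \<open>c \<theta>\<^sub>S\<close>.\<close>

lift_definition gmonom :: "'v set \<Rightarrow> 'r::zero \<Rightarrow> ('v, 'r) grassmann" is
  "\<lambda>S c T. if T = S \<and> finite S then c else 0"
proof safe
  fix S :: "'v set" and c :: 'r
  show "finite {T. (if T = S \<and> finite S then c else 0) \<noteq> 0}"
    by (rule finite_subset[of _ "{S}"]) auto
qed auto

lemma gmonom_empty: "gmonom {} c = gconst c"
  by (rule grassmann_eqI) (simp add: gmonom.rep_eq gconst.rep_eq)

lemma gmonom_decomposition: "f = (\<Sum>S\<in>{S. gcoeff f S \<noteq> 0}. gmonom S (gcoeff f S))"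
proof (rule grassmann_eqI)
  fix T :: "'a set" assume T: "finite T"
  have fin: "finite {S. gcoeff f S \<noteq> 0}" using gcoeff[of f] by auto
  have "(\<Sum>S\<in>{S. gcoeff f S \<noteq> 0}. gcoeff (gmonom S (gcoeff f S)) T) =
      (\<Sum>S\<in>{S. gcoeff f S \<noteq> 0}. if S = T then gcoeff f T else 0)"
    by (intro sum.cong) (auto simp: gmonom.rep_eq T)
  then show "gcoeff f T = gcoeff (\<Sum>S\<in>{S. gcoeff f S \<noteq> 0}. gmonom S (gcoeff f S)) T"
    by (simp add: gcoeff_sum fin)
qed

text \<open>No sign occurs, since \<open>v\<close> precedes all of \<open>S\<close>.\<close>

lemma theta_mult_gmonom:
  fixes c :: "'r::comm_ring_1"
  assumes S: "finite S" and v: "\<And>w. w \<in> S \<Longrightarrow> v < w"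
  shows "theta v * gmonom S c = gmonom (insert v S) c"
proof (rule grassmann_eqI)
  fix T :: "'a set" assume T: "finite T"
  have vS: "v \<notin> S" using v by auto
  have sg: "shuffle_sgn {v} S = (1 :: 'r)"
    unfolding shuffle_sgn_def by (intro prod.neutral) (simp add: v less_not_sym)
  have "gcoeff (theta v * gmonom S c) T =
      (\<Sum>U\<in>Pow T. if U = {v} then (if T - {v} = S then c else 0) else 0)"
    unfolding times_grassmann.rep_eq
    by (intro sum.cong) (auto simp: theta.rep_eq gmonom.rep_eq S sg)
  also have "\<dots> = (if v \<in> T \<and> T - {v} = S then c else 0)"
    using T by simp
  also have "\<dots> = gcoeff (gmonom (insert v S) c) T"
    using vS S by (auto simp: gmonom.rep_eq)
  finally show "gcoeff (theta v * gmonom S c) T = gcoeff (gmonom (insert v S) c) T" .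
qed

text \<open>
  The coefficients are treated monomial by monomial, and the odd part of a monomial is built by adjoining
  smaller and smaller variables. The case of zero is separate because the odd component contains zero
  even if there are no odd variables.
\<close>

lemma superpolys_induct [consumes 1, case_names zero const var add mult]:
  fixes f :: "'k::comm_ring_1 superpoly"
  assumes f: "f \<in> superpolys I p"
    and zero: "\<And>p. Q p 0"
    and const: "\<And>c. Q 0 (sp_scale c 1)"
    and var: "\<And>i j. j \<in> I i \<Longrightarrow> Q i (sp_var i j)"
    and add: "\<And>p f g. f \<in> superpolys I p \<Longrightarrow> g \<in> superpolys I p \<Longrightarrow> Q p f \<Longrightarrow> Q p g \<Longrightarrow> Q p (f + g)"
    and mult: "\<And>p q f g. f \<in> superpolys I p \<Longrightarrow> g \<in> superpolys I q \<Longrightarrow>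
      Q p f \<Longrightarrow> Q q g \<Longrightarrow> Q (p + q) (f * g)"
  shows "Q p f"
proof -
  define R where "R p f \<longleftrightarrow> f \<in> superpolys I p \<and> Q p f" for p and f :: "'k superpoly"
  have Rc: "R 0 (sp_scale c 1)" for c by (simp add: R_def const superpolys_const)
  have Rv: "R i (sp_var i j)" if "j \<in> I i" for i j using that by (simp add: R_def var superpolys_var)
  have Ra: "R p (f + g)" if "R p f" "R p g" for p f g using that by (simp add: R_def add superpolys_add)
  have Rm: "R r (f * g)" if "R p f" "R q g" "r = p + q" for p q r f g
    unfolding that(3) using that(1,2) mult[of f p g q] superpolys_mult[of f I p g q] by (auto simp only: R_def)
  have Rz: "R p 0" for p by (simp add: R_def zero superpolys_zero)
  have Rsum: "R p (\<Sum>x\<in>X. h x)" if "\<And>x. x \<in> X \<Longrightarrow> R p (h x)" for p X and h :: "'c \<Rightarrow> 'k superpoly"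
    using that by (induction X rule: infinite_finite_induct) (auto intro: Rz Ra)
  have monom: "R 0 (gconst (Poly_Mapping.single m c))" if "Poly_Mapping.keys m \<subseteq> I 0" for m and c :: 'k
    using that
  proof (induction m arbitrary: c rule: poly_mapping_induct_single)
    case zero
    then show ?case using Rc[of c] by (simp add: sp_scale_def)
  next
    case (single j n)
    then show ?case
    proof (induction n arbitrary: c)
      case 0
      then show ?case using Rc[of c] by (simp add: sp_scale_def)
    next
      case (Suc n)
      then have j: "j \<in> I 0" by simp
      have IH: "R 0 (gconst (Poly_Mapping.single (Poly_Mapping.single j n) c))"
        by (rule Suc.IH) (use j in \<open>auto split: if_splits\<close>)
      have "(gconst (Poly_Mapping.single (Poly_Mapping.single j (Suc n)) c) :: 'k superpoly) =
          sp_var 0 j * gconst (Poly_Mapping.single (Poly_Mapping.single j n) c)"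
        by (simp add: sp_var_def mult_single flip: gconst_times single_add)
      then show ?case using Rm[OF Rv[OF j] IH] by simp
    qed
  next
    case (add p q)
    have "Poly_Mapping.keys (p + q) = Poly_Mapping.keys p \<union> Poly_Mapping.keys q"
      by (auto simp: in_keys_iff lookup_add)
    with add have IH: "R 0 (gconst (Poly_Mapping.single p 1))" "R 0 (gconst (Poly_Mapping.single q c))"
      by auto
    have "(gconst (Poly_Mapping.single (p + q) c) :: 'k superpoly) =
        gconst (Poly_Mapping.single p 1) * gconst (Poly_Mapping.single q c)"
      by (simp add: mult_single flip: gconst_times)
    then show ?case using Rm[OF IH] by (simp only: add_0)
  qed
  have coeff: "R 0 (gconst c)" if "c \<in> coeffs_in (I 0)" for c
  proof -
    have "c = (\<Sum>m\<in>Poly_Mapping.keys c. Poly_Mapping.single m (Poly_Mapping.lookup c m))"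
      by (rule poly_mapping_eqI) (simp add: lookup_sum lookup_single when_def in_keys_iff)
    then have "(gconst c :: 'k superpoly) =
        gconst (\<Sum>m\<in>Poly_Mapping.keys c. Poly_Mapping.single m (Poly_Mapping.lookup c m))"
      by (rule arg_cong)
    also have "\<dots> = (\<Sum>m\<in>Poly_Mapping.keys c. gconst (Poly_Mapping.single m (Poly_Mapping.lookup c m)))"
      by (rule grassmann_eqI) (simp add: gcoeff_sum gconst.rep_eq)
    finally show ?thesis using that by (auto simp: coeffs_in_def intro!: Rsum monom)
  qed
  have mon: "R (of_nat (card S)) (gmonom S c)" if "finite S" "S \<subseteq> I 1" "c \<in> coeffs_in (I 0)" for S c
    using that
  proof (induction S rule: finite_linorder_min_induct)
    case empty
    then show ?case by (simp add: gmonom_empty coeff)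
  next
    case (insert v S)
    then have "R 1 (theta v)" "R (of_nat (card S)) (gmonom S c)" using Rv[of v 1] by (auto simp: sp_var_def)
    then have "R (of_nat (card (insert v S))) (theta v * gmonom S c)"
      by (rule Rm) (use insert in \<open>auto simp: card_insert_if\<close>)
    then show ?case using insert by (simp add: theta_mult_gmonom)
  qed
  have "R p (\<Sum>S\<in>{S. gcoeff f S \<noteq> 0}. gmonom S (gcoeff f S))"
  proof (rule Rsum)
    fix S assume "S \<in> {S. gcoeff f S \<noteq> 0}"
    then have S: "gcoeff f S \<noteq> 0" by simp
    then have "finite S" using gcoeff_infinite by blast
    moreover have "of_nat (card S) = p"
      using S f parity_part.rep_eq[of p f] unfolding superpolys_iff by (metis (full_types))
    ultimately show "R p (gmonom S (gcoeff f S))"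
      using mon[of S "gcoeff f S"] S f by (auto simp: superpolys_iff spolys_def)
  qed
  then show ?thesis by (simp add: R_def flip: gmonom_decomposition)
qed

text \<open>
  The \<open>i\<close>-th power of the parity automorphism; it produces the sign of exchanging the argument with an
  element of parity \<open>i\<close>.
\<close>

definition ptw :: "bit \<Rightarrow> ('v, 'r::comm_ring_1) grassmann \<Rightarrow> ('v::linorder, 'r) grassmann" where
  "ptw i f = parity_part 0 f + zsgn i * parity_part 1 f"

lemma ptw_homogeneous: "parity_part p f = f \<Longrightarrow> ptw i f = zsgn (i * p) * f"
  using parity_part_other[of p f 0] parity_part_other[of p f 1]
  by (cases p) (auto simp: ptw_def zsgn_def)

lemma ptw_add: "ptw i (f + g) = ptw i f + ptw i g"
  by (simp add: ptw_def parity_part_plus algebra_simps)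

lemma ptw_zero [simp]: "ptw i 0 = 0" by (simp add: ptw_def)

lemma ptw_0 [simp]: "ptw 0 f = f" by (simp add: ptw_def parity_part_add zsgn_def)

lemma ptw_sum: "ptw i (\<Sum>x\<in>X. h x) = (\<Sum>x\<in>X. ptw i (h x))"
  by (induction X rule: infinite_finite_induct) (auto simp: ptw_add)

lemma ptw_scale: "ptw i (sp_scale c f) = sp_scale c (ptw i f)"
  by (simp add: ptw_def parity_part_scale sp_scale_add_right zsgn_def sp_scale_minus_right)

lemma ptw_one: "ptw i 1 = 1"
  by (simp add: ptw_def parity_part_one)

lemma ptw_ptw: "ptw i (ptw j f) = ptw (i + j) f"
  by (cases i; cases j)
    (simp_all add: ptw_def parity_part_plus parity_part_zsgn parity_part_parity_part zsgn_def parity_part_minus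
      parity_part_add parity_part_diff)

lemma ptw_mult:
  fixes f g :: "('v::linorder, 'r::comm_ring_1) grassmann"
  shows "ptw i (f * g) = ptw i f * ptw i g"
proof -
  let ?p = "\<lambda>p. parity_part p f" and ?q = "\<lambda>p. parity_part p g"
  have h: "ptw i (?p p * ?q q) = ptw i (?p p) * ptw i (?q q)" for p q
  proof -
    have "ptw i (?p p * ?q q) = zsgn (i * (p + q)) * (?p p * ?q q)"
      by (rule ptw_homogeneous, rule parity_part_mult) simp_all
    also have "\<dots> = (zsgn (i * p) * ?p p) * (zsgn (i * q) * ?q q)"
      by (cases i; cases p; cases q) (simp_all add: zsgn_def)
    also have "zsgn (i * p) * ?p p = ptw i (?p p)" by (rule ptw_homogeneous[symmetric]) simp
    also have "zsgn (i * q) * ?q q = ptw i (?q q)" by (rule ptw_homogeneous[symmetric]) simp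
    finally show ?thesis .
  qed
  have "ptw i ((?p 0 + ?p 1) * (?q 0 + ?q 1)) = ptw i (?p 0 + ?p 1) * ptw i (?q 0 + ?q 1)"
    by (simp add: distrib_left distrib_right ptw_add h)
  then show ?thesis by (simp add: parity_part_add)
qed

lemma spolys_ptw: "f \<in> spolys I \<Longrightarrow> ptw i f \<in> spolys I"
  by (simp add: ptw_def spolys_add spolys_zsgn spolys_parity_part)

lemma vector_space_sp_scale: "vector_space (sp_scale :: 'k::field \<Rightarrow> _)"
  by unfold_locales (simp_all add: sp_scale_add_right sp_scale_add_left sp_scale_scale sp_scale_one)

lemma super_commutative_superpolys:
  "super_commutative_algebra (sp_scale :: 'k::field \<Rightarrow> _) (superpolys I)"
proof -
  interpret vector_space "sp_scale :: 'k \<Rightarrow> _" by (rule vector_space_sp_scale)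
  have inter: "superpolys I 0 \<inter> superpolys I 1 = {0 :: 'k superpoly}"
  proof safe
    fix f :: "'k superpoly"
    assume "f \<in> superpolys I 0" "f \<in> superpolys I 1"
    then have "parity_part 0 f = f" "parity_part 1 f = f" by (auto simp: superpolys_iff)
    then show "f = 0" using parity_part_other[of 0 f 1] by simp
  qed (auto simp: superpolys_zero)
  have comm: "f * g = sp_scale (zsgn (i * j)) (g * f)"
    if "f \<in> superpolys I i" "g \<in> superpolys I j" for f g :: "'k superpoly" and i j
    unfolding sp_scale_zsgn using that by (intro super_commute) (simp_all only: superpolys_iff)
  show ?thesis
    by (intro super_commutative_algebra.intro z2_graded_algebra.intro vector_space_sp_scale
        z2_graded_algebra_axioms.intro super_commutative_algebra_axioms.intro inter comm)
      (auto simp: subspace_def superpolys_zero superpolys_add superpolys_scale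
        sp_scale_mult_left sp_scale_mult_right superpolys_mult)
qed

section \<open>Superbrackets on supersymmetric polynomials\<close>

text \<open>The axioms of a Poisson superbracket other than the Jacobi identity.\<close>

locale superbracket =
  fixes I :: "bit \<Rightarrow> int set" and br :: "'k::field superpoly \<Rightarrow> 'k superpoly \<Rightarrow> 'k superpoly"
  assumes br_add_left: "u \<in> spolys I \<Longrightarrow> v \<in> spolys I \<Longrightarrow> w \<in> spolys I \<Longrightarrow> br (u + v) w = br u w + br v w"
    and br_add_right: "u \<in> spolys I \<Longrightarrow> v \<in> spolys I \<Longrightarrow> w \<in> spolys I \<Longrightarrow> br w (u + v) = br w u + br w v"
    and br_scale_left: "u \<in> spolys I \<Longrightarrow> v \<in> spolys I \<Longrightarrow> br (sp_scale c u) v = sp_scale c (br u v)"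
    and br_scale_right: "u \<in> spolys I \<Longrightarrow> v \<in> spolys I \<Longrightarrow> br u (sp_scale c v) = sp_scale c (br u v)"
    and br_grade: "u \<in> superpolys I p \<Longrightarrow> v \<in> superpolys I q \<Longrightarrow> br u v \<in> superpolys I (p + q)"
    and br_skew: "u \<in> superpolys I p \<Longrightarrow> v \<in> superpolys I q \<Longrightarrow> br u v = - (zsgn (p * q) * br v u)"
    and br_leibniz: "u \<in> superpolys I p \<Longrightarrow> v \<in> superpolys I q \<Longrightarrow> w \<in> spolys I \<Longrightarrow>
      br u (v * w) = br u v * w + zsgn (p * q) * (v * br u w)"
begin

lemma in_spolys: "u \<in> superpolys I p \<Longrightarrow> u \<in> spolys I"
  by (simp add: superpolys_iff)

lemma br_spolys: "u \<in> superpolys I p \<Longrightarrow> v \<in> superpolys I q \<Longrightarrow> br u v \<in> spolys I"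
  by (rule in_spolys, rule br_grade)

lemma br_minus_left: "u \<in> spolys I \<Longrightarrow> v \<in> spolys I \<Longrightarrow> br (- u) v = - br u v"
  using br_scale_left[of u v "- 1"] by (simp add: sp_scale_minus_left sp_scale_one)

lemma br_minus_right: "u \<in> spolys I \<Longrightarrow> v \<in> spolys I \<Longrightarrow> br u (- v) = - br u v"
  using br_scale_right[of u v "- 1"] by (simp add: sp_scale_minus_left sp_scale_one)

lemma br_zsgn: "u \<in> spolys I \<Longrightarrow> v \<in> spolys I \<Longrightarrow> br (zsgn i * u) v = zsgn i * br u v"
    "u \<in> spolys I \<Longrightarrow> v \<in> spolys I \<Longrightarrow> br u (zsgn i * v) = zsgn i * br u v"
  by (auto simp: zsgn_def br_minus_left br_minus_right)

lemma br_one: "u \<in> superpolys I p \<Longrightarrow> br u 1 = 0"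
  using br_leibniz[of u p 1 0 1] superpolys_const[of 1 I] by (simp add: zsgn_def sp_scale_one)

definition jac :: "bit \<Rightarrow> bit \<Rightarrow> 'k superpoly \<Rightarrow> 'k superpoly \<Rightarrow> 'k superpoly \<Rightarrow> 'k superpoly" where
  "jac p q u v w = br u (br v w) - br (br u v) w - zsgn (p * q) * br v (br u w)"

text \<open>The Jacobiator inherits skew symmetry, so that every argument can be moved to the last place.\<close>

lemma jac_swap_left:
  assumes "u \<in> superpolys I p" "v \<in> superpolys I q" "w \<in> superpolys I r"
  shows "jac q p v u w = - (zsgn (p * q) * jac p q u v w)"
proof -
  have "br (br v u) w = - (zsgn (p * q) * br (br u v) w)"
    using assms by (subst br_skew[of v q u p]) 
      (simp_all add: mult.commute br_minus_left br_zsgn spolys_zsgn br_spolys in_spolys)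
  then show ?thesis
    by (cases p; cases q) (simp_all add: jac_def zsgn_def)
qed

lemma jac_swap_right:
  assumes u: "u \<in> superpolys I p" and v: "v \<in> superpolys I q" and w: "w \<in> superpolys I r"
  shows "jac p r u w v = - (zsgn (q * r) * jac p q u v w)"
proof -
  note m = in_spolys[OF u] in_spolys[OF v] in_spolys[OF w] br_spolys[OF u v] br_spolys[OF v w] br_spolys[OF u w]
  have 1: "br u (br w v) = - (zsgn (q * r) * br u (br v w))"
    using m by (subst br_skew[OF w v]) (simp add: mult.commute br_minus_right br_zsgn spolys_zsgn)
  have 2: "br (br u w) v = - (zsgn ((p + r) * q) * br v (br u w))"
    by (rule br_skew[OF br_grade[OF u w] v])
  have 3: "br w (br u v) = - (zsgn (r * (p + q)) * br (br u v) w)"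
    by (rule br_skew[OF w br_grade[OF u v]])
  show ?thesis
    unfolding jac_def 1 2 3 by (cases p; cases q; cases r) (simp_all add: zsgn_def)
qed

text \<open>
  In its last argument, the Jacobiator is the supercommutator of two inner superderivations minus a third
  one, and a supercommutator of superderivations is a superderivation.
\<close>

lemma jac_derivation:
  assumes u: "u \<in> superpolys I p" and v: "v \<in> superpolys I q"
    and w: "w \<in> superpolys I r" and w': "w' \<in> superpolys I r'"
  shows "jac p q u v (w * w') = jac p q u v w * w' + zsgn ((p + q) * r) * (w * jac p q u v w')"
proof -
  note g = br_grade[OF u v] br_grade[OF u w] br_grade[OF v w] br_grade[OF u w'] br_grade[OF v w']
  note m = in_spolys[OF u] in_spolys[OF v] in_spolys[OF w] in_spolys[OF w'] g[THEN in_spolys]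
  have 1: "br u (br v (w * w')) = br u (br v w) * w' + zsgn (p * (q + r)) * (br v w * br u w')
      + zsgn (q * r) * (br u w * br v w' + zsgn (p * r) * (w * br u (br v w')))"
    using m by (simp add: br_leibniz[OF v w] br_add_right spolys_mult spolys_zsgn br_zsgn
        br_leibniz[OF u g(3)] br_leibniz[OF u w])
  have 2: "br v (br u (w * w')) = br v (br u w) * w' + zsgn (q * (p + r)) * (br u w * br v w')
      + zsgn (p * r) * (br v w * br u w' + zsgn (q * r) * (w * br v (br u w')))"
    using m by (simp add: br_leibniz[OF u w] br_add_right spolys_mult spolys_zsgn br_zsgn
        br_leibniz[OF v g(2)] br_leibniz[OF v w])
  have 3: "br (br u v) (w * w') = br (br u v) w * w' + zsgn ((p + q) * r) * (w * br (br u v) w')"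
    by (rule br_leibniz[OF g(1) w in_spolys[OF w']])
  show ?thesis
    unfolding jac_def 1 2 3
    by (cases p; cases q; cases r) (simp_all add: zsgn_def algebra_simps)
qed

lemma jac_add:
  assumes u: "u \<in> superpolys I p" and v: "v \<in> superpolys I q"
    and w: "w \<in> superpolys I r" and w': "w' \<in> superpolys I r"
  shows "jac p q u v (w + w') = jac p q u v w + jac p q u v w'"
proof -
  note g = br_grade[OF u v] br_grade[OF u w] br_grade[OF v w] br_grade[OF u w'] br_grade[OF v w']
  note m = in_spolys[OF u] in_spolys[OF v] in_spolys[OF w] in_spolys[OF w'] g[THEN in_spolys]
  show ?thesis using m by (simp add: jac_def br_add_right distrib_left)
qed

lemma jac_generated:
  assumes u: "u \<in> superpolys I p" and v: "v \<in> superpolys I q"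
    and gen: "\<And>i j. j \<in> I i \<Longrightarrow> jac p q u v (sp_var i j) = 0"
    and w: "w \<in> superpolys I r"
  shows "jac p q u v w = 0"
proof -
  have c: "br u' (sp_scale c 1) = 0" if "u' \<in> superpolys I p'" for u' p' c
    using br_scale_right[of u' 1 c] br_one[OF that] in_spolys[OF that] by simp
  have z: "br u' 0 = 0" if "u' \<in> superpolys I p'" for u' p'
    using c[of u' p' 0] that by simp
  show ?thesis
    using w
  proof (induction rule: superpolys_induct)
    case (zero p)
    then show ?case by (simp add: jac_def z[OF u] z[OF v] z[OF br_grade[OF u v]])
  next
    case (const a)
    then show ?case
      by (simp add: jac_def c[OF u] c[OF v] z[OF u] z[OF v] c[OF br_grade[OF u v]])
  next
    case (var i j)
    then show ?case by (rule gen)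
  next
    case (add p f g)
    then show ?case by (simp add: jac_add[OF u v])
  next
    case (mult p q f g)
    then show ?case by (simp add: jac_derivation[OF u v])
  qed
qed

text \<open>The three arguments are moved to the last place in turn, where \<open>jac_generated\<close> applies.\<close>

theorem jac_from_variables:
  assumes gen: "\<And>i j i' j' i'' j''. j \<in> I i \<Longrightarrow> j' \<in> I i' \<Longrightarrow> j'' \<in> I i'' \<Longrightarrow>
      jac i i' (sp_var i j) (sp_var i' j') (sp_var i'' j'') = 0"
    and u: "u \<in> superpolys I p" and v: "v \<in> superpolys I q" and w: "w \<in> superpolys I r"
  shows "jac p q u v w = 0"
proof -
  have 1: "jac i i' (sp_var i j) (sp_var i' j') w = 0"
    if "j \<in> I i" "j' \<in> I i'" "w \<in> superpolys I r" for i j i' j' w r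
    by (rule jac_generated[OF superpolys_var superpolys_var gen]) (use that in auto)
  have 2: "jac i q (sp_var i j) v w = 0"
    if "j \<in> I i" "v \<in> superpolys I q" "w \<in> superpolys I r" for i j q r v w
  proof (rule jac_generated[OF superpolys_var that(2) _ that(3)])
    show "jac i q (sp_var i j) v (sp_var i' j') = 0" if "j' \<in> I i'" for i' j'
      using jac_swap_right[OF superpolys_var superpolys_var \<open>v \<in> _\<close>, of j i j' i']
        1[OF \<open>j \<in> I i\<close> that \<open>v \<in> _\<close>] \<open>j \<in> I i\<close> that by simp
  qed fact
  show ?thesis
  proof (rule jac_generated[OF u v _ w])
    show "jac p q u v (sp_var i j) = 0" if "j \<in> I i" for i j
      using jac_swap_right[OF u superpolys_var v, of j i] jac_swap_left[OF superpolys_var u v, of j i]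
        2[OF that u v] that by simp
  qed
qed

theorem poisson_if_jac:
  assumes jac: "\<And>u v w p q r. u \<in> superpolys I p \<Longrightarrow> v \<in> superpolys I q \<Longrightarrow> w \<in> superpolys I r \<Longrightarrow>
    jac p q u v w = 0"
  shows "poisson_superbracket sp_scale (superpolys I) br"
proof -
  interpret super_commutative_algebra "sp_scale :: 'k \<Rightarrow> _" "superpolys I"
    by (rule super_commutative_superpolys)
  have jacobi: "br u (br v w) = br (br u v) w + zsgn (i * j) * br v (br u w)"
    if "u \<in> superpolys I i" "v \<in> superpolys I j" "w \<in> superpolys I k" for u v w i j k
    using jac[OF that] by (simp add: jac_def algebra_simps)
  show ?thesis
    by (intro poisson_superbracket.intro super_commutative_superpolys lie_superalgebra.intro
        vector_space_sp_scale lie_superalgebra_axioms.intro poisson_superbracket_axioms.intro,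
        unfold superpolys_sum_eq sp_scale_zsgn)
      (rule subspace_grade grade_Int br_add_left br_add_right br_scale_left br_scale_right
        br_grade br_skew jacobi br_leibniz; assumption)+
qed

end

lemma superbracket_cong:
  assumes "superbracket I br" "\<And>u v. u \<in> spolys I \<Longrightarrow> v \<in> spolys I \<Longrightarrow> br' u v = br u v"
  shows "superbracket I br'"
proof -
  interpret superbracket I br by fact
  note m = superpolys_iff[THEN iffD1, THEN conjunct1]
  show ?thesis
  proof
    show "br' u v \<in> superpolys I (p + q)" if "u \<in> superpolys I p" "v \<in> superpolys I q" for u v p q
      using br_grade[OF that] that m assms(2) by metis
    show "br' u v = - (zsgn (p * q) * br' v u)" if "u \<in> superpolys I p" "v \<in> superpolys I q" for u v p q
      using br_skew[OF that] that m assms(2) by metis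
    show "br' u (v * w) = br' u v * w + zsgn (p * q) * (v * br' u w)"
      if "u \<in> superpolys I p" "v \<in> superpolys I q" "w \<in> spolys I" for u v w p q
      using br_leibniz[OF that] spolys_mult[OF m that(3), OF that(2)] that m assms(2) by metis
  qed (simp_all add: assms(2) spolys_add spolys_scale br_add_left br_add_right br_scale_left br_scale_right)
qed

lemma superbracket_combination:
  assumes "superbracket I b1" "superbracket I b2"
  shows "superbracket I (\<lambda>u v. sp_scale c1 (b1 u v) + sp_scale c2 (b2 u v))"
proof -
  interpret b1: superbracket I b1 by fact
  interpret b2: superbracket I b2 by fact
  show ?thesis
  proof
    show "sp_scale c1 (b1 u v) + sp_scale c2 (b2 u v) \<in> superpolys I (p + q)"
      if "u \<in> superpolys I p" "v \<in> superpolys I q" for u v p q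
      using that by (intro superpolys_add superpolys_scale b1.br_grade b2.br_grade)
    show "sp_scale c1 (b1 u v) + sp_scale c2 (b2 u v) =
        - (zsgn (p * q) * (sp_scale c1 (b1 v u) + sp_scale c2 (b2 v u)))"
      if "u \<in> superpolys I p" "v \<in> superpolys I q" for u v p q
      unfolding b1.br_skew[OF that] b2.br_skew[OF that]
      by (cases "p * q") (simp_all add: zsgn_def sp_scale_minus_right)
    show "sp_scale c1 (b1 u (v * w)) + sp_scale c2 (b2 u (v * w)) =
        (sp_scale c1 (b1 u v) + sp_scale c2 (b2 u v)) * w +
        zsgn (p * q) * (v * (sp_scale c1 (b1 u w) + sp_scale c2 (b2 u w)))"
      if "u \<in> superpolys I p" "v \<in> superpolys I q" "w \<in> spolys I" for u v w p q
      unfolding b1.br_leibniz[OF that] b2.br_leibniz[OF that]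
      by (cases "p * q") (simp_all add: zsgn_def sp_scale_minus_right sp_scale_add_right sp_scale_diff_right
          sp_scale_mult_left sp_scale_mult_right distrib_left distrib_right)
  qed (simp_all add: b1.br_add_left b1.br_add_right b1.br_scale_left b1.br_scale_right
      b2.br_add_left b2.br_add_right b2.br_scale_left b2.br_scale_right
      sp_scale_add_right sp_scale_scale mult.commute)
qed

text \<open>
  The Jacobiator is quadratic in the bracket. On the pencil spanned by two brackets it has three
  coefficients, which are determined by the values at three members of the pencil that are pairwise
  independent. The three members used here are so because \<open>1\<close> and \<open>- 1\<close> differ in the field.
\<close>

theorem poisson_superpair_from_three:
  assumes char: "CHAR('k::field) \<noteq> 2"
    and b1: "superbracket I (b1 :: 'k superpoly \<Rightarrow> _)" and b2: "poisson_superbracket sp_scale (superpolys I) b2"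
    and sb2: "superbracket I b2"
    and plus: "poisson_superbracket sp_scale (superpolys I) (\<lambda>u v. b2 u v + b1 u v)"
    and minus: "poisson_superbracket sp_scale (superpolys I) (\<lambda>u v. b2 u v - b1 u v)"
  shows "poisson_superpair sp_scale (superpolys I) b1 b2"
proof -
  have two: "f = 0" if "f + f = 0" for f :: "'k superpoly"
  proof -
    have "(2::'k) \<noteq> 0"
    proof
      assume "(2::'k) = 0"
      then have "CHAR('k) dvd 2" by (metis of_nat_numeral of_nat_eq_0_iff_char_dvd)
      then have "CHAR('k) \<le> 2" by (rule dvd_imp_le) simp
      moreover have "CHAR('k) \<noteq> 1" by simp
      moreover have "CHAR('k) \<noteq> 0" using \<open>CHAR('k) dvd 2\<close> by (metis dvd_0_left zero_neq_numeral)
      ultimately show False using char by linarith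
    qed
    then have "f = sp_scale (inverse 2) (sp_scale 2 f)"
      by (simp add: sp_scale_scale sp_scale_one)
    also have "sp_scale 2 f = f + f"
      using sp_scale_add_left[of 1 1 f] by (simp add: sp_scale_one)
    finally show ?thesis using that by simp
  qed
  interpret b1: superbracket I b1 by fact
  interpret b2: superbracket I b2 by fact
  let ?P = "\<lambda>c1 c2 u v. sp_scale c1 (b1 u v) + sp_scale c2 (b2 u v)"
  have sup: "superbracket I (?P c1 c2)" for c1 c2
    by (rule superbracket_combination[OF b1 sb2])
  have all: "superbracket.jac (?P c1 c2) p q u v w = 0"
    if u: "u \<in> superpolys I p" and v: "v \<in> superpolys I q" and w: "w \<in> superpolys I r" for c1 c2 p q r u v w
  proof -
    note g1 = b1.br_spolys[OF u v] b1.br_spolys[OF u w] b1.br_spolys[OF v w]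
    note g2 = b2.br_spolys[OF u v] b2.br_spolys[OF u w] b2.br_spolys[OF v w]
    note m = b1.in_spolys[OF u] b1.in_spolys[OF v] b1.in_spolys[OF w] g1 g2
    \<comment> \<open>The polarized Jacobiator: the coefficient of \<open>c1 * c2\<close>.\<close>
    define mixed where "mixed = b1 u (b2 v w) + b2 u (b1 v w) - b1 (b2 u v) w - b2 (b1 u v) w
      - zsgn (p * q) * (b1 v (b2 u w) + b2 v (b1 u w))"
    have J: "superbracket.jac (?P c1 c2) p q u v w =
        sp_scale (c1 * c1) (b1.jac p q u v w) + sp_scale (c1 * c2) mixed + sp_scale (c2 * c2) (b2.jac p q u v w)"
      for c1 c2
      unfolding superbracket.jac_def[OF sup] mixed_def b1.jac_def b2.jac_def
      using m
      by (cases "p * q")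
        (simp_all add: zsgn_def b1.br_add_left b1.br_add_right b1.br_scale_left b1.br_scale_right
          b2.br_add_left b2.br_add_right b2.br_scale_left b2.br_scale_right spolys_scale
          sp_scale_add_right sp_scale_diff_right sp_scale_minus_right sp_scale_scale mult.commute algebra_simps)
    have "b2.jac p q u v w = 0"
    proof -
      interpret poisson_superbracket sp_scale "superpolys I" b2 by fact
      show ?thesis using bracket_jacobi[OF u v w] by (simp add: b2.jac_def)
    qed
    moreover have "superbracket.jac (?P 1 1) p q u v w = 0"
    proof -
      interpret poisson_superbracket sp_scale "superpolys I" "\<lambda>u v. b2 u v + b1 u v" by fact
      show ?thesis unfolding superbracket.jac_def[OF sup] using bracket_jacobi[OF u v w]
        by (simp add: sp_scale_one add.commute)
    qed
    moreover have "superbracket.jac (?P (- 1) 1) p q u v w = 0"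
    proof -
      interpret poisson_superbracket sp_scale "superpolys I" "\<lambda>u v. b2 u v - b1 u v" by fact
      show ?thesis unfolding superbracket.jac_def[OF sup] using bracket_jacobi[OF u v w]
        by (simp add: sp_scale_one sp_scale_minus_left)
    qed
    ultimately have e: "b2.jac p q u v w = 0" "b1.jac p q u v w + mixed = 0" "b1.jac p q u v w - mixed = 0"
      unfolding J by (simp_all add: sp_scale_one sp_scale_minus_left)
    then have "b1.jac p q u v w + b1.jac p q u v w = 0" by (simp add: eq_neg_iff_add_eq_0[symmetric])
    then have "b1.jac p q u v w = 0" by (rule two)
    with e show ?thesis unfolding J by simp
  qed
  have comb: "poisson_superbracket sp_scale (superpolys I) (?P c1 c2)" for c1 c2
    by (rule superbracket.poisson_if_jac[OF sup all])
  then show ?thesis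
    using comb[of 1 0] b2 unfolding poisson_superpair_def by (simp add: sp_scale_one)
qed

section \<open>The quadratic bracket of a polarized superalgebra with a trace form\<close>

text \<open>The action of the sign \<open>zsgn i\<close> on an additive group.\<close>

definition sg :: "bit \<Rightarrow> 'g \<Rightarrow> 'g::ab_group_add" where
  "sg i u = (if i = 0 then u else - u)"

text \<open>
  The algebra of formal sums in abstract form: \<open>H p\<close> is the component of parity \<open>p\<close>, the maps \<open>pos\<close> and
  \<open>neg\<close> are the projections onto two complementary isotropic subalgebras, and \<open>tr\<close> is a supersymmetric
  invariant form, so that \<open>tr u v\<close> plays the role of the supertrace of the product of \<open>u\<close> and \<open>v\<close>. The
  carrier is explicit because the space of formal sums depends on the algebra and is not a type.
\<close>

locale super_trace_algebra =
  fixes H :: "bit \<Rightarrow> 'g::ab_group_add set"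
    and mul :: "'g \<Rightarrow> 'g \<Rightarrow> 'g" (infixl "\<star>" 70)
    and pos neg :: "'g \<Rightarrow> 'g"
    and tr :: "'g \<Rightarrow> 'g \<Rightarrow> 'p::ring_1"
  assumes H_add [intro, simp]: "u \<in> H p \<Longrightarrow> v \<in> H p \<Longrightarrow> u + v \<in> H p"
    and H_uminus [intro, simp]: "u \<in> H p \<Longrightarrow> - u \<in> H p"
    and mul_closed: "u \<in> H p \<Longrightarrow> v \<in> H q \<Longrightarrow> u \<star> v \<in> H (p + q)"
    and mul_add_left: "u \<in> H p \<Longrightarrow> v \<in> H p \<Longrightarrow> w \<in> H q \<Longrightarrow> (u + v) \<star> w = u \<star> w + v \<star> w"
    and mul_add_right: "u \<in> H p \<Longrightarrow> v \<in> H p \<Longrightarrow> w \<in> H q \<Longrightarrow> w \<star> (u + v) = w \<star> u + w \<star> v"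
    and mul_assoc: "u \<in> H p \<Longrightarrow> v \<in> H q \<Longrightarrow> w \<in> H r \<Longrightarrow> (u \<star> v) \<star> w = u \<star> (v \<star> w)"
    and pos_closed [intro, simp]: "u \<in> H p \<Longrightarrow> pos u \<in> H p"
    and neg_closed [intro, simp]: "u \<in> H p \<Longrightarrow> neg u \<in> H p"
    and pos_neg: "u \<in> H p \<Longrightarrow> pos u + neg u = u"
    and neg_add: "u \<in> H p \<Longrightarrow> v \<in> H p \<Longrightarrow> neg (u + v) = neg u + neg v"
    and tr_add_left: "u \<in> H p \<Longrightarrow> v \<in> H p \<Longrightarrow> w \<in> H q \<Longrightarrow> tr (u + v) w = tr u w + tr v w"
    and tr_add_right: "u \<in> H p \<Longrightarrow> v \<in> H p \<Longrightarrow> w \<in> H q \<Longrightarrow> tr w (u + v) = tr w u + tr w v"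
    and tr_assoc: "u \<in> H p \<Longrightarrow> v \<in> H q \<Longrightarrow> w \<in> H r \<Longrightarrow> tr (u \<star> v) w = tr u (v \<star> w)"
    and tr_super: "u \<in> H p \<Longrightarrow> v \<in> H q \<Longrightarrow> tr u v = zsgn (p * q) * tr v u"
    and tr_pos_pos: "u \<in> H p \<Longrightarrow> v \<in> H q \<Longrightarrow> tr (pos u) (pos v) = 0"
    and tr_neg_neg: "u \<in> H p \<Longrightarrow> v \<in> H q \<Longrightarrow> tr (neg u) (neg v) = 0"
    and mul_pos_pos: "u \<in> H p \<Longrightarrow> v \<in> H q \<Longrightarrow> neg (pos u \<star> pos v) = 0"
    and mul_neg_neg: "u \<in> H p \<Longrightarrow> v \<in> H q \<Longrightarrow> pos (neg u \<star> neg v) = 0"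
begin

lemma mul_closed' [intro, simp]:
  "u \<in> H 0 \<Longrightarrow> v \<in> H q \<Longrightarrow> u \<star> v \<in> H q" "u \<in> H p \<Longrightarrow> v \<in> H 0 \<Longrightarrow> u \<star> v \<in> H p"
  using mul_closed[of u 0 v q] mul_closed[of u p v 0] by auto

declare mul_closed [intro]

lemma H_diff [intro, simp]: "u \<in> H p \<Longrightarrow> v \<in> H p \<Longrightarrow> u - v \<in> H p"
  using H_add[of u p "- v"] by simp

lemma H_sg [intro, simp]: "u \<in> H p \<Longrightarrow> sg i u \<in> H p"
  by (simp add: sg_def)

text \<open>Isotropy of both subalgebras makes the two projections adjoint to each other.\<close>

lemma tr_neg_left: "u \<in> H p \<Longrightarrow> v \<in> H q \<Longrightarrow> tr (neg u) v = tr u (pos v)"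
proof -
  assume u: "u \<in> H p" and v: "v \<in> H q"
  have "tr (neg u) v = tr (neg u) (pos v + neg v)" using pos_neg[OF v] by simp
  also have "\<dots> = tr (pos u + neg u) (pos v)"
    using u v tr_add_right[of "pos v" q "neg v" "neg u" p] tr_add_left[of "pos u" p "neg u" "pos v" q]
      tr_neg_neg[OF u v] tr_pos_pos[OF u v] by simp
  finally show ?thesis using pos_neg[OF u] by simp
qed

lemma mul_zero_left: "w \<in> H q \<Longrightarrow> 0 \<in> H p \<Longrightarrow> 0 \<star> w = 0"
  using mul_add_left[of 0 p 0 w q] by simp

lemma mul_zero_right: "w \<in> H q \<Longrightarrow> 0 \<in> H p \<Longrightarrow> w \<star> 0 = 0"
  using mul_add_right[of 0 p 0 w q] by simp

lemma H_0: "u \<in> H p \<Longrightarrow> 0 \<in> H p"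
  using H_diff[of u p u] by simp

lemma mul_minus_left: "u \<in> H p \<Longrightarrow> w \<in> H q \<Longrightarrow> (- u) \<star> w = - (u \<star> w)"
  using mul_add_left[of u p "- u" w q] mul_zero_left[of w q p] H_0[of u p]
  by (simp add: eq_neg_iff_add_eq_0 add.commute)

lemma mul_minus_right: "u \<in> H p \<Longrightarrow> w \<in> H q \<Longrightarrow> w \<star> (- u) = - (w \<star> u)"
  using mul_add_right[of u p "- u" w q] mul_zero_right[of w q p] H_0[of u p]
  by (simp add: eq_neg_iff_add_eq_0 add.commute)

lemma mul_diff_left: "u \<in> H p \<Longrightarrow> v \<in> H p \<Longrightarrow> w \<in> H q \<Longrightarrow> (u - v) \<star> w = u \<star> w - v \<star> w"
  using mul_add_left[of u p "- v" w q] mul_minus_left[of v p w q] by simp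

lemma mul_diff_right: "u \<in> H p \<Longrightarrow> v \<in> H p \<Longrightarrow> w \<in> H q \<Longrightarrow> w \<star> (u - v) = w \<star> u - w \<star> v"
  using mul_add_right[of u p "- v" w q] mul_minus_right[of v p w q] by simp

lemma tr_zero: "w \<in> H q \<Longrightarrow> 0 \<in> H p \<Longrightarrow> tr 0 w = 0" "w \<in> H q \<Longrightarrow> 0 \<in> H p \<Longrightarrow> tr w 0 = 0"
  using tr_add_left[of 0 p 0 w q] tr_add_right[of 0 p 0 w q] by simp_all

lemma tr_minus_left: "u \<in> H p \<Longrightarrow> w \<in> H q \<Longrightarrow> tr (- u) w = - tr u w"
  using tr_add_left[of u p "- u" w q] tr_zero[of w q p] H_0[of u p]
  by (simp add: eq_neg_iff_add_eq_0 add.commute)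

lemma tr_minus_right: "u \<in> H p \<Longrightarrow> w \<in> H q \<Longrightarrow> tr w (- u) = - tr w u"
  using tr_add_right[of u p "- u" w q] tr_zero[of w q p] H_0[of u p]
  by (simp add: eq_neg_iff_add_eq_0 add.commute)

lemma tr_diff_left: "u \<in> H p \<Longrightarrow> v \<in> H p \<Longrightarrow> w \<in> H q \<Longrightarrow> tr (u - v) w = tr u w - tr v w"
  using tr_add_left[of u p "- v" w q] tr_minus_left[of v p w q] by simp

lemma tr_diff_right: "u \<in> H p \<Longrightarrow> v \<in> H p \<Longrightarrow> w \<in> H q \<Longrightarrow> tr w (u - v) = tr w u - tr w v"
  using tr_add_right[of u p "- v" w q] tr_minus_right[of v p w q] by simp

lemma tr_sg_left: "u \<in> H p \<Longrightarrow> w \<in> H q \<Longrightarrow> tr (sg i u) w = zsgn i * tr u w"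
  by (auto simp: sg_def zsgn_def tr_minus_left)

lemma neg_minus: "u \<in> H p \<Longrightarrow> neg (- u) = - neg u"
  using neg_add[of u p "- u"] neg_add[of 0 p 0] H_0[of u p]
  by (simp add: eq_neg_iff_add_eq_0 add.commute)

lemma neg_diff: "u \<in> H p \<Longrightarrow> v \<in> H p \<Longrightarrow> neg (u - v) = neg u - neg v"
  using neg_add[of u p "- v"] neg_minus[of v p] by simp

lemma tr_even_commute: "u \<in> H 0 \<Longrightarrow> v \<in> H q \<Longrightarrow> tr u v = tr v u"
  using tr_super[of u 0 v q] by (simp add: zsgn_def)

text \<open>A cyclic rotation costs the sign of moving one factor past the other two.\<close>

lemma tr_rotate:
  assumes "u \<in> H a" "v \<in> H b" "w \<in> H c"
  shows "tr (v \<star> w) u = zsgn (a * (b + c)) * tr (u \<star> v) w"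
    and "tr (w \<star> u) v = zsgn (c * (a + b)) * tr (u \<star> v) w"
proof -
  have "tr (v \<star> w) u = zsgn ((b + c) * a) * tr u (v \<star> w)"
    using assms by (intro tr_super mul_closed)
  then show "tr (v \<star> w) u = zsgn (a * (b + c)) * tr (u \<star> v) w"
    using assms by (simp add: tr_assoc mult.commute)
  have "tr (w \<star> u) v = tr w (u \<star> v)" by (rule tr_assoc[OF assms(3,1,2)])
  also have "\<dots> = zsgn (c * (a + b)) * tr (u \<star> v) w"
    using assms by (intro tr_super mul_closed)
  finally show "tr (w \<star> u) v = zsgn (c * (a + b)) * tr (u \<star> v) w" .
qed

text \<open>A product within one of the subalgebras stays there, and the subalgebra is isotropic.\<close>

lemma tr_pure:
  assumes "u \<in> H a" "v \<in> H b" "w \<in> H c"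
  shows "tr (pos u \<star> pos v) (pos w) = 0" "tr (neg u \<star> neg v) (neg w) = 0"
proof -
  have "pos (pos u \<star> pos v) = pos u \<star> pos v"
    using pos_neg[of "pos u \<star> pos v" "a + b"] mul_pos_pos[of u a v b] assms by (simp add: mul_closed)
  then show "tr (pos u \<star> pos v) (pos w) = 0"
    using tr_pos_pos[of "pos u \<star> pos v" "a + b" w c] assms by (simp add: mul_closed)
  have "neg (neg u \<star> neg v) = neg u \<star> neg v"
    using pos_neg[of "neg u \<star> neg v" "a + b"] mul_neg_neg[of u a v b] assms by (simp add: mul_closed)
  then show "tr (neg u \<star> neg v) (neg w) = 0"
    using tr_neg_neg[of "neg u \<star> neg v" "a + b" w c] assms by (simp add: mul_closed)
qed

lemma tr3_expand:
  assumes "u1 \<in> H a" "u2 \<in> H a" "v1 \<in> H b" "v2 \<in> H b" "w1 \<in> H c" "w2 \<in> H c"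
  shows "tr ((u1 + u2) \<star> v1) w1 = tr (u1 \<star> v1) w1 + tr (u2 \<star> v1) w1"
    and "tr (u1 \<star> (v1 + v2)) w1 = tr (u1 \<star> v1) w1 + tr (u1 \<star> v2) w1"
    and "tr (u1 \<star> v1) (w1 + w2) = tr (u1 \<star> v1) w1 + tr (u1 \<star> v1) w2"
  using assms by (simp_all add: mul_add_left[of _ a _ _ b] mul_add_right[of _ b _ _ a]
      tr_add_left[of _ "a + b" _ _ c] tr_add_right[of _ c _ _ "a + b"] mul_closed)

text \<open>
  This collects the terms of the Jacobi identity that involve left products \<open>u = L \<star> X\<close>, \<open>v = L \<star> Y\<close>,
  \<open>w = L \<star> Z\<close> only. When every factor is split into its two components, the three cyclic
  permutations of \<open>S\<close> together contain each of the six mixed patterns once in either cyclic order. The two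
  pure patterns vanish, so the mixed ones add up to the full traces.
\<close>

lemma cyclic_left:
  assumes "u \<in> H a" "v \<in> H b" "w \<in> H c"
  defines "S \<equiv> \<lambda>a b c u v w. tr (neg u \<star> v) (pos w) + zsgn (a * b) * tr (neg v \<star> neg u) w
    - zsgn (a * b + c * (a + b)) * tr (w \<star> v) (neg u)"
  shows "S a b c u v w + zsgn (c * (a + b)) * S c a b w u v + zsgn (a * (b + c)) * S b c a v w u =
    tr (u \<star> v) w - zsgn (b * c) * tr (u \<star> w) v"
proof -
  define up um where u': "up = pos u" "um = neg u"
  define vp vm where v': "vp = pos v" "vm = neg v"
  define wp wm where w': "wp = pos w" "wm = neg w"
  have H: "up \<in> H a" "um \<in> H a" "vp \<in> H b" "vm \<in> H b" "wp \<in> H c" "wm \<in> H c"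
    using assms by (simp_all add: u' v' w')
  have e: "u = up + um" "v = vp + vm" "w = wp + wm"
    using assms by (simp_all add: u' v' w' pos_neg)
  have z: "tr (up \<star> vp) wp = 0" "tr (up \<star> wp) vp = 0" "tr (um \<star> vm) wm = 0" "tr (um \<star> wm) vm = 0"
    unfolding u' v' w' using tr_pure[OF assms(1,2,3)] tr_pure[OF assms(1,3,2)] by simp_all
  have r: "tr (y \<star> z) x = zsgn (a * (b + c)) * tr (x \<star> y) z"
     "tr (z \<star> x) y = zsgn (c * (a + b)) * tr (x \<star> y) z"
     "tr (z \<star> y) x = zsgn (a * (b + c)) * tr (x \<star> z) y"
     "tr (y \<star> x) z = zsgn (b * (a + c)) * tr (x \<star> z) y"
    if "x \<in> {up, um}" "y \<in> {vp, vm}" "z \<in> {wp, wm}" for x y z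
    using that H tr_rotate[of x a y b z c] tr_rotate[of x a z c y b] by (auto simp: add.commute)
  have S: "S a b c u v w = tr (um \<star> v) wp + zsgn (a * b) * tr (vm \<star> um) w
        - zsgn (a * b + c * (a + b)) * tr (w \<star> v) um"
      "S c a b w u v = tr (wm \<star> u) vp + zsgn (c * a) * tr (um \<star> wm) v
        - zsgn (c * a + b * (c + a)) * tr (v \<star> u) wm"
      "S b c a v w u = tr (vm \<star> w) up + zsgn (b * c) * tr (wm \<star> vm) u
        - zsgn (b * c + a * (b + c)) * tr (u \<star> w) vm"
    by (simp_all add: S_def u' v' w')
  note x = tr3_expand[of _ a _ _ b _ _ c] tr3_expand[of _ a _ _ c _ _ b] tr3_expand[of _ b _ _ a _ _ c]
    tr3_expand[of _ b _ _ c _ _ a] tr3_expand[of _ c _ _ a _ _ b] tr3_expand[of _ c _ _ b _ _ a]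
  show ?thesis
    unfolding S unfolding e using H
    by (cases a; cases b; cases c) (simp_all add: x r z zsgn_def algebra_simps)
qed

text \<open>
  The counterpart for the right products \<open>u = X \<star> L\<close>, \<open>v = Y \<star> L\<close>, \<open>w = Z \<star> L\<close>, with total of the opposite
  sign.
\<close>

lemma cyclic_right:
  assumes "u \<in> H a" "v \<in> H b" "w \<in> H c"
  defines "S \<equiv> \<lambda>a b c u v w. tr (neg u \<star> neg v) w + zsgn (a * b) * tr (v \<star> neg u) (pos w)
    - zsgn (a * (b + c)) * tr (neg v) (w \<star> u)"
  shows "S a b c u v w + zsgn (c * (a + b)) * S c a b w u v + zsgn (a * (b + c)) * S b c a v w u =
    zsgn (b * c) * tr (u \<star> w) v - tr (u \<star> v) w"
proof -
  define up um where u': "up = pos u" "um = neg u"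
  define vp vm where v': "vp = pos v" "vm = neg v"
  define wp wm where w': "wp = pos w" "wm = neg w"
  have H: "up \<in> H a" "um \<in> H a" "vp \<in> H b" "vm \<in> H b" "wp \<in> H c" "wm \<in> H c"
    using assms by (simp_all add: u' v' w')
  have e: "u = up + um" "v = vp + vm" "w = wp + wm"
    using assms by (simp_all add: u' v' w' pos_neg)
  have z: "tr (up \<star> vp) wp = 0" "tr (up \<star> wp) vp = 0" "tr (um \<star> vm) wm = 0" "tr (um \<star> wm) vm = 0"
    unfolding u' v' w' using tr_pure[OF assms(1,2,3)] tr_pure[OF assms(1,3,2)] by simp_all
  have r: "tr (y \<star> z) x = zsgn (a * (b + c)) * tr (x \<star> y) z"
     "tr (z \<star> x) y = zsgn (c * (a + b)) * tr (x \<star> y) z"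
     "tr (z \<star> y) x = zsgn (a * (b + c)) * tr (x \<star> z) y"
     "tr (y \<star> x) z = zsgn (b * (a + c)) * tr (x \<star> z) y"
    if "x \<in> {up, um}" "y \<in> {vp, vm}" "z \<in> {wp, wm}" for x y z
    using that H tr_rotate[of x a y b z c] tr_rotate[of x a z c y b] by (auto simp: add.commute)
  have S: "S a b c u v w = tr (um \<star> vm) w + zsgn (a * b) * tr (v \<star> um) wp
        - zsgn (a * (b + c)) * tr (vm \<star> w) u"
      "S c a b w u v = tr (wm \<star> um) v + zsgn (c * a) * tr (u \<star> wm) vp
        - zsgn (c * (a + b)) * tr (um \<star> v) w"
      "S b c a v w u = tr (vm \<star> wm) u + zsgn (b * c) * tr (w \<star> vm) up
        - zsgn (b * (c + a)) * tr (wm \<star> u) v"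
    using assms(1-3) tr_assoc[of vm b w c u a] tr_assoc[of um a v b w c] tr_assoc[of wm c u a v b]
    by (simp_all add: S_def u' v' w')
  note x = tr3_expand[of _ a _ _ b _ _ c] tr3_expand[of _ a _ _ c _ _ b] tr3_expand[of _ b _ _ a _ _ c]
    tr3_expand[of _ b _ _ c _ _ a] tr3_expand[of _ c _ _ a _ _ b] tr3_expand[of _ c _ _ b _ _ a]
  show ?thesis
    unfolding S unfolding e using H
    by (cases a; cases b; cases c) (simp_all add: x r z zsgn_def algebra_simps)
qed

text \<open>The quadratic Hamiltonian vector field at the point \<open>L\<close> with differential \<open>X\<close>.\<close>

definition vfield :: "'g \<Rightarrow> 'g \<Rightarrow> 'g" where
  "vfield L X = neg (L \<star> X) \<star> L - L \<star> neg (X \<star> L)"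

lemma vfield_closed [intro, simp]: "L \<in> H 0 \<Longrightarrow> X \<in> H p \<Longrightarrow> vfield L X \<in> H p"
  by (simp add: vfield_def)

lemma tr_vfield:
  assumes L: "L \<in> H 0" and X: "X \<in> H p" and Y: "Y \<in> H q"
  shows "tr (vfield L X) Y = tr (neg (L \<star> X)) (L \<star> Y) - tr (neg (X \<star> L)) (Y \<star> L)"
proof -
  have "tr (neg (L \<star> X) \<star> L) Y = tr (neg (L \<star> X)) (L \<star> Y)"
    by (rule tr_assoc[where p = p and q = 0 and r = q]) (use assms in auto)
  moreover have "tr (L \<star> neg (X \<star> L)) Y = tr (neg (X \<star> L)) (Y \<star> L)"
  proof -
    have "tr (L \<star> neg (X \<star> L)) Y = tr L (neg (X \<star> L) \<star> Y)"
      by (rule tr_assoc[where p = 0 and q = p and r = q]) (use assms in auto)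
    also have "\<dots> = tr (neg (X \<star> L) \<star> Y) L"
      by (rule tr_even_commute[where q = "p + q"]) (use assms in auto)
    also have "\<dots> = tr (neg (X \<star> L)) (Y \<star> L)"
      by (rule tr_assoc[where p = p and q = q and r = 0]) (use assms in auto)
    finally show ?thesis .
  qed
  moreover have "tr (vfield L X) Y = tr (neg (L \<star> X) \<star> L) Y - tr (L \<star> neg (X \<star> L)) Y"
    unfolding vfield_def by (rule tr_diff_left[where p = p and q = q]) (use assms in auto)
  ultimately show ?thesis by simp
qed

text \<open>One factor \<open>L\<close> is rotated from the front to the back of the word.\<close>

lemma tr_cross:
  assumes L: "L \<in> H 0" and X: "X \<in> H p" and Y: "Y \<in> H q"
  shows "tr (L \<star> X) (L \<star> Y) = tr (X \<star> L) (Y \<star> L)"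
proof -
  have "tr (L \<star> X) (L \<star> Y) = tr L (X \<star> (L \<star> Y))"
    by (rule tr_assoc[where p = 0 and q = p and r = q]) (use assms in auto)
  also have "\<dots> = tr (X \<star> (L \<star> Y)) L"
    by (rule tr_even_commute[where q = "p + q"]) (use assms in auto)
  also have "\<dots> = tr X ((L \<star> Y) \<star> L)"
    by (rule tr_assoc[where p = p and q = q and r = 0]) (use assms in auto)
  also have "(L \<star> Y) \<star> L = L \<star> (Y \<star> L)"
    by (rule mul_assoc[where p = 0 and q = q and r = 0]) (use assms in auto)
  also have "tr X (L \<star> (Y \<star> L)) = tr (X \<star> L) (Y \<star> L)"
    by (rule tr_assoc[symmetric, where p = p and q = 0 and r = q]) (use assms in auto)
  finally show ?thesis .
qed

lemma tr_neg_skew: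
  assumes "u \<in> H p" "v \<in> H q"
  shows "tr (neg u) v = tr u v - zsgn (p * q) * tr (neg v) u"
proof -
  have "tr u v = tr (pos u + neg u) v" using assms by (simp add: pos_neg)
  also have "\<dots> = tr (pos u) v + tr (neg u) v"
    by (rule tr_add_left[where p = p and q = q]) (use assms in auto)
  also have "tr (pos u) v = zsgn (p * q) * tr v (pos u)" by (rule tr_super) (use assms in auto)
  also have "tr v (pos u) = tr (neg v) u" by (rule tr_neg_left[symmetric]) (use assms in auto)
  finally show ?thesis by simp
qed

text \<open>
  By isotropy, \<open>tr (neg u) v\<close> is super skew up to \<open>tr u v\<close>. The two defects, for left and for right products,
  cancel by \<open>tr_cross\<close>.
\<close>

lemma tr_vfield_skew:
  assumes L: "L \<in> H 0" and X: "X \<in> H p" and Y: "Y \<in> H q"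
  shows "tr (vfield L X) Y = - zsgn (p * q) * tr (vfield L Y) X"
  unfolding tr_vfield[OF L X Y] tr_vfield[OF L Y X]
  using tr_neg_skew[of "L \<star> X" p "L \<star> Y" q] tr_neg_skew[of "X \<star> L" p "Y \<star> L" q] tr_cross[OF L X Y] assms
  by (simp add: right_diff_distrib)

text \<open>
  The derivative of \<open>tr (vfield L Y) Z\<close> in \<open>L\<close> in the direction \<open>V\<close>, for \<open>V\<close> of parity \<open>a\<close>, a constant \<open>Y\<close>
  of parity \<open>b\<close> and a constant \<open>Z\<close>. The signs come from moving \<open>V\<close> past \<open>Y\<close>.
\<close>

definition dquad :: "bit \<Rightarrow> bit \<Rightarrow> 'g \<Rightarrow> 'g \<Rightarrow> 'g \<Rightarrow> 'g \<Rightarrow> 'p" where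
  "dquad a b L V Y Z = tr (neg (V \<star> Y) \<star> L + sg (a * b) (neg (L \<star> Y) \<star> V)
     - V \<star> neg (Y \<star> L) - sg (a * b) (L \<star> neg (Y \<star> V))) Z"

text \<open>The common shape of all traces in which left and right products occur together.\<close>

definition word :: "'g \<Rightarrow> 'g \<Rightarrow> 'g \<Rightarrow> 'g \<Rightarrow> 'p" where
  "word L p Y q = tr p (Y \<star> (q \<star> L))"

text \<open>
  Invariance of the form brings every term into one of three shapes: traces of left products (first line),
  traces of right products (second line), and mixed words. The latter are grouped according to the partners
  with which they cancel in the cyclic sum.
\<close>

lemma dquad_vfield:
  assumes L: "L \<in> H 0" and X: "X \<in> H a" and Y: "Y \<in> H b" and Z: "Z \<in> H c"
  shows "dquad a b L (vfield L X) Y Z =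
      (tr (neg (L \<star> X) \<star> (L \<star> Y)) (pos (L \<star> Z)) + zsgn (a * b) * tr (neg (L \<star> Y) \<star> neg (L \<star> X)) (L \<star> Z))
    + (tr (neg (X \<star> L) \<star> neg (Y \<star> L)) (Z \<star> L) + zsgn (a * b) * tr ((Y \<star> L) \<star> neg (X \<star> L)) (pos (Z \<star> L)))
    - (word L (neg (X \<star> L)) Y (pos (L \<star> Z)) + zsgn (b * c) * word L (neg (X \<star> L)) Z (neg (L \<star> Y)))
    - (zsgn (a * (b + c)) * word L (neg (Y \<star> L)) Z (neg (L \<star> X))
       + zsgn (a * b + c * (a + b)) * word L (pos (Z \<star> L)) Y (neg (L \<star> X)))"
proof -
  define u v w where u: "u = L \<star> X" and v: "v = L \<star> Y" and w: "w = L \<star> Z"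
  define u' v' w' where u': "u' = X \<star> L" and v': "v' = Y \<star> L" and w': "w' = Z \<star> L"
  define V where V: "V = vfield L X"
  have H: "u \<in> H a" "v \<in> H b" "w \<in> H c" "u' \<in> H a" "v' \<in> H b" "w' \<in> H c" "V \<in> H a"
    using assms by (simp_all add: u v w u' v' w' V)
  have Veq: "V = neg u \<star> L - L \<star> neg u'" by (simp add: V vfield_def u u')
  have word: "tr (L \<star> (p \<star> R)) q = word L p R q" if "p \<in> H d" "R \<in> H e" "q \<in> H f" for p q R d e f
  proof -
    have "tr (L \<star> (p \<star> R)) q = tr L ((p \<star> R) \<star> q)"
      by (rule tr_assoc[where p = 0 and q = "d + e" and r = f]) (use L that in auto)
    also have "\<dots> = tr ((p \<star> R) \<star> q) L"
      by (rule tr_even_commute[where q = "d + e + f"]) (use L that in auto)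
    also have "\<dots> = tr (p \<star> R) (q \<star> L)"
      by (rule tr_assoc[where p = "d + e" and q = f and r = 0]) (use L that in auto)
    also have "\<dots> = word L p R q" unfolding word_def
      by (rule tr_assoc[where p = d and q = e and r = f]) (use L that in auto)
    finally show ?thesis .
  qed
  have VR: "V \<star> R = neg u \<star> (L \<star> R) - L \<star> (neg u' \<star> R)" if "R \<in> H d" for R d
  proof -
    have "V \<star> R = (neg u \<star> L) \<star> R - (L \<star> neg u') \<star> R"
      unfolding Veq by (rule mul_diff_left[where p = a and q = d]) (use L H that in auto)
    also have "(neg u \<star> L) \<star> R = neg u \<star> (L \<star> R)"
      by (rule mul_assoc[where p = a and q = 0 and r = d]) (use L H that in auto)
    also have "(L \<star> neg u') \<star> R = L \<star> (neg u' \<star> R)"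
      by (rule mul_assoc[where p = 0 and q = a and r = d]) (use L H that in auto)
    finally show ?thesis .
  qed
  have YV: "Y \<star> V = Y \<star> (neg u \<star> L) - v' \<star> neg u'"
  proof -
    have "Y \<star> V = Y \<star> (neg u \<star> L) - Y \<star> (L \<star> neg u')"
      unfolding Veq by (rule mul_diff_right[where p = a and q = b]) (use L Y H in auto)
    also have "Y \<star> (L \<star> neg u') = v' \<star> neg u'" unfolding v'
      by (rule mul_assoc[symmetric, where p = b and q = 0 and r = a]) (use L Y H in auto)
    finally show ?thesis .
  qed
  have q1: "tr (neg (V \<star> Y) \<star> L) Z = tr (neg u \<star> v) (pos w) - word L (neg u') Y (pos w)"
  proof -
    have "tr (neg (V \<star> Y) \<star> L) Z = tr (neg (V \<star> Y)) w" unfolding w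
      by (rule tr_assoc[where p = "a + b" and q = 0 and r = c]) (use L Y Z H in auto)
    also have "\<dots> = tr (V \<star> Y) (pos w)"
      by (rule tr_neg_left[where p = "a + b" and q = c]) (use Y H in auto)
    also have "\<dots> = tr (neg u \<star> v) (pos w) - tr (L \<star> (neg u' \<star> Y)) (pos w)"
      unfolding VR[OF Y] v
      by (rule tr_diff_left[where p = "a + b" and q = c]) (use L Y H in auto)
    also have "tr (L \<star> (neg u' \<star> Y)) (pos w) = word L (neg u') Y (pos w)"
      by (rule word) (use Y H in auto)
    finally show ?thesis .
  qed
  have q2: "tr (neg v \<star> V) Z = tr (neg v \<star> neg u) w - zsgn (b * (a + c)) * word L (neg u') Z (neg v)"
  proof -
    have "tr (neg v \<star> V) Z = tr (neg v) (V \<star> Z)"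
      by (rule tr_assoc[where p = b and q = a and r = c]) (use Z H in auto)
    also have "\<dots> = tr (neg v) (neg u \<star> w) - tr (neg v) (L \<star> (neg u' \<star> Z))"
      unfolding VR[OF Z] w
      by (rule tr_diff_right[where p = "a + c" and q = b]) (use L Z H in auto)
    also have "tr (neg v) (neg u \<star> w) = tr (neg v \<star> neg u) w"
      by (rule tr_assoc[symmetric, where p = b and q = a and r = c]) (use H in auto)
    also have "tr (neg v) (L \<star> (neg u' \<star> Z)) = zsgn (b * (a + c)) * tr (L \<star> (neg u' \<star> Z)) (neg v)"
      by (rule tr_super) (use L Z H in auto)
    also have "tr (L \<star> (neg u' \<star> Z)) (neg v) = word L (neg u') Z (neg v)"
      by (rule word) (use Z H in auto)
    finally show ?thesis .
  qed
  have q3: "tr (V \<star> neg v') Z = zsgn (a * (b + c)) * word L (neg v') Z (neg u) - tr (neg u' \<star> neg v') w'"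
  proof -
    have "tr (V \<star> neg v') Z = tr V (neg v' \<star> Z)"
      by (rule tr_assoc[where p = a and q = b and r = c]) (use Z H in auto)
    also have "\<dots> = tr (neg u \<star> L) (neg v' \<star> Z) - tr (L \<star> neg u') (neg v' \<star> Z)"
      unfolding Veq
      by (rule tr_diff_left[where p = a and q = "b + c"]) (use L Z H in auto)
    also have "tr (neg u \<star> L) (neg v' \<star> Z) = tr (neg u) (L \<star> (neg v' \<star> Z))"
      by (rule tr_assoc[where p = a and q = 0 and r = "b + c"]) (use L Z H in auto)
    also have "\<dots> = zsgn (a * (b + c)) * tr (L \<star> (neg v' \<star> Z)) (neg u)"
      by (rule tr_super) (use L Z H in auto)
    also have "tr (L \<star> (neg v' \<star> Z)) (neg u) = word L (neg v') Z (neg u)"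
      by (rule word) (use Z H in auto)
    also have "tr (L \<star> neg u') (neg v' \<star> Z) = tr L (neg u' \<star> (neg v' \<star> Z))"
      by (rule tr_assoc[where p = 0 and q = a and r = "b + c"]) (use L Z H in auto)
    also have "neg u' \<star> (neg v' \<star> Z) = (neg u' \<star> neg v') \<star> Z"
      by (rule mul_assoc[symmetric, where p = a and q = b and r = c]) (use Z H in auto)
    also have "tr L ((neg u' \<star> neg v') \<star> Z) = tr ((neg u' \<star> neg v') \<star> Z) L"
      by (rule tr_even_commute[where q = "a + b + c"]) (use L Z H in auto)
    also have "\<dots> = tr (neg u' \<star> neg v') w'" unfolding w'
      by (rule tr_assoc[where p = "a + b" and q = c and r = 0]) (use L Z H in auto)
    finally show ?thesis .
  qed
  have q4: "tr (L \<star> neg (Y \<star> V)) Z =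
      zsgn (c * (a + b)) * word L (pos w') Y (neg u) - tr (v' \<star> neg u') (pos w')"
  proof -
    have "tr (L \<star> neg (Y \<star> V)) Z = tr L (neg (Y \<star> V) \<star> Z)"
      by (rule tr_assoc[where p = 0 and q = "b + a" and r = c]) (use L Y Z H in auto)
    also have "\<dots> = tr (neg (Y \<star> V) \<star> Z) L"
      by (rule tr_even_commute[where q = "b + a + c"]) (use L Y Z H in auto)
    also have "\<dots> = tr (neg (Y \<star> V)) w'" unfolding w'
      by (rule tr_assoc[where p = "b + a" and q = c and r = 0]) (use L Y Z H in auto)
    also have "\<dots> = tr (Y \<star> V) (pos w')"
      by (rule tr_neg_left[where p = "b + a" and q = c]) (use Y H in auto)
    also have "\<dots> = tr (Y \<star> (neg u \<star> L)) (pos w') - tr (v' \<star> neg u') (pos w')"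
      unfolding YV
      by (rule tr_diff_left[where p = "b + a" and q = c]) (use L Y H in auto)
    also have "tr (Y \<star> (neg u \<star> L)) (pos w') = zsgn ((b + a) * c) * tr (pos w') (Y \<star> (neg u \<star> L))"
      by (rule tr_super) (use L Y H in auto)
    finally show ?thesis by (simp add: word_def mult.commute add.commute)
  qed
  define t1 t2 t3 t4 where t: "t1 = neg (V \<star> Y) \<star> L" "t2 = neg v \<star> V" "t3 = V \<star> neg v'" "t4 = L \<star> neg (Y \<star> V)"
  have tH: "t1 \<in> H (a + b)" "t2 \<in> H (a + b)" "t3 \<in> H (a + b)" "t4 \<in> H (a + b)"
    using L Y H mul_closed[of V a Y b] mul_closed[of Y b V a] mul_closed[of "neg v" b V a]
      mul_closed[of V a "neg v'" b] by (auto simp: t add.commute)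
  have "dquad a b L V Y Z = tr (t1 + sg (a * b) t2 - t3 - sg (a * b) t4) Z"
    by (simp add: dquad_def v v' t)
  also have "\<dots> = tr t1 Z + zsgn (a * b) * tr t2 Z - tr t3 Z - zsgn (a * b) * tr t4 Z"
    using tH Z by (simp add: tr_diff_left[of _ "a + b" _ _ c] tr_add_left[of _ "a + b" _ _ c]
      tr_sg_left[of _ "a + b" _ c])
  finally show ?thesis
    unfolding t q1 q2 q3 q4 V[symmetric] u[symmetric] v[symmetric] w[symmetric]
      u'[symmetric] v'[symmetric] w'[symmetric]
    by (cases a; cases b; cases c) (simp_all add: zsgn_def algebra_simps)
qed

lemma word_add:
  assumes "L \<in> H 0" "p1 \<in> H a" "p2 \<in> H a" "Y \<in> H b" "q1 \<in> H c" "q2 \<in> H c"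
  shows "word L (p1 + p2) Y q1 = word L p1 Y q1 + word L p2 Y q1"
    and "word L p1 Y (q1 + q2) = word L p1 Y q1 + word L p1 Y q2"
proof -
  have c: "Y \<star> (q \<star> L) \<in> H (b + c)" if "q \<in> H c" for q
    using assms that by (auto intro: mul_closed)
  show "word L (p1 + p2) Y q1 = word L p1 Y q1 + word L p2 Y q1"
    unfolding word_def by (rule tr_add_left[OF assms(2,3) c[OF assms(5)]])
  have "(q1 + q2) \<star> L = q1 \<star> L + q2 \<star> L"
    by (rule mul_add_left[where p = c and q = 0]) (use assms in auto)
  moreover have "Y \<star> (q1 \<star> L + q2 \<star> L) = Y \<star> (q1 \<star> L) + Y \<star> (q2 \<star> L)"
    by (rule mul_add_right[where p = c and q = b]) (use assms in auto)
  moreover have "tr p1 (Y \<star> (q1 \<star> L) + Y \<star> (q2 \<star> L)) = tr p1 (Y \<star> (q1 \<star> L)) + tr p1 (Y \<star> (q2 \<star> L))"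
    by (rule tr_add_right[OF c[OF assms(5)] c[OF assms(6)] assms(2)])
  ultimately show "word L p1 Y (q1 + q2) = word L p1 Y q1 + word L p1 Y q2"
    by (simp add: word_def)
qed

text \<open>
  In the cyclic sum every mixed word meets a partner that differs from it only by the opposite projection
  of one factor. In the sum of the two this projection disappears, and what remains is a trace of right
  products only or of left products only. These are the last terms of \<open>S\<close> in \<open>cyclic_right\<close> and
  \<open>cyclic_left\<close>, whose totals cancel because \<open>L \<star> X \<star> L \<star> Y \<star> L \<star> Z\<close> can be rotated by one factor.
\<close>

lemma jacobi_vfield:
  assumes L: "L \<in> H 0" and X: "X \<in> H a" and Y: "Y \<in> H b" and Z: "Z \<in> H c"
  shows "dquad a b L (vfield L X) Y Z + zsgn (c * (a + b)) * dquad c a L (vfield L Z) X Y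
    + zsgn (a * (b + c)) * dquad b c L (vfield L Y) Z X = 0"
proof -
  define u v w where u: "u = L \<star> X" and v: "v = L \<star> Y" and w: "w = L \<star> Z"
  define u' v' w' where u': "u' = X \<star> L" and v': "v' = Y \<star> L" and w': "w' = Z \<star> L"
  have H: "u \<in> H a" "v \<in> H b" "w \<in> H c" "u' \<in> H a" "v' \<in> H b" "w' \<in> H c"
    using assms by (simp_all add: u v w u' v' w')
  \<comment> \<open>The partners with opposite projections of a left product.\<close>
  have m1: "word L (neg q') S (neg p) + word L (neg q') S (pos p) = tr (neg q') (r' \<star> p')"
    if "P \<in> H d" "S \<in> H f" "q' \<in> H e" "p = L \<star> P" "p' = P \<star> L" "r' = S \<star> L"
    for P S q' p p' r' d e f
  proof -
    have p: "p \<in> H d" using L that by simp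
    have "word L (neg q') S (neg p) + word L (neg q') S (pos p) = word L (neg q') S (pos p + neg p)"
      by (subst word_add(2)[where a = e and b = f and c = d]) (use L that p in auto)
    also have "\<dots> = tr (neg q') (S \<star> ((L \<star> P) \<star> L))" using p by (simp add: word_def pos_neg that(4))
    also have "(L \<star> P) \<star> L = L \<star> (P \<star> L)"
      by (rule mul_assoc[where p = 0 and q = d and r = 0]) (use L that in auto)
    also have "S \<star> (L \<star> (P \<star> L)) = r' \<star> p'" unfolding that
      by (rule mul_assoc[symmetric, where p = f and q = 0 and r = d]) (use L that in auto)
    finally show ?thesis .
  qed
  \<comment> \<open>The partners with opposite projections of a right product.\<close>
  have m2: "word L (neg r') Q (neg p) + word L (pos r') Q (neg p) = tr (r \<star> q) (neg p)"
    if "Q \<in> H e" "S \<in> H f" "p \<in> H d" "q = L \<star> Q" "r = L \<star> S" "r' = S \<star> L"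
    for Q S p q r r' d e f
  proof -
    have r': "r' \<in> H f" using L that by simp
    have "word L (neg r') Q (neg p) + word L (pos r') Q (neg p) = word L (pos r' + neg r') Q (neg p)"
      by (subst word_add(1)[where a = f and b = e and c = d]) (use L that r' in auto)
    also have "\<dots> = tr (S \<star> L) (Q \<star> (neg p \<star> L))" using r' by (simp add: word_def pos_neg that(6))
    also have "\<dots> = tr S (L \<star> (Q \<star> (neg p \<star> L)))"
      by (rule tr_assoc[where p = f and q = 0 and r = "e + d"]) (use L that in auto)
    also have "L \<star> (Q \<star> (neg p \<star> L)) = (q \<star> neg p) \<star> L"
    proof -
      have "L \<star> (Q \<star> (neg p \<star> L)) = q \<star> (neg p \<star> L)" unfolding that
        by (rule mul_assoc[symmetric, where p = 0 and q = e and r = d]) (use L that in auto)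
      also have "\<dots> = (q \<star> neg p) \<star> L"
        by (rule mul_assoc[symmetric, where p = e and q = d and r = 0]) (use L that in auto)
      finally show ?thesis .
    qed
    also have "tr S ((q \<star> neg p) \<star> L) = tr (S \<star> (q \<star> neg p)) L"
      by (rule tr_assoc[symmetric, where p = f and q = "e + d" and r = 0])
        (use L that in auto)
    also have "\<dots> = tr L (S \<star> (q \<star> neg p))"
      by (rule tr_even_commute[symmetric, where q = "f + (e + d)"]) (use L that in auto)
    also have "\<dots> = tr r (q \<star> neg p)" unfolding that
      by (rule tr_assoc[symmetric, where p = 0 and q = f and r = "e + d"])
        (use L that in auto)
    also have "\<dots> = tr (r \<star> q) (neg p)"
      by (rule tr_assoc[symmetric, where p = f and q = e and r = d]) (use L that in auto)
    finally show ?thesis .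
  qed
  note E = dquad_vfield[OF L X Y Z] dquad_vfield[OF L Z X Y] dquad_vfield[OF L Y Z X]
  note E' = E[folded u v w u' v' w']
  have M: "word L (neg v') Z (pos u) = tr (neg v') (w' \<star> u') - word L (neg v') Z (neg u)"
     "word L (neg u') Y (pos w) = tr (neg u') (v' \<star> w') - word L (neg u') Y (neg w)"
     "word L (neg w') X (pos v) = tr (neg w') (u' \<star> v') - word L (neg w') X (neg v)"
     "word L (pos w') Y (neg u) = tr (w \<star> v) (neg u) - word L (neg w') Y (neg u)"
     "word L (pos v') X (neg w) = tr (v \<star> u) (neg w) - word L (neg v') X (neg w)"
     "word L (pos u') Z (neg v) = tr (u \<star> w) (neg v) - word L (neg u') Z (neg v)"
    using m1[OF X Z _ u u' w', of v' b] m1[OF Z Y _ w w' v', of u' a] m1[OF Y X _ v v' u', of w' c]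
      m2[OF Y Z _ v w w', of u a] m2[OF X Y _ u v v', of w c] m2[OF Z X _ w u u', of v b] H
    by (simp_all add: eq_diff_eq add.commute)
  have T: "tr (u \<star> v) w = tr (u' \<star> v') w'" "tr (u \<star> w) v = tr (u' \<star> w') v'"
  proof -
    have *: "tr ((L \<star> P) \<star> (L \<star> Q)) (L \<star> S) = tr ((P \<star> L) \<star> (Q \<star> L)) (S \<star> L)"
      if "P \<in> H d" "Q \<in> H e" "S \<in> H f" for P Q S d e f
    proof -
      have "(L \<star> P) \<star> (L \<star> Q) = L \<star> (P \<star> (L \<star> Q))"
        by (rule mul_assoc[where p = 0 and q = d and r = e]) (use L that in auto)
      moreover have "P \<star> (L \<star> Q) = (P \<star> L) \<star> Q"
        by (rule mul_assoc[symmetric, where p = d and q = 0 and r = e]) (use L that in auto)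
      moreover have "((P \<star> L) \<star> Q) \<star> L = (P \<star> L) \<star> (Q \<star> L)"
        by (rule mul_assoc[where p = d and q = e and r = 0]) (use L that in auto)
      ultimately show ?thesis
        using tr_cross[OF L, of "(P \<star> L) \<star> Q" "d + e" S f] L that by (simp add: mul_closed)
    qed
    show "tr (u \<star> v) w = tr (u' \<star> v') w'" "tr (u \<star> w) v = tr (u' \<star> w') v'"
      unfolding u v w u' v' w' using * X Y Z by blast+
  qed
  note C1 = cyclic_left[OF H(1-3)] note C2 = cyclic_right[OF H(4-6)]
  show ?thesis
    unfolding E' M using arg_cong2[where f = "(+)", OF C1 C2] unfolding T
    by (cases a; cases b; cases c) (simp_all add: zsgn_def algebra_simps)
qed

text \<open>The superbracket of elements of parities \<open>p\<close> and \<open>q\<close>.\<close>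

definition sbr :: "bit \<Rightarrow> bit \<Rightarrow> 'g \<Rightarrow> 'g \<Rightarrow> 'g" where
  "sbr p q u v = u \<star> v - sg (p * q) (v \<star> u)"

lemma tr_sbr:
  assumes "w \<in> H r" "u \<in> H p" "v \<in> H q"
  shows "tr w (sbr p q u v) = tr w (u \<star> v) - zsgn (p * q) * tr w (v \<star> u)"
proof -
  have "v \<star> u \<in> H (p + q)" using mul_closed[of v q u p] assms by (simp add: add.commute)
  then show ?thesis
    using assms mul_closed[of u p v q]
    by (cases "p * q") (simp_all add: sbr_def sg_def zsgn_def tr_diff_right[of _ "p + q" _ _ r]
        tr_add_right[of _ "p + q" _ _ r])
qed

definition linbr :: "bit \<Rightarrow> bit \<Rightarrow> 'g \<Rightarrow> 'g \<Rightarrow> 'g \<Rightarrow> 'g \<Rightarrow> 'p" where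
  "linbr p q L K F G = tr L (sbr p q F (pos (K \<star> G))) - tr L (sbr p q (neg (K \<star> F)) G)"

text \<open>
  After expansion in \<open>K\<close>, the quadratic part is \<open>tr (neg (K \<star> F)) (K \<star> G) - tr (neg (K \<star> F)) (G \<star> K)\<close>,
  which vanishes since \<open>K\<close> commutes with \<open>G\<close>. The linear part consists of the four traces \<open>x\<close>, \<open>y\<close>, \<open>z\<close>, \<open>t\<close>,
  each of which can be rotated until \<open>L\<close> is the first factor.
\<close>

lemma tr_vfield_shift:
  assumes L: "L \<in> H 0" and K: "K \<in> H 0" and F: "F \<in> H p" and G: "G \<in> H q"
    and cF: "K \<star> F = F \<star> K" and cG: "K \<star> G = G \<star> K"
  shows "tr (vfield (L + K) F) G = tr (vfield L F) G + linbr p q L K F G"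
    and "tr (vfield (L - K) F) G = tr (vfield L F) G - linbr p q L K F G"
proof -
  define k where "k = K \<star> F"
  define g where "g = K \<star> G"
  have H: "k \<in> H p" "g \<in> H q" using K F G by (simp_all add: k_def g_def)
  define x y z t where "x = tr (neg (L \<star> F)) (K \<star> G)" and "y = tr (neg k) (L \<star> G)"
    and "z = tr (neg (F \<star> L)) (G \<star> K)" and "t = tr (neg k) (G \<star> L)"
  have quad: "tr (neg k) (K \<star> G) - tr (neg k) (G \<star> K) = 0" by (simp add: cG)
  have lin: "linbr p q L K F G = x + y - z - t"
  proof -
    have x: "x = tr L (F \<star> pos g)"
    proof -
      have "x = tr (L \<star> F) (pos g)" unfolding x_def g_def
        by (rule tr_neg_left[where p = p and q = q]) (use L F K G in auto)
      also have "\<dots> = tr L (F \<star> pos g)"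
        by (rule tr_assoc[where p = 0 and q = p and r = q]) (use L F H in auto)
      finally show ?thesis .
    qed
    have z: "z = zsgn (p * q) * tr L (pos g \<star> F)"
    proof -
      have "z = tr (F \<star> L) (pos g)" unfolding z_def g_def cG
        by (rule tr_neg_left[where p = p and q = q]) (use L F K G in auto)
      also have "\<dots> = tr F (L \<star> pos g)"
        by (rule tr_assoc[where p = p and q = 0 and r = q]) (use L F H in auto)
      also have "\<dots> = zsgn (p * q) * tr (L \<star> pos g) F"
        by (rule tr_super) (use L F H in auto)
      also have "tr (L \<star> pos g) F = tr L (pos g \<star> F)"
        by (rule tr_assoc[where p = 0 and q = q and r = p]) (use L F H in auto)
      finally show ?thesis .
    qed
    have y: "y = zsgn (p * q) * tr L (G \<star> neg k)"
    proof -
      have "y = zsgn (p * q) * tr (L \<star> G) (neg k)" unfolding y_def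
        by (rule tr_super) (use L G H in auto)
      also have "tr (L \<star> G) (neg k) = tr L (G \<star> neg k)"
        by (rule tr_assoc[where p = 0 and q = q and r = p]) (use L G H in auto)
      finally show ?thesis .
    qed
    have t: "t = tr L (neg k \<star> G)"
    proof -
      have "t = tr (neg k \<star> G) L" unfolding t_def
        by (rule tr_assoc[symmetric, where p = p and q = q and r = 0]) (use L G H in auto)
      also have "\<dots> = tr L (neg k \<star> G)"
        by (rule tr_even_commute[symmetric, where q = "p + q"]) (use L G H in auto)
      finally show ?thesis .
    qed
    show ?thesis
      unfolding linbr_def k_def[symmetric] g_def[symmetric] x y z t
      using L F G H by (simp add: tr_sbr[of L 0 F p "pos g" q] tr_sbr[of L 0 "neg k" p G q])
  qed
  have add: "(L + K) \<star> R = L \<star> R + K \<star> R" "R \<star> (L + K) = R \<star> L + R \<star> K"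
    "(L - K) \<star> R = L \<star> R - K \<star> R" "R \<star> (L - K) = R \<star> L - R \<star> K" if "R \<in> H r" for R r
    using L K that by (auto intro: mul_add_left mul_add_right mul_diff_left mul_diff_right)
  have m: "neg (L \<star> F + K \<star> F) = neg (L \<star> F) + neg k" "neg (F \<star> L + F \<star> K) = neg (F \<star> L) + neg k"
    "neg (L \<star> F - K \<star> F) = neg (L \<star> F) - neg k" "neg (F \<star> L - F \<star> K) = neg (F \<star> L) - neg k"
    using L K F by (simp_all add: k_def neg_add[of _ p] neg_diff[of _ p] flip: cF)
  have c: "L \<star> G \<in> H q" "K \<star> G \<in> H q" "G \<star> L \<in> H q" "G \<star> K \<in> H q" "neg (L \<star> F) \<in> H p" "neg (F \<star> L) \<in> H p"
    "neg k \<in> H p"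
    using L K F G H by auto
  have b: "tr (vfield L F) G = tr (neg (L \<star> F)) (L \<star> G) - tr (neg (F \<star> L)) (G \<star> L)"
    by (rule tr_vfield[OF L F G])
  have "tr (vfield (L + K) F) G = tr (neg (L \<star> F) + neg k) (L \<star> G + K \<star> G) - tr (neg (F \<star> L) + neg k) (G \<star> L + G \<star> K)"
    by (subst tr_vfield[OF H_add[OF L K] F G]) (simp only: add[OF F] add[OF G] m)
  also have "\<dots> = tr (vfield L F) G + (x + y - z - t) + (tr (neg k) (K \<star> G) - tr (neg k) (G \<star> K))"
    unfolding b using c
    by (simp add: tr_add_left[of _ p _ _ q] tr_add_right[of _ q _ _ p] x_def y_def z_def t_def)
  finally show "tr (vfield (L + K) F) G = tr (vfield L F) G + linbr p q L K F G"
    unfolding lin quad by simp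
  have "tr (vfield (L - K) F) G = tr (neg (L \<star> F) - neg k) (L \<star> G - K \<star> G) - tr (neg (F \<star> L) - neg k) (G \<star> L - G \<star> K)"
    by (subst tr_vfield[OF H_diff[OF L K] F G]) (simp only: add[OF F] add[OF G] m)
  also have "\<dots> = tr (vfield L F) G - (x + y - z - t) + (tr (neg k) (K \<star> G) - tr (neg k) (G \<star> K))"
    unfolding b using c
    by (simp add: tr_diff_left[of _ p _ _ q] tr_diff_right[of _ q _ _ p] x_def y_def z_def t_def)
  finally show "tr (vfield (L - K) F) G = tr (vfield L F) G - linbr p q L K F G"
    unfolding lin quad by simp
qed

end

section \<open>The filtration of a polarized algebra\<close>

context polarized_algebra
begin

lemma form_add_left: "form (u + v) w = form u w + form v w"
  and form_scale_left: "form (sc c u) w = c * form u w"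
  and form_zero_left [simp]: "form 0 w = 0"
  and form_diff_left: "form (u - v) w = form u w - form v w"
proof -
  interpret l: Vector_Spaces.linear sc "(*)" "\<lambda>u. form u w" by (rule form_linear_left)
  show "form (u + v) w = form u w + form v w" "form (sc c u) w = c * form u w" "form 0 w = 0"
    "form (u - v) w = form u w - form v w"
    by (simp_all add: l.add l.scale l.zero l.diff)
qed

lemma form_add_right: "form w (u + v) = form w u + form w v"
  and form_scale_right: "form w (sc c u) = c * form w u"
  and form_zero_right [simp]: "form w 0 = 0"
proof -
  interpret l: Vector_Spaces.linear sc "(*)" "\<lambda>u. form w u" by (rule form_linear_right)
  show "form w (u + v) = form w u + form w v" "form w (sc c u) = c * form w u" "form w 0 = 0"
    by (simp_all add: l.add l.scale l.zero)
qed

lemma form_sum_left: "form (\<Sum>x\<in>X. h x) w = (\<Sum>x\<in>X. form (h x) w)"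
  by (induction X rule: infinite_finite_induct) (auto simp: form_add_left)

lemma form_sum_right: "form w (\<Sum>x\<in>X. h x) = (\<Sum>x\<in>X. form w (h x))"
  by (induction X rule: infinite_finite_induct) (auto simp: form_add_right)

lemma gradedE: obtains u0 u1 where "u = u0 + u1" "u0 \<in> A 0" "u1 \<in> A 1"
  using grade_sum by (metis UNIV_I set_plus_elim)

lemma polarizedE: obtains p n where "u = p + n" "p \<in> Ap" "n \<in> Am"
  using polar_sum by (metis UNIV_I set_plus_elim)

lemma form_grade': "u \<in> A i \<Longrightarrow> v \<in> A j \<Longrightarrow> i \<noteq> j \<Longrightarrow> form u v = 0"
  using form_grade[of u v] form_grade[of v u] form_supersymmetric[of u i v j]
  by (cases i; cases j) (auto simp: zsgn_def)

lemma form_assoc: "form (u * v) w = form u (v * w)"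
proof -
  obtain u0 u1 where u: "u = u0 + u1" "u0 \<in> A 0" "u1 \<in> A 1" by (rule gradedE)
  obtain v0 v1 where v: "v = v0 + v1" "v0 \<in> A 0" "v1 \<in> A 1" by (rule gradedE)
  show ?thesis using u v
    by (simp add: algebra_simps form_add_left form_add_right form_associative[of _ 0 _ 0]
        form_associative[of _ 0 _ 1] form_associative[of _ 1 _ 0] form_associative[of _ 1 _ 1])
qed

text \<open>An isotropic subspace with an isotropic complement is its own annihilator.\<close>

lemma neg_iff_left: "u \<in> Am \<longleftrightarrow> (\<forall>v\<in>Am. form u v = 0)"
proof
  assume *: "\<forall>v\<in>Am. form u v = 0"
  obtain p n where u: "u = p + n" "p \<in> Ap" "n \<in> Am" by (rule polarizedE)
  have "form p v = 0" for v
  proof -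
    obtain q m where "v = q + m" "q \<in> Ap" "m \<in> Am" by (rule polarizedE)
    then show ?thesis
      using * u isotropic_pos isotropic_neg by (auto simp: form_add_right form_add_left)
  qed
  then have "p = 0" by (rule form_nondegenerate_left)
  with u show "u \<in> Am" by simp
qed (use isotropic_neg in auto)

lemma neg_iff_right: "u \<in> Am \<longleftrightarrow> (\<forall>v\<in>Am. form v u = 0)"
proof
  assume *: "\<forall>v\<in>Am. form v u = 0"
  obtain p n where u: "u = p + n" "p \<in> Ap" "n \<in> Am" by (rule polarizedE)
  have "form v p = 0" for v
  proof -
    obtain q m where "v = q + m" "q \<in> Ap" "m \<in> Am" by (rule polarizedE)
    then show ?thesis
      using * u isotropic_pos isotropic_neg by (auto simp: form_add_right form_add_left)
  qed
  then have "p = 0" by (rule form_nondegenerate_right)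
  with u show "u \<in> Am" by simp
qed (use isotropic_neg in auto)

text \<open>
  This is the annihilator of the \<open>(m + 1)\<close>-st power of \<open>Am\<close>, hence a two-sided notion; for positive \<open>m\<close>
  it is \<open>filt (m - 1) + Am\<close>. Unlike \<open>filt\<close>, these spaces make the whole of \<open>A\<close> a filtered algebra.
\<close>

primrec wfilt :: "nat \<Rightarrow> 'a set" where
  "wfilt 0 = Am"
| "wfilt (Suc m) = {u. \<forall>v\<in>Am. v * u \<in> wfilt m}"

lemma subspace_wfilt: "subspace (wfilt m)"
proof (induction m)
  case (Suc m)
  then show ?case
    by (auto simp: subspace_def distrib_left simp flip: scale_mult_right)
qed (simp add: subspace_neg)

text \<open>
  For \<open>m = 0\<close> both conditions say that \<open>form v (u * w)\<close> vanishes for \<open>v\<close> and \<open>w\<close> in \<open>Am\<close>. The induction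
  step exchanges a left and a right multiplication.
\<close>

lemma wfilt_Suc_right: "u \<in> wfilt (Suc m) \<longleftrightarrow> (\<forall>v\<in>Am. u * v \<in> wfilt m)"
proof (induction m arbitrary: u)
  case 0
  have "(\<forall>v\<in>Am. v * u \<in> Am) \<longleftrightarrow> (\<forall>v\<in>Am. \<forall>w\<in>Am. form (v * u) w = 0)"
    by (subst neg_iff_left) simp
  also have "\<dots> \<longleftrightarrow> (\<forall>w\<in>Am. \<forall>v\<in>Am. form v (u * w) = 0)"
    by (auto simp: form_assoc)
  also have "\<dots> \<longleftrightarrow> (\<forall>w\<in>Am. u * w \<in> Am)"
    by (subst neg_iff_right) simp
  finally show ?case by simp
next
  case (Suc m)
  have "u \<in> wfilt (Suc (Suc m)) \<longleftrightarrow> (\<forall>v\<in>Am. v * u \<in> wfilt (Suc m))" by simp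
  also have "\<dots> \<longleftrightarrow> (\<forall>v\<in>Am. \<forall>w\<in>Am. v * u * w \<in> wfilt m)" unfolding Suc.IH ..
  also have "\<dots> \<longleftrightarrow> (\<forall>w\<in>Am. u * w \<in> wfilt (Suc m))" by (auto simp: mult.assoc)
  finally show ?case .
qed

lemma wfilt_mono_Suc: "wfilt m \<subseteq> wfilt (Suc m)"
  by (induction m) (auto intro: mult_neg)

lemma wfilt_mono: "m \<le> n \<Longrightarrow> wfilt m \<subseteq> wfilt n"
  by (rule lift_Suc_mono_le[of wfilt, OF wfilt_mono_Suc])

lemma wfilt_neg_mult: "u \<in> wfilt (Suc m) \<Longrightarrow> v \<in> Am \<Longrightarrow> v * u \<in> wfilt m"
  by simp

lemma wfilt_mult_neg: "u \<in> wfilt (Suc m) \<Longrightarrow> v \<in> Am \<Longrightarrow> u * v \<in> wfilt m"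
  by (simp only: wfilt_Suc_right)

lemma wfilt_mult: "u \<in> wfilt m \<Longrightarrow> w \<in> wfilt n \<Longrightarrow> u * w \<in> wfilt (m + n)"
proof (induction m arbitrary: u)
  case 0
  then have "u * w \<in> wfilt (n - 1)"
    by (cases n) (auto intro: mult_neg)
  then show ?case using wfilt_mono[of "n - 1" n] by auto
next
  case (Suc m)
  then show ?case by (auto simp flip: mult.assoc)
qed

lemma filt_plus_neg: "filt m + Am = wfilt (Suc m)" and filt_eq: "filt m = Ap \<inter> wfilt (Suc m)"
proof -
  have *: "(Ap \<inter> wfilt (Suc m)) + Am = wfilt (Suc m)" for m
  proof safe
    fix u assume "u \<in> (Ap \<inter> wfilt (Suc m)) + Am"
    then obtain p n where "u = p + n" "p \<in> wfilt (Suc m)" "n \<in> Am" by (auto elim: set_plus_elim)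
    moreover have "n \<in> wfilt (Suc m)" using \<open>n \<in> Am\<close> wfilt_mono[of 0 "Suc m"] by auto
    ultimately show "u \<in> wfilt (Suc m)" using subspace_add[OF subspace_wfilt] by metis
  next
    fix u assume u: "u \<in> wfilt (Suc m)"
    obtain p n where pn: "u = p + n" "p \<in> Ap" "n \<in> Am" by (rule polarizedE)
    then have "n \<in> wfilt (Suc m)" using wfilt_mono[of 0 "Suc m"] by auto
    then have "u - n \<in> wfilt (Suc m)" using u subspace_diff[OF subspace_wfilt] by metis
    with pn show "u \<in> (Ap \<inter> wfilt (Suc m)) + Am" by auto
  qed
  show eq: "filt m = Ap \<inter> wfilt (Suc m)" for m
  proof (induction m)
    case (Suc m)
    have "filt (Suc m) = {u \<in> Ap. \<forall>v\<in>Am. v * u \<in> filt m + Am}" by simp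
    also have "filt m + Am = wfilt (Suc m)" unfolding Suc.IH by (rule *)
    finally show ?case by auto
  qed auto
  show "filt m + Am = wfilt (Suc m)" unfolding eq by (rule *)
qed

lemma pos_comp_eq:
  assumes "u = p + n" "p \<in> Ap" "n \<in> Am" shows "pos_comp u = p" and "neg_comp u = n"
proof -
  have uniq: "q = p" if "q \<in> Ap" "u - q \<in> Am" for q
  proof -
    have "p - q \<in> Ap" using assms that subspace_diff[OF subspace_pos] by auto
    moreover have "p - q = (u - q) - n" using assms by simp
    then have "p - q \<in> Am" using assms that subspace_diff[OF subspace_neg] by metis
    ultimately have "p - q = 0" using polar_Int by blast
    then show ?thesis by simp
  qed
  show 1: "pos_comp u = p"
    unfolding pos_comp_def
  proof (rule the_equality)
    show "p \<in> Ap \<and> u - p \<in> Am" using assms by simp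
  qed (simp add: uniq)
  show "neg_comp u = n"
    unfolding neg_comp_def
  proof (rule the_equality)
    show "m = n" if "m \<in> Am \<and> u - m \<in> Ap" for m
      using uniq[of "u - m"] that assms by simp
    show "n \<in> Am \<and> u - n \<in> Ap" using assms by simp
  qed
qed

lemma pos_comp_mem: "pos_comp u \<in> Ap" and neg_comp_mem: "neg_comp u \<in> Am"
  and pos_neg_comp: "pos_comp u + neg_comp u = u"
proof -
  obtain p n where "u = p + n" "p \<in> Ap" "n \<in> Am" by (rule polarizedE)
  then show "pos_comp u \<in> Ap" "neg_comp u \<in> Am" "pos_comp u + neg_comp u = u"
    using pos_comp_eq by auto
qed

lemma comp_grade: assumes "u \<in> A k" shows "pos_comp u \<in> A k" "neg_comp u \<in> A k"
proof -
  have *: "\<exists>a b. a \<in> V \<and> b \<in> V \<and> a \<in> A k \<and> b \<in> A (k + 1) \<and> v = a + b"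
    if "V = (V \<inter> A 0) + (V \<inter> A 1)" "v \<in> V" for V v
  proof -
    from that have "v \<in> (V \<inter> A 0) + (V \<inter> A 1)" by auto
    then obtain a b where "v = a + b" "a \<in> V \<inter> A 0" "b \<in> V \<inter> A 1" by (rule set_plus_elim)
    then show ?thesis by (cases k) (auto simp: add.commute intro: exI[of _ a] exI[of _ b])
  qed
  obtain p p' where p: "p \<in> Ap" "p' \<in> Ap" "p \<in> A k" "p' \<in> A (k + 1)" "pos_comp u = p + p'"
    using *[OF graded_pos pos_comp_mem] by blast
  obtain n n' where n: "n \<in> Am" "n' \<in> Am" "n \<in> A k" "n' \<in> A (k + 1)" "neg_comp u = n + n'"
    using *[OF graded_neg neg_comp_mem] by blast
  have "p' + n' = u - (p + n)" using pos_neg_comp[of u] p n by (simp add: algebra_simps)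
  then have "p' + n' \<in> A k"
    using assms p n subspace_diff[OF subspace_grade] subspace_add[OF subspace_grade] by metis
  moreover have "p' + n' \<in> A (k + 1)" using p n subspace_add[OF subspace_grade] by metis
  ultimately have "p' + n' = 0" using grade_Int by (cases k) auto
  then have "p' = 0 - n'" by (simp add: eq_neg_iff_add_eq_0)
  then have "p' \<in> Am" using n subspace_diff[OF subspace_neg subspace_0[OF subspace_neg]] by metis
  then have "p' = 0" using p polar_Int by auto
  with \<open>p' + n' = 0\<close> have "n' = 0" by simp
  with \<open>p' = 0\<close> p n show "pos_comp u \<in> A k" "neg_comp u \<in> A k" by auto
qed

end


section \<open>Coordinates as values of the form\<close>

context polarized_bases
begin

text \<open>The indices of all basis elements of parity \<open>i\<close>, positive and negative.\<close>

definition ix :: "bit \<Rightarrow> int set" where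
  "ix i = {j. j \<in> J i \<or> - j \<in> J i}"

lemma ix_eq: "J i \<union> uminus ` J i = ix i"
  by (auto simp: ix_def intro: image_eqI[of _ _ "- j" for j])

text \<open>The sign that relates a coordinate to the value of the form at the dual basis element; see \<open>coord_form\<close>.\<close>

definition eps :: "bit \<Rightarrow> int \<Rightarrow> 'r::ring_1" where
  "eps i j = (if j > 0 then zsgn i else 1)"

lemma J_pos: "j \<in> J i \<Longrightarrow> j > 0"
  using J_cases[of i] by (elim disjE exE) simp_all

lemma neg_ix [simp]: "- j \<in> ix i \<longleftrightarrow> j \<in> ix i"
  by (auto simp: ix_def)

lemma ix_cases: "j \<in> ix i \<Longrightarrow> (j \<in> J i \<Longrightarrow> P) \<Longrightarrow> (- j \<in> J i \<Longrightarrow> P) \<Longrightarrow> P"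
  by (auto simp: ix_def)

lemma J_ix: "j \<in> J i \<Longrightarrow> j \<in> ix i" "- j \<in> J i \<Longrightarrow> j \<in> ix i"
  by (auto simp: ix_def)

lemma ix_nonzero: "j \<in> ix i \<Longrightarrow> j \<noteq> 0"
  by (auto simp: ix_def dest: J_pos)

lemma ix_J: "j \<in> ix i \<Longrightarrow> j > 0 \<Longrightarrow> j \<in> J i" "j \<in> ix i \<Longrightarrow> j < 0 \<Longrightarrow> - j \<in> J i"
  by (auto simp: ix_def dest: J_pos)

lemma s_pos: "j \<in> J i \<Longrightarrow> s i j \<in> Ap" and s_pos_grade: "j \<in> J i \<Longrightarrow> s i j \<in> A i"
proof -
  assume "j \<in> J i"
  then have "s i j \<in> span (s i ` J i)" by (intro span_base) auto
  then show "s i j \<in> Ap" "s i j \<in> A i" using pos_basis[of i] by (auto simp: is_basis_family_def)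
qed

lemma s_neg: "- j \<in> J i \<Longrightarrow> s i j \<in> Am" using neg_mem[of "- j" i] by simp

lemma s_grade: "j \<in> ix i \<Longrightarrow> s i j \<in> A i"
  using neg_mem[of "- j" i] by (auto simp: s_pos_grade elim: ix_cases)

text \<open>
  Beyond \<open>J i\<close> the values of \<open>s i\<close> are arbitrary. If \<open>J i\<close> has \<open>n\<close> elements and \<open>filt_dim i m\<close> were larger, the
  element \<open>s i (n + 1)\<close> of \<open>filt m\<close> would depend on the basis \<open>s i ` J i\<close>, contrary to \<open>filt_basis\<close>.
\<close>

lemma filt_subset_J: "{1..int (filt_dim i m)} \<subseteq> J i"
proof (cases "J i = {1..}")
  case False
  then obtain n :: nat where J: "J i = {1..int n}" using J_cases by blast
  have "\<not> n < filt_dim i m"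
  proof
    assume n: "n < filt_dim i m"
    let ?v = "s i (int n + 1)"
    have inj: "inj_on (s i) {1..int (filt_dim i m)}"
      and ind: "independent (s i ` {1..int (filt_dim i m)})"
      and span: "span (s i ` {1..int (filt_dim i m)}) = filt m \<inter> A i"
      using filt_basis[of i m] by (auto simp: is_basis_family_def)
    have "?v \<in> filt m \<inter> A i" using n unfolding span[symmetric] by (intro span_base) auto
    then have "?v \<in> Ap \<inter> A i" unfolding filt_eq by auto
    then have "?v \<in> span (s i ` {1..int n})" using pos_basis[of i] J by (auto simp: is_basis_family_def)
    also have "\<dots> \<subseteq> span (s i ` {1..int (filt_dim i m)} - {?v})"
    proof (rule span_mono)
      show "s i ` {1..int n} \<subseteq> s i ` {1..int (filt_dim i m)} - {?v}"
        using n inj_onD[OF inj, of _ "int n + 1"] by fastforce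
    qed
    finally have "dependent (s i ` {1..int (filt_dim i m)})"
      unfolding dependent_def using n by (intro bexI[of _ ?v]) auto
    with ind show False by simp
  qed
  with J show ?thesis by auto
qed auto

lemma s_wfilt: "j \<in> J i \<Longrightarrow> j \<le> int (filt_dim i m) \<Longrightarrow> s i j \<in> wfilt (Suc m)"
proof -
  assume "j \<in> J i" "j \<le> int (filt_dim i m)"
  then have "s i j \<in> span (s i ` {1..int (filt_dim i m)})"
    using J_pos[of j i] by (intro span_base) auto
  then show ?thesis using filt_basis[of i m] filt_eq[of m] by (auto simp: is_basis_family_def)
qed

lemma ex_wfilt: "\<exists>m. u \<in> wfilt m"
proof -
  obtain p n where u: "u = p + n" "p \<in> Ap" "n \<in> Am" by (rule polarizedE)
  obtain m where "p \<in> filt m" using u filt_exhaustive by auto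
  then have "p \<in> wfilt (Suc m)" by (simp only: filt_eq Int_iff)
  moreover have "n \<in> wfilt (Suc m)" using u wfilt_mono[of 0 "Suc m"] by auto
  ultimately show ?thesis using u subspace_add[OF subspace_wfilt] by metis
qed

lemma neg_s_wfilt: "- j \<in> J i \<Longrightarrow> s i j \<in> wfilt m"
  using s_neg wfilt_mono[of 0 m] by auto

text \<open>
  A bound for the positive indices at which an element of \<open>wfilt m\<close> can have a nonzero coordinate; see
  \<open>form_beyond_wbound\<close>.
\<close>

definition wbound :: "nat \<Rightarrow> nat" where
  "wbound m = max (filt_dim 0 m) (filt_dim 1 m)"

lemma filt_dim_wbound: "filt_dim i m \<le> wbound m"
  by (cases i) (auto simp: wbound_def)

lemma pos_expansion:
  assumes "u \<in> Ap \<inter> A k" "u \<in> wfilt m" "int (wbound m) \<le> N"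
  shows "u = (\<Sum>j\<in>{j\<in>J k. j \<le> N}. sc (form (s k (- j)) u) (s k j))"
proof -
  let ?F = "{1..int (filt_dim k m)}"
  have "u \<in> filt m \<inter> A k" using assms wfilt_mono[of m "Suc m"] unfolding filt_eq by auto
  then have "u \<in> span (s k ` ?F)" using filt_basis[of k m] by (simp add: is_basis_family_def)
  then obtain c where u: "u = (\<Sum>v\<in>s k ` ?F. sc (c v) v)" by (auto simp: span_finite)
  have fin: "finite {j\<in>J k. j \<le> N}"
    by (rule finite_subset[of _ "{0..N}"]) (auto dest: J_pos)
  have sub: "?F \<subseteq> {j\<in>J k. j \<le> N}"
    using filt_subset_J[of k m] filt_dim_wbound[of k m] assms(3) by auto
  have "inj_on (s k) ?F" using filt_basis[of k m] by (simp add: is_basis_family_def)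
  then have "u = (\<Sum>j\<in>?F. sc (c (s k j)) (s k j))" by (simp add: u sum.reindex)
  also have "\<dots> = (\<Sum>j\<in>{j\<in>J k. j \<le> N}. sc (if j \<in> ?F then c (s k j) else 0) (s k j))"
    using fin sub by (intro sum.mono_neutral_cong_left) auto
  finally have e: "u = (\<Sum>j\<in>{j\<in>J k. j \<le> N}. sc (if j \<in> ?F then c (s k j) else 0) (s k j))" .
  have "form (s k (- l)) u = (if l \<in> ?F then c (s k l) else 0)" if "l \<in> J k" "l \<le> N" for l
  proof -
    have "form (s k (- l)) u = (\<Sum>j\<in>{j\<in>J k. j \<le> N}. if j = l then (if l \<in> ?F then c (s k l) else 0) else 0)"
      by (subst e, simp only: form_sum_right form_scale_right, rule sum.cong) (use that in \<open>auto simp: dual\<close>)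
    then show ?thesis using fin that by simp
  qed
  then show ?thesis by (subst (1) e, intro sum.cong) auto
qed

lemma form_neg_pos_comp: "- j \<in> J i \<Longrightarrow> form (s i j) (pos_comp u) = form (s i j) u"
    "- j \<in> J i \<Longrightarrow> form (pos_comp u) (s i j) = form u (s i j)"
  and form_pos_neg_comp: "j \<in> J i \<Longrightarrow> form (s i j) (neg_comp u) = form (s i j) u"
    "j \<in> J i \<Longrightarrow> form (neg_comp u) (s i j) = form u (s i j)"
proof -
  note [simp] = pos_comp_mem neg_comp_mem isotropic_neg isotropic_pos s_neg s_pos
  have *: "form (s i j) u = form (s i j) (pos_comp u) + form (s i j) (neg_comp u)"
    "form u (s i j) = form (pos_comp u) (s i j) + form (neg_comp u) (s i j)"
    using pos_neg_comp[of u] by (simp_all flip: form_add_left form_add_right)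
  show "- j \<in> J i \<Longrightarrow> form (s i j) (pos_comp u) = form (s i j) u"
    "- j \<in> J i \<Longrightarrow> form (pos_comp u) (s i j) = form u (s i j)"
    "j \<in> J i \<Longrightarrow> form (s i j) (neg_comp u) = form (s i j) u"
    "j \<in> J i \<Longrightarrow> form (neg_comp u) (s i j) = form u (s i j)"
    unfolding * by simp_all
qed

lemma pos_comp_wfilt: "u \<in> wfilt m \<Longrightarrow> pos_comp u \<in> wfilt m"
proof -
  assume u: "u \<in> wfilt m"
  have "neg_comp u \<in> wfilt m" using neg_comp_mem wfilt_mono[of 0 m] by auto
  moreover have "pos_comp u = u - neg_comp u" using pos_neg_comp[of u] by (simp add: algebra_simps)
  ultimately show ?thesis using u subspace_diff[OF subspace_wfilt] by metis
qed

lemma form_beyond_wbound: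
  assumes "u \<in> wfilt m" "u \<in> A k" "- j \<in> J i" "int (wbound m) < - j"
  shows "form (s i j) u = 0" "form u (s i j) = 0"
proof -
  have si: "s i j \<in> A i" using assms by (auto intro!: s_grade J_ix)
  show 0: "form (s i j) u = 0"
  proof (cases "i = k")
    case True
    have p: "pos_comp u \<in> Ap \<inter> A k" "pos_comp u \<in> wfilt m"
      using assms pos_comp_mem comp_grade pos_comp_wfilt by auto
    have "form (s i j) (pos_comp u) = (\<Sum>l\<in>{l\<in>J k. l \<le> int (wbound m)}.
        form (s k (- l)) (pos_comp u) * form (s i j) (s k l))"
      by (subst pos_expansion[OF p order_refl]) (simp add: form_sum_right form_scale_right)
    also have "\<dots> = 0"
    proof (intro sum.neutral ballI)
      fix l assume "l \<in> {l\<in>J k. l \<le> int (wbound m)}"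
      then show "form (s k (- l)) (pos_comp u) * form (s i j) (s k l) = 0"
        using dual[of "- j" i l k] assms True by auto
    qed
    finally show ?thesis using form_neg_pos_comp assms by metis
  next
    case False
    then show ?thesis using form_grade'[OF si assms(2)] by simp
  qed
  show "form u (s i j) = 0" using form_supersymmetric[OF assms(2) si] 0 by simp
qed

text \<open>
  Positive and negative coordinates are defined differently, by a linear combination and by a formal sum;
  up to sign both are values of the form at the dual basis element.
\<close>

lemma coord_form:
  assumes u: "u \<in> A k"
  shows "coord k u i j = (if i = k \<and> j \<in> ix k then eps k j * form u (s k (- j)) else 0)"
proof (cases "i = k")
  case True
  show ?thesis
  proof (cases "j \<in> J k")
    case j: True
    obtain m where m: "u \<in> wfilt m" using ex_wfilt by blast
    have p: "pos_comp u \<in> Ap \<inter> A k" "pos_comp u \<in> wfilt m"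
      using u m pos_comp_mem comp_grade pos_comp_wfilt by auto
    have ind: "independent (s k ` J k)" and inj: "inj_on (s k) (J k)" and span: "span (s k ` J k) = Ap \<inter> A k"
      using pos_basis[of k] by (auto simp: is_basis_family_def)
    define N where "N = max j (int (wbound m))"
    have fin: "finite {j\<in>J k. j \<le> N}"
      by (rule finite_subset[of _ "{0..N}"]) (auto dest: J_pos)
    let ?R = "representation (s k ` J k)"
    have "?R (pos_comp u) (s k j) = ?R (\<Sum>l\<in>{l\<in>J k. l \<le> N}. sc (form (s k (- l)) (pos_comp u)) (s k l)) (s k j)"
      by (subst pos_expansion[OF p, of N]) (auto simp: N_def)
    also have "\<dots> = (\<Sum>l\<in>{l\<in>J k. l \<le> N}. ?R (sc (form (s k (- l)) (pos_comp u)) (s k l)) (s k j))"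
      by (subst representation_sum[OF ind]) (auto simp: span_scale span_base)
    also have "\<dots> = (\<Sum>l\<in>{l\<in>J k. l \<le> N}. if l = j then form (s k (- j)) (pos_comp u) else 0)"
      using j inj by (intro sum.cong refl)
        (auto simp: representation_scale[OF ind] representation_basis[OF ind] span_base inj_on_def)
    also have "\<dots> = form (s k (- j)) (pos_comp u)" using fin j by (simp add: N_def)
    also have "\<dots> = form (s k (- j)) u" using form_neg_pos_comp(1)[of "- j" k u] j by simp
    also have "\<dots> = zsgn k * form u (s k (- j))"
      using form_supersymmetric[OF s_grade u, of "- j"] j by (simp add: J_ix)
    finally show ?thesis
      using True j by (simp add: coord_def J_pos J_ix eps_def)
  next
    case False
    then show ?thesis
      using True form_pos_neg_comp(2)[of "- j" k u] J_pos[of "- j" k]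
      by (auto simp: coord_def J_ix eps_def elim: ix_cases)
  qed
qed (simp add: coord_def)

definition box :: "int \<Rightarrow> (bit \<times> int) set" where
  "box N = {(i, j). j \<in> ix i \<and> \<bar>j\<bar> \<le> N}"

lemma finite_box [simp]: "finite (box N)"
  by (rule finite_subset[of _ "UNIV \<times> {-N..N}"]) (auto simp: box_def UNIV_bit)

text \<open>
  The positive indices account for the pairing of the component of \<open>u\<close> in \<open>Ap\<close> with that of \<open>v\<close> in \<open>Am\<close>, the
  negative ones for the other way round.
\<close>

lemma form_expansion:
  assumes u: "u \<in> A k" "u \<in> wfilt m" and v: "v \<in> A k" "v \<in> wfilt n"
    and N: "int (wbound m) \<le> N" "int (wbound n) \<le> N"
  shows "form u v = (\<Sum>j\<in>{j\<in>ix k. \<bar>j\<bar> \<le> N}. eps k j * form u (s k (- j)) * form (s k j) v)"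
proof -
  let ?P = "{j\<in>J k. j \<le> N}"
  have fin: "finite ?P"
    by (rule finite_subset[of _ "{0..N}"]) (auto dest: J_pos)
  have box: "{j\<in>ix k. \<bar>j\<bar> \<le> N} = ?P \<union> uminus ` ?P"
    by (auto simp: ix_def dest: J_pos intro: image_eqI[of _ _ "- j" for j])
  have disj: "?P \<inter> uminus ` ?P = {}" by (auto dest!: J_pos)
  have pu: "pos_comp u \<in> Ap \<inter> A k" "pos_comp u \<in> wfilt m"
    and pv: "pos_comp v \<in> Ap \<inter> A k" "pos_comp v \<in> wfilt n"
    using u v pos_comp_mem comp_grade pos_comp_wfilt by auto
  have "form u v = form (pos_comp u + neg_comp u) (pos_comp v + neg_comp v)"
    by (simp add: pos_neg_comp)
  also have "\<dots> = form (pos_comp u) (neg_comp v) + form (neg_comp u) (pos_comp v)"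
    by (simp add: form_add_left form_add_right isotropic_pos isotropic_neg pos_comp_mem neg_comp_mem)
  also have "form (pos_comp u) (neg_comp v) = (\<Sum>j\<in>?P. form (s k (- j)) u * form (s k j) v)"
    by (subst pos_expansion[OF pu N(1)])
      (simp add: form_sum_left form_scale_left form_neg_pos_comp form_pos_neg_comp)
  also have "\<dots> = (\<Sum>j\<in>?P. eps k j * form u (s k (- j)) * form (s k j) v)"
    using form_supersymmetric[OF s_grade u(1)] by (intro sum.cong) (auto simp: eps_def J_pos J_ix)
  also have "form (neg_comp u) (pos_comp v) = (\<Sum>j\<in>?P. form (s k (- j)) v * form u (s k j))"
    by (subst pos_expansion[OF pv N(2)])
      (simp add: form_sum_right form_scale_right form_neg_pos_comp form_pos_neg_comp)
  also have "\<dots> = (\<Sum>j\<in>uminus ` ?P. eps k j * form u (s k (- j)) * form (s k j) v)"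
    by (subst sum.reindex) (auto simp: eps_def dest: J_pos intro!: sum.cong)
  also have "(\<Sum>j\<in>?P. eps k j * form u (s k (- j)) * form (s k j) v) +
      (\<Sum>j\<in>uminus ` ?P. eps k j * form u (s k (- j)) * form (s k j) v) =
      (\<Sum>j\<in>{j\<in>ix k. \<bar>j\<bar> \<le> N}. eps k j * form u (s k (- j)) * form (s k j) v)"
    unfolding box using fin disj by (intro sum.union_disjoint[symmetric]) auto
  finally show ?thesis .
qed

end

section \<open>The algebra of formal sums\<close>

context polarized_bases
begin

text \<open>
  A basis element is addressed by the pair of its parity and its integer index, and \<open>du\<close> is the pair of the
  dual basis element.
\<close>

abbreviation cf :: "'k gbar \<Rightarrow> bit \<times> int \<Rightarrow> 'k superpoly" where
  "cf \<xi> a \<equiv> \<xi> (fst a) (snd a)"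

abbreviation el :: "bit \<times> int \<Rightarrow> 'a" where
  "el a \<equiv> s (fst a) (snd a)"

abbreviation du :: "bit \<times> int \<Rightarrow> bit \<times> int" where
  "du a \<equiv> (fst a, - snd a)"

abbreviation ep :: "bit \<times> int \<Rightarrow> 'r::ring_1" where
  "ep a \<equiv> eps (fst a) (snd a)"

definition IX :: "(bit \<times> int) set" where
  "IX = {a. snd a \<in> ix (fst a)}"

text \<open>Formal sums are infinite only in the negative direction: the indices in the support are bounded above.\<close>

definition gsupp :: "int \<Rightarrow> 'k gbar \<Rightarrow> bool" where
  "gsupp N \<xi> \<longleftrightarrow> (\<forall>a. cf \<xi> a \<noteq> 0 \<longrightarrow> a \<in> IX \<and> snd a \<le> N)"

lemma gsuppD: "gsupp N \<xi> \<Longrightarrow> cf \<xi> a \<noteq> 0 \<Longrightarrow> a \<in> IX" "gsupp N \<xi> \<Longrightarrow> cf \<xi> a \<noteq> 0 \<Longrightarrow> snd a \<le> N"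
  unfolding gsupp_def by blast+

lemma gsupp_mono: "gsupp N \<xi> \<Longrightarrow> N \<le> N' \<Longrightarrow> gsupp N' \<xi>"
  by (force simp: gsupp_def)

lemma box_iff: "a \<in> box N \<longleftrightarrow> a \<in> IX \<and> \<bar>snd a\<bar> \<le> N"
  by (auto simp: box_def IX_def)

lemma el_grade: "a \<in> IX \<Longrightarrow> el a \<in> A (fst a)"
  by (simp add: IX_def s_grade)

lemma el_mult_grade: "a \<in> IX \<Longrightarrow> b \<in> IX \<Longrightarrow> el a * el b \<in> A (fst a + fst b)"
  by (intro grade_mult el_grade)

lemma IX_du [simp]: "du a \<in> IX \<longleftrightarrow> a \<in> IX" "(i, - j) \<in> IX \<longleftrightarrow> (i, j) \<in> IX"
  by (simp_all add: IX_def)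

lemma box_du [simp]: "du a \<in> box N \<longleftrightarrow> a \<in> box N"
  by (simp add: box_iff)

lemma form_el_parity:
  "a \<in> IX \<Longrightarrow> b \<in> IX \<Longrightarrow> c \<in> IX \<Longrightarrow> form (el a * el b) (el c) \<noteq> 0 \<Longrightarrow> fst c = fst a + fst b"
  using form_grade'[OF el_mult_grade el_grade] by metis

lemma form_el_rotate:
  assumes "a \<in> IX" "b \<in> IX" "c \<in> IX"
  shows "form (el b * el c) (el a) = zsgn (fst a) * form (el a * el b) (el c)"
proof -
  have eq: "form (el b * el c) (el a) = zsgn ((fst b + fst c) * fst a) * form (el a * el b) (el c)"
    using form_supersymmetric[OF el_mult_grade el_grade, of b c a] assms by (simp add: form_assoc)
  show ?thesis
  proof (cases "form (el a * el b) (el c) = 0")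
    case False
    then have "fst c = fst a + fst b" using form_el_parity assms by blast
    then have "(fst b + fst c) * fst a = fst a" by (cases "fst a"; cases "fst b") auto
    with eq show ?thesis by simp
  qed (simp add: eq)
qed

text \<open>
  A word in letters whose indices are bounded above by \<open>N\<close> has a nonzero trace only if the indices are
  bounded below as well; this is what makes all sums finite.
\<close>

definition wordbound :: "int \<Rightarrow> int \<Rightarrow> bool" where
  "wordbound N K \<longleftrightarrow> N \<le> K \<and>
    (\<forall>a\<in>IX. \<forall>b\<in>IX. \<forall>c\<in>IX. snd a \<le> N \<longrightarrow> snd b \<le> N \<longrightarrow> form (el a * el b) (el c) \<noteq> 0 \<longrightarrow>
      - K \<le> snd c \<and> (snd c \<le> N \<longrightarrow> - K \<le> snd a \<and> - K \<le> snd b))"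

lemma ex_common_wfilt: "finite X \<Longrightarrow> \<exists>m. \<forall>a\<in>X. el a \<in> wfilt m"
proof (induction X rule: finite_induct)
  case (insert x X)
  then obtain m where m: "\<forall>a\<in>X. el a \<in> wfilt m" by blast
  obtain n where n: "el x \<in> wfilt n" using ex_wfilt by blast
  have "wfilt m \<subseteq> wfilt (max m n)" "wfilt n \<subseteq> wfilt (max m n)" by (auto intro!: wfilt_mono)
  with m n show ?case by (intro exI[of _ "max m n"]) auto
qed simp

lemma ex_letters_wfilt: "\<exists>m. \<forall>a\<in>IX. snd a \<le> N \<longrightarrow> el a \<in> wfilt m"
proof -
  have "finite {a. snd a \<in> J (fst a) \<and> snd a \<le> N}"
    by (rule finite_subset[of _ "UNIV \<times> {0..N}"]) (auto dest: J_pos simp: UNIV_bit)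
  then obtain m where m: "\<forall>a\<in>{a. snd a \<in> J (fst a) \<and> snd a \<le> N}. el a \<in> wfilt m"
    using ex_common_wfilt by blast
  show ?thesis
  proof (intro exI[of _ m] ballI impI)
    fix a assume a: "a \<in> IX" "snd a \<le> N"
    then have "snd a \<in> ix (fst a)" by (simp add: IX_def)
    then show "el a \<in> wfilt m"
      by (rule ix_cases) (use a m in \<open>auto intro: neg_s_wfilt\<close>)
  qed
qed

lemma form_el_bound:
  assumes "u \<in> wfilt m" "u \<in> A k" "c \<in> IX" "form u (el c) \<noteq> 0 \<or> form (el c) u \<noteq> 0"
  shows "- int (wbound m) \<le> snd c"
proof (rule ccontr)
  assume n: "\<not> - int (wbound m) \<le> snd c"
  then have "- snd c \<in> J (fst c)" using assms(3) ix_J(2)[of "snd c" "fst c"] by (auto simp: IX_def)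
  then show False using form_beyond_wbound[OF assms(1,2), of "snd c" "fst c"] n assms(4) by auto
qed

text \<open>
  Only finitely many letters with index at most \<open>N\<close> are positive, so all of them lie in a common \<open>wfilt m\<close>, and
  the product of any two in \<open>wfilt (m + m)\<close>. After a rotation, the form pairs any given letter
  with the product of the other two.
\<close>

lemma ex_wordbound: "\<exists>K. wordbound N K"
proof -
  obtain m where m: "\<forall>a\<in>IX. snd a \<le> N \<longrightarrow> el a \<in> wfilt m" using ex_letters_wfilt by blast
  define K where "K = max N (int (wbound (m + m)))"
  have "- K \<le> snd c \<and> (snd c \<le> N \<longrightarrow> - K \<le> snd a \<and> - K \<le> snd b)"
    if abc: "a \<in> IX" "b \<in> IX" "c \<in> IX" "snd a \<le> N" "snd b \<le> N" and nz: "form (el a * el b) (el c) \<noteq> 0"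
    for a b c
  proof (intro conjI impI)
    have w: "el a \<in> wfilt m" "el b \<in> wfilt m" using m abc by auto
    show "- K \<le> snd c"
      using form_el_bound[OF wfilt_mult[OF w] el_mult_grade, of c] abc nz by (auto simp: K_def)
    assume "snd c \<le> N"
    with m abc have c: "el c \<in> wfilt m" by auto
    show "- K \<le> snd a"
      using form_el_bound[OF wfilt_mult[OF w(2) c] el_mult_grade, of a] abc nz
      by (auto simp: K_def form_assoc)
    have "form (el c * el a) (el b) \<noteq> 0"
      using form_el_rotate[of b c a] form_el_rotate[of a b c] nz abc by (auto simp: zsgn_def split: if_splits)
    then show "- K \<le> snd b"
      using form_el_bound[OF wfilt_mult[OF c w(1)] el_mult_grade, of b] abc by (auto simp: K_def)
  qed
  then have "wordbound N K" unfolding wordbound_def by (auto simp: K_def)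
  then show ?thesis by blast
qed

lemma wordboundD:
  assumes "wordbound N K" "a \<in> IX" "b \<in> IX" "c \<in> IX" "snd a \<le> N" "snd b \<le> N" "form (el a * el b) (el c) \<noteq> 0"
  shows "- K \<le> snd c" "snd c \<le> N \<Longrightarrow> a \<in> box K \<and> b \<in> box K \<and> c \<in> box K"
  using assms unfolding wordbound_def box_iff by force+

lemma ptw_parity_sum:
  "(\<Sum>p\<in>UNIV. zsgn (i * (k + p)) * (f * parity_part (k + p) g)) = f * ptw i g"
  by (cases i; cases k) (simp_all add: UNIV_bit ptw_def zsgn_def distrib_left right_diff_distrib algebra_simps)

lemma gbar_mult_outside:
  assumes "d \<notin> IX" shows "cf (gbar_mult \<xi> \<eta>) d = 0"
proof -
  have z: "(\<lambda>(i1, j1, i2, j2). sp_scale (coord (i1 + i2) (s i1 j1 * s i2 j2) (fst d) (snd d)) (F i1 j1 i2 j2)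
      when j1 \<in> J i1 \<union> uminus ` J i1 \<and> j2 \<in> J i2 \<union> uminus ` J i2) = (\<lambda>_. 0 :: 'k superpoly)" for F
  proof (intro ext, clarify)
    fix i1 j1 i2 j2
    have "coord (i1 + i2) (s i1 j1 * s i2 j2) (fst d) (snd d) = 0" if "j1 \<in> ix i1" "j2 \<in> ix i2"
      using that assms coord_form[OF grade_mult[OF s_grade s_grade, OF that], of "fst d" "snd d"]
      by (auto simp: IX_def)
    then show "(sp_scale (coord (i1 + i2) (s i1 j1 * s i2 j2) (fst d) (snd d)) (F i1 j1 i2 j2)
      when j1 \<in> J i1 \<union> uminus ` J i1 \<and> j2 \<in> J i2 \<union> uminus ` J i2) = 0"
      unfolding ix_eq by (simp add: when_def)
  qed
  show ?thesis unfolding gbar_mult_def gbar_mult_hom_def z by simp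
qed

text \<open>
  The sum that defines a coefficient of a product may be taken over any box that is large enough. The sign and
  the splitting of the second factor by parity are absorbed into \<open>ptw\<close>.
\<close>

lemma gbar_mult_coeff:
  assumes \<xi>: "gsupp N \<xi>" and \<eta>: "gsupp N \<eta>" and K: "wordbound N K"
    and d: "d \<in> IX" "- snd d \<le> N"
  shows "cf (gbar_mult \<xi> \<eta>) d =
    (\<Sum>a\<in>box K. \<Sum>b\<in>box K. sp_scale (ep d * form (el a * el b) (el (du d))) (cf \<xi> a * ptw (fst a) (cf \<eta> b)))"
proof -
  define c where "c a b = ep d * form (el a * el b) (el (du d))" for a b
  have cc: "coord (fst a + fst b) (el a * el b) (fst d) (snd d) = c a b" if "a \<in> IX" "b \<in> IX" for a b
  proof -
    have "coord (fst a + fst b) (el a * el b) (fst d) (snd d) =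
        (if fst d = fst a + fst b then c a b else 0)"
      using d coord_form[OF el_mult_grade[OF that], of "fst d" "snd d"] by (auto simp: c_def IX_def)
    then show ?thesis
      using form_el_parity[of a b "du d"] that d by (auto simp: c_def)
  qed
  define T where "T p a b = sp_scale (c a b) (zsgn (fst a * (fst b + p)) * (cf \<xi> a * parity_part (fst b + p) (cf \<eta> b)))"
    for p a b
  define g where "g p = (\<lambda>(i1, j1, i2, j2).
     sp_scale (coord (i1 + i2) (s i1 j1 * s i2 j2) (fst d) (snd d))
       (zsgn (i1 * (i2 + p)) * (\<xi> i1 j1 * gbar_part p \<eta> i2 j2))
     when j1 \<in> J i1 \<union> uminus ` J i1 \<and> j2 \<in> J i2 \<union> uminus ` J i2)" for p
  define t where "t = (\<lambda>(a, b). (fst a, snd a, fst b, snd b) :: bit \<times> int \<times> bit \<times> int)"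
  have inj: "inj_on t (box K \<times> box K)" by (auto simp: inj_on_def t_def prod_eq_iff)
  have gt: "g p (t (a, b)) = (if a \<in> IX \<and> b \<in> IX then T p a b else 0)" for p a b
    using cc[of a b] unfolding g_def t_def ix_eq
    by (cases a; cases b) (auto simp: T_def gbar_part_def IX_def when_def)
  have hom: "gbar_mult_hom p \<xi> (gbar_part p \<eta>) (fst d) (snd d) = (\<Sum>a\<in>box K. \<Sum>b\<in>box K. T p a b)" for p
  proof -
    have "gbar_mult_hom p \<xi> (gbar_part p \<eta>) (fst d) (snd d) = Sum_any (g p)"
      by (simp add: gbar_mult_hom_def g_def)
    also have "\<dots> = sum (g p) (t ` (box K \<times> box K))"
    proof (rule Sum_any.expand_superset)
      show "{x. g p x \<noteq> 0} \<subseteq> t ` (box K \<times> box K)"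
      proof
        fix x assume "x \<in> {x. g p x \<noteq> 0}"
        then have nz: "g p x \<noteq> 0" by simp
        obtain i1 j1 i2 j2 where "x = (i1, j1, i2, j2)" by (cases x)
        then obtain a b where x: "x = t (a, b)"
          using that[of "(i1, j1)" "(i2, j2)"] by (simp add: t_def)
        with nz gt have ab: "a \<in> IX" "b \<in> IX" and T: "T p a b \<noteq> 0" by (metis (full_types))+
        then have "cf \<xi> a \<noteq> 0" "cf \<eta> b \<noteq> 0" "form (el a * el b) (el (du d)) \<noteq> 0"
          by (auto simp: T_def c_def)
        with \<xi> \<eta> have "snd a \<le> N" "snd b \<le> N" by (auto simp: gsupp_def)
        with wordboundD(2)[OF K ab, of "du d"] \<open>form _ _ \<noteq> 0\<close> d have "a \<in> box K" "b \<in> box K" by auto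
        with x show "x \<in> t ` (box K \<times> box K)" by auto
      qed
    qed simp
    also have "\<dots> = (\<Sum>(a, b)\<in>box K \<times> box K. T p a b)"
      unfolding sum.reindex[OF inj] by (intro sum.cong) (auto simp: gt box_iff)
    also have "\<dots> = (\<Sum>a\<in>box K. \<Sum>b\<in>box K. T p a b)"
      by (rule sum.cartesian_product[symmetric])
    finally show ?thesis .
  qed
  have "cf (gbar_mult \<xi> \<eta>) d = (\<Sum>p\<in>UNIV. \<Sum>a\<in>box K. \<Sum>b\<in>box K. T p a b)"
    by (simp add: gbar_mult_def hom)
  also have "\<dots> = (\<Sum>a\<in>box K. \<Sum>b\<in>box K. \<Sum>p\<in>UNIV. T p a b)"
    by (subst sum.swap, rule sum.cong[OF refl], rule sum.swap)
  also have "\<dots> = (\<Sum>a\<in>box K. \<Sum>b\<in>box K. sp_scale (c a b) (cf \<xi> a * ptw (fst a) (cf \<eta> b)))"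
    unfolding T_def by (simp only: sp_scale_sum[symmetric] ptw_parity_sum)
  finally show ?thesis by (simp add: c_def)
qed

lemma gbar_mult_supp:
  assumes \<xi>: "gsupp N \<xi>" and \<eta>: "gsupp N \<eta>" and K: "wordbound N K"
  shows "gsupp K (gbar_mult \<xi> \<eta>)"
  unfolding gsupp_def
proof (intro allI impI conjI)
  fix d assume nz: "cf (gbar_mult \<xi> \<eta>) d \<noteq> 0"
  then show d: "d \<in> IX" using gbar_mult_outside by blast
  define N' where "N' = max N (- snd d)"
  obtain K' where K': "wordbound N' K'" using ex_wordbound by blast
  have s: "gsupp N' \<xi>" "gsupp N' \<eta>" using \<xi> \<eta> gsupp_mono by (auto simp: N'_def)
  obtain a b where ab: "a \<in> box K'" "b \<in> box K'"
      and nz: "sp_scale (ep d * form (el a * el b) (el (du d))) (cf \<xi> a * ptw (fst a) (cf \<eta> b)) \<noteq> 0"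
  proof -
    from nz have "(\<Sum>a\<in>box K'. \<Sum>b\<in>box K'. sp_scale (ep d * form (el a * el b) (el (du d)))
        (cf \<xi> a * ptw (fst a) (cf \<eta> b))) \<noteq> 0"
      using gbar_mult_coeff[OF s K' d] by (simp add: N'_def)
    then show ?thesis using that by (metis (no_types, lifting) sum.neutral)
  qed
  then have "cf \<xi> a \<noteq> 0" "cf \<eta> b \<noteq> 0" "form (el a * el b) (el (du d)) \<noteq> 0" by auto
  then have "- K \<le> snd (du d)"
    using \<xi> \<eta> d ab by (intro wordboundD(1)[OF K, of a b]) (auto simp: gsupp_def box_iff)
  then show "snd d \<le> K" by simp
qed

lemma sum_box_du: "(\<Sum>a\<in>box N. h (du a)) = (\<Sum>a\<in>box N. h a)"
  by (rule sum.reindex_bij_witness[of _ du du]) auto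

lemma gbar_form_box:
  assumes \<xi>: "gsupp N \<xi>" and \<eta>: "gsupp N \<eta>"
  shows "gbar_form \<xi> \<eta> = (\<Sum>a\<in>box N. ep a * (cf \<xi> a * ptw (fst a) (cf \<eta> (du a))))"
proof -
  define P where "P = {a. snd a \<in> J (fst a) \<and> snd a \<le> N}"
  have fin: "finite P"
    by (rule finite_subset[of _ "UNIV \<times> {0..N}"]) (auto dest: J_pos simp: P_def UNIV_bit)
  have box: "box N = P \<union> du ` P" and disj: "P \<inter> du ` P = {}"
  proof -
    show "box N = P \<union> du ` P"
    proof safe
      fix i j assume ij: "(i, j) \<in> box N" "(i, j) \<notin> du ` P"
      then have "- j \<notin> J i" by (force simp: P_def box_def dest: J_pos intro: image_eqI[of _ _ "(i, - j)"])
      then show "(i, j) \<in> P" using ij by (auto simp: box_def P_def ix_def)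
    qed (auto simp: P_def box_def J_ix dest!: J_pos)
    show "P \<inter> du ` P = {}" by (auto simp: P_def dest!: J_pos)
  qed
  define g where "g p = (\<lambda>(i, j).
     zsgn (i * (i + p)) * (\<xi> i (- j) * gbar_part p \<eta> i j + zsgn i * (\<xi> i j * gbar_part p \<eta> i (- j)))
     when j \<in> J i)" for p
  have hom: "gbar_form_hom p \<xi> (gbar_part p \<eta>) = (\<Sum>a\<in>P. g p a)" for p
    unfolding gbar_form_hom_def g_def[symmetric]
  proof (rule Sum_any.expand_superset[OF fin])
    show "{a. g p a \<noteq> 0} \<subseteq> P"
    proof safe
      fix i j assume nz: "g p (i, j) \<noteq> 0"
      then have j: "j \<in> J i" by (auto simp: g_def when_def split: if_splits)
      have "\<eta> i j \<noteq> 0 \<or> \<xi> i j \<noteq> 0" using nz by (auto simp: g_def gbar_part_def when_def split: if_splits)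
      then have "j \<le> N" using \<xi> \<eta> by (auto simp: gsupp_def)
      with j show "(i, j) \<in> P" by (simp add: P_def)
    qed
  qed
  have ge: "(\<Sum>p\<in>UNIV. g p a) = cf \<xi> (du a) * ptw (fst a) (cf \<eta> a) + zsgn (fst a) * (cf \<xi> a * ptw (fst a) (cf \<eta> (du a)))"
    if "a \<in> P" for a
  proof -
    have "g p a = zsgn (fst a * (fst a + p)) * (cf \<xi> (du a) * parity_part (fst a + p) (cf \<eta> a))
        + zsgn (fst a) * (zsgn (fst a * (fst a + p)) * (cf \<xi> a * parity_part (fst a + p) (cf \<eta> (du a))))" for p
      using that by (cases "fst a * (fst a + p)"; cases "fst a"; cases a)
        (auto simp: g_def P_def gbar_part_def zsgn_def algebra_simps)
    then show ?thesis
      by (simp only: sum.distrib sum_distrib_left[symmetric] ptw_parity_sum)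
  qed
  have "gbar_form \<xi> \<eta> = (\<Sum>p\<in>UNIV. \<Sum>a\<in>P. g p a)"
    by (simp add: gbar_form_def hom)
  also have "\<dots> = (\<Sum>a\<in>P. cf \<xi> (du a) * ptw (fst a) (cf \<eta> a)
      + zsgn (fst a) * (cf \<xi> a * ptw (fst a) (cf \<eta> (du a))))"
    by (subst sum.swap) (simp add: ge)
  also have "\<dots> = (\<Sum>a\<in>du ` P. ep a * (cf \<xi> a * ptw (fst a) (cf \<eta> (du a))))
      + (\<Sum>a\<in>P. ep a * (cf \<xi> a * ptw (fst a) (cf \<eta> (du a))))"
  proof -
    have "(\<Sum>a\<in>du ` P. ep a * (cf \<xi> a * ptw (fst a) (cf \<eta> (du a)))) = (\<Sum>a\<in>P. cf \<xi> (du a) * ptw (fst a) (cf \<eta> a))"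
      by (subst sum.reindex) (auto simp: inj_on_def P_def eps_def dest!: J_pos intro!: sum.cong)
    moreover have "(\<Sum>a\<in>P. ep a * (cf \<xi> a * ptw (fst a) (cf \<eta> (du a)))) =
        (\<Sum>a\<in>P. zsgn (fst a) * (cf \<xi> a * ptw (fst a) (cf \<eta> (du a))))"
      by (intro sum.cong) (auto simp: P_def eps_def dest!: J_pos)
    ultimately show ?thesis by (simp add: sum.distrib)
  qed
  also have "\<dots> = (\<Sum>a\<in>box N. ep a * (cf \<xi> a * ptw (fst a) (cf \<eta> (du a))))"
    unfolding box using fin disj by (subst sum.union_disjoint) (auto simp: add.commute)
  finally show ?thesis .
qed

lemma gsupp_common: "gsupp N \<xi> \<Longrightarrow> gsupp N' \<eta> \<Longrightarrow> gsupp (max N N') \<xi> \<and> gsupp (max N N') \<eta>"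
  by (auto intro: gsupp_mono)

lemma gsupp_add: "gsupp N \<xi> \<Longrightarrow> gsupp N \<eta> \<Longrightarrow> gsupp N (\<xi> + \<eta>)"
  unfolding gsupp_def plus_fun_def by (metis add_0)

lemma gsupp_uminus: "gsupp N \<xi> \<Longrightarrow> gsupp N (- \<xi>)"
  by (simp add: gsupp_def)

lemma gbar_mult_ext:
  assumes "gsupp N \<xi>" "gsupp N \<eta>" "gsupp N' \<xi>'"
    and "\<And>M K d. N \<le> M \<Longrightarrow> N' \<le> M \<Longrightarrow> wordbound M K \<Longrightarrow> d \<in> IX \<Longrightarrow> - snd d \<le> M \<Longrightarrow>
      cf (gbar_mult \<xi> \<eta>) d = cf \<xi>' d"
  shows "gbar_mult \<xi> \<eta> = \<xi>'"
proof (intro ext)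
  fix i j
  show "gbar_mult \<xi> \<eta> i j = \<xi>' i j"
  proof (cases "(i, j) \<in> IX")
    case True
    obtain K where "wordbound (max (max N N') (- j)) K" using ex_wordbound by blast
    then show ?thesis using assms(4)[of "max (max N N') (- j)" K "(i, j)"] True by simp
  next
    case False
    then show ?thesis using gbar_mult_outside[of "(i, j)"] assms(3) by (auto simp: gsupp_def)
  qed
qed

lemma gbar_mult_add_left:
  assumes "gsupp N \<xi>" "gsupp N \<xi>'" "gsupp N \<eta>"
  shows "gbar_mult (\<xi> + \<xi>') \<eta> = gbar_mult \<xi> \<eta> + gbar_mult \<xi>' \<eta>"
proof -
  obtain K where K: "wordbound N K" using ex_wordbound by blast
  show ?thesis
  proof (rule gbar_mult_ext)
    show "gsupp N (\<xi> + \<xi>')" "gsupp N \<eta>" "gsupp K (gbar_mult \<xi> \<eta> + gbar_mult \<xi>' \<eta>)"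
      using assms K by (auto intro: gsupp_add gbar_mult_supp)
    fix M K' d assume M: "N \<le> M" "wordbound M K'" "d \<in> IX" "- snd d \<le> M"
    then have s: "gsupp M \<xi>" "gsupp M \<xi>'" "gsupp M \<eta>" "gsupp M (\<xi> + \<xi>')"
      using assms by (auto intro: gsupp_mono gsupp_add)
    show "cf (gbar_mult (\<xi> + \<xi>') \<eta>) d = cf (gbar_mult \<xi> \<eta> + gbar_mult \<xi>' \<eta>) d"
      using gbar_mult_coeff[OF s(4,3) M(2-4)] gbar_mult_coeff[OF s(1,3) M(2-4)] gbar_mult_coeff[OF s(2,3) M(2-4)]
      by (simp add: plus_fun_def distrib_right sp_scale_add_right sum.distrib)
  qed
qed

lemma gbar_mult_add_right:
  assumes "gsupp N \<xi>" "gsupp N \<xi>'" "gsupp N \<eta>"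
  shows "gbar_mult \<eta> (\<xi> + \<xi>') = gbar_mult \<eta> \<xi> + gbar_mult \<eta> \<xi>'"
proof -
  obtain K where K: "wordbound N K" using ex_wordbound by blast
  show ?thesis
  proof (rule gbar_mult_ext)
    show "gsupp N \<eta>" "gsupp N (\<xi> + \<xi>')" "gsupp K (gbar_mult \<eta> \<xi> + gbar_mult \<eta> \<xi>')"
      using assms K by (auto intro: gsupp_add gbar_mult_supp)
    fix M K' d assume M: "N \<le> M" "wordbound M K'" "d \<in> IX" "- snd d \<le> M"
    then have s: "gsupp M \<xi>" "gsupp M \<xi>'" "gsupp M \<eta>" "gsupp M (\<xi> + \<xi>')"
      using assms by (auto intro: gsupp_mono gsupp_add)
    show "cf (gbar_mult \<eta> (\<xi> + \<xi>')) d = cf (gbar_mult \<eta> \<xi> + gbar_mult \<eta> \<xi>') d"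
      using gbar_mult_coeff[OF s(3,4) M(2-4)] gbar_mult_coeff[OF s(3,1) M(2-4)] gbar_mult_coeff[OF s(3,2) M(2-4)]
      by (simp add: plus_fun_def distrib_left sp_scale_add_right sum.distrib ptw_add)
  qed
qed

lemma gbar_form_add_left:
  assumes "gsupp N \<xi>" "gsupp N \<xi>'" "gsupp N \<eta>"
  shows "gbar_form (\<xi> + \<xi>') \<eta> = gbar_form \<xi> \<eta> + gbar_form \<xi>' \<eta>"
  using gbar_form_box[OF gsupp_add[OF assms(1,2)] assms(3)] gbar_form_box[OF assms(1,3)] gbar_form_box[OF assms(2,3)]
  by (simp add: plus_fun_def distrib_right distrib_left sum.distrib)

lemma gbar_form_add_right:
  assumes "gsupp N \<xi>" "gsupp N \<xi>'" "gsupp N \<eta>"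
  shows "gbar_form \<eta> (\<xi> + \<xi>') = gbar_form \<eta> \<xi> + gbar_form \<eta> \<xi>'"
  using gbar_form_box[OF assms(3) gsupp_add[OF assms(1,2)]] gbar_form_box[OF assms(3,1)] gbar_form_box[OF assms(3,2)]
  by (simp add: plus_fun_def distrib_left sum.distrib ptw_add)

lemma eps_du: "(i, j) \<in> IX \<Longrightarrow> eps i j * eps i (- j) = (zsgn i :: 'r::ring_1)"
  using ix_nonzero[of j i] by (auto simp: eps_def IX_def)

lemma eps_square: "eps i j * eps i j = (1 :: 'r::ring_1)"
  by (simp add: eps_def zsgn_square)

lemma eps_scale: "eps i j * f = sp_scale (eps i j) f"
  by (simp add: eps_def sp_scale_one)

text \<open>Here and in \<open>gbar_form_mult_right\<close>, the two ways of bracketing yield one and the same sum over words.\<close>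

lemma gbar_form_mult_left:
  assumes "gsupp N \<xi>" "gsupp N \<eta>" "gsupp N \<zeta>" and K: "wordbound N K"
  shows "gbar_form (gbar_mult \<xi> \<eta>) \<zeta> = (\<Sum>a\<in>box K. \<Sum>b\<in>box K. \<Sum>c\<in>box K.
    sp_scale (form (el a * el b) (el c)) (cf \<xi> a * (ptw (fst a) (cf \<eta> b) * ptw (fst a + fst b) (cf \<zeta> c))))"
proof -
  have NK: "N \<le> K" using K by (simp add: wordbound_def)
  let ?T = "\<lambda>a b c. sp_scale (form (el a * el b) (el c))
    (cf \<xi> a * (ptw (fst a) (cf \<eta> b) * ptw (fst a + fst b) (cf \<zeta> c)))"
  have "gbar_form (gbar_mult \<xi> \<eta>) \<zeta> =
      (\<Sum>d\<in>box K. ep d * (cf (gbar_mult \<xi> \<eta>) d * ptw (fst d) (cf \<zeta> (du d))))"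
    by (rule gbar_form_box[OF gbar_mult_supp[OF assms(1,2) K] gsupp_mono[OF assms(3) NK]])
  also have "\<dots> = (\<Sum>d\<in>box K. \<Sum>a\<in>box K. \<Sum>b\<in>box K. ?T a b (du d))"
  proof (intro sum.cong refl)
    fix d assume d: "d \<in> box K"
    show "ep d * (cf (gbar_mult \<xi> \<eta>) d * ptw (fst d) (cf \<zeta> (du d))) = (\<Sum>a\<in>box K. \<Sum>b\<in>box K. ?T a b (du d))"
    proof (cases "cf \<zeta> (du d) = 0")
      case False
      with assms(3) have dN: "d \<in> IX" "- snd d \<le> N" unfolding gsupp_def using d by (auto simp: box_iff dest: spec[of _ "du d"])
      have "ep d * (cf (gbar_mult \<xi> \<eta>) d * ptw (fst d) (cf \<zeta> (du d))) = (\<Sum>a\<in>box K. \<Sum>b\<in>box K.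
        sp_scale (ep d * (ep d * form (el a * el b) (el (du d))))
          (cf \<xi> a * (ptw (fst a) (cf \<eta> b) * ptw (fst d) (cf \<zeta> (du d)))))"
        by (simp add: gbar_mult_coeff[OF assms(1,2) K dN] eps_scale sum_distrib_right sp_scale_sum
            sp_scale_scale sp_scale_mult_left mult.assoc)
      also have "\<dots> = (\<Sum>a\<in>box K. \<Sum>b\<in>box K. ?T a b (du d))"
      proof (intro sum.cong refl)
        fix a b assume ab: "a \<in> box K" "b \<in> box K"
        show "sp_scale (ep d * (ep d * form (el a * el b) (el (du d))))
          (cf \<xi> a * (ptw (fst a) (cf \<eta> b) * ptw (fst d) (cf \<zeta> (du d)))) = ?T a b (du d)"
        proof (cases "form (el a * el b) (el (du d)) = 0")
          case False
          then have "fst d = fst a + fst b" using form_el_parity[of a b "du d"] ab d by (auto simp: box_iff)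
          then show ?thesis by (simp add: eps_square flip: mult.assoc)
        qed simp
      qed
      finally show ?thesis .
    qed simp
  qed
  also have "\<dots> = (\<Sum>c\<in>box K. \<Sum>a\<in>box K. \<Sum>b\<in>box K. ?T a b c)"
    by (rule sum_box_du[where h = "\<lambda>c. \<Sum>a\<in>box K. \<Sum>b\<in>box K. ?T a b c"])
  also have "\<dots> = (\<Sum>a\<in>box K. \<Sum>b\<in>box K. \<Sum>c\<in>box K. ?T a b c)"
    by (subst sum.swap, rule sum.cong[OF refl], rule sum.swap)
  finally show ?thesis .
qed

lemma gbar_form_mult_right:
  assumes "gsupp N \<xi>" "gsupp N \<eta>" "gsupp N \<zeta>" and K: "wordbound N K"
  shows "gbar_form \<xi> (gbar_mult \<eta> \<zeta>) = (\<Sum>a\<in>box K. \<Sum>b\<in>box K. \<Sum>c\<in>box K.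
    sp_scale (form (el a * el b) (el c)) (cf \<xi> a * (ptw (fst a) (cf \<eta> b) * ptw (fst a + fst b) (cf \<zeta> c))))"
proof -
  have NK: "N \<le> K" using K by (simp add: wordbound_def)
  let ?T = "\<lambda>a b c. sp_scale (form (el a * el b) (el c))
    (cf \<xi> a * (ptw (fst a) (cf \<eta> b) * ptw (fst a + fst b) (cf \<zeta> c)))"
  have "gbar_form \<xi> (gbar_mult \<eta> \<zeta>) =
      (\<Sum>a\<in>box K. ep a * (cf \<xi> a * ptw (fst a) (cf (gbar_mult \<eta> \<zeta>) (du a))))"
    by (rule gbar_form_box[OF gsupp_mono[OF assms(1) NK] gbar_mult_supp[OF assms(2,3) K]])
  also have "\<dots> = (\<Sum>a\<in>box K. \<Sum>b\<in>box K. \<Sum>c\<in>box K. ?T a b c)"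
  proof (intro sum.cong refl)
    fix a assume a: "a \<in> box K"
    show "ep a * (cf \<xi> a * ptw (fst a) (cf (gbar_mult \<eta> \<zeta>) (du a))) = (\<Sum>b\<in>box K. \<Sum>c\<in>box K. ?T a b c)"
    proof (cases "cf \<xi> a = 0")
      case False
      then have aN: "du a \<in> IX" "- snd (du a) \<le> N" using gsuppD[OF assms(1)] by auto
      have e: "gbar_mult \<eta> \<zeta> (fst a) (- snd a) = (\<Sum>b\<in>box K. \<Sum>c\<in>box K.
          sp_scale (ep (du a) * form (el b * el c) (el a)) (cf \<eta> b * ptw (fst b) (cf \<zeta> c)))"
        using gbar_mult_coeff[OF assms(2,3) K aN] by simp
      have "ep a * (cf \<xi> a * ptw (fst a) (cf (gbar_mult \<eta> \<zeta>) (du a))) = (\<Sum>b\<in>box K. \<Sum>c\<in>box K.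
        sp_scale (ep a * ep (du a) * form (el b * el c) (el a))
          (cf \<xi> a * (ptw (fst a) (cf \<eta> b) * ptw (fst a + fst b) (cf \<zeta> c))))"
        by (simp add: e eps_scale sum_distrib_left sp_scale_sum ptw_sum
            ptw_scale ptw_mult ptw_ptw sp_scale_scale sp_scale_mult_right mult.assoc mult.commute mult.left_commute)
      also have "\<dots> = (\<Sum>b\<in>box K. \<Sum>c\<in>box K. ?T a b c)"
        using a by (intro sum.cong refl)
          (simp add: eps_du form_el_rotate[of a] box_iff zsgn_zsgn)
      finally show ?thesis .
    qed simp
  qed
  finally show ?thesis .
qed

lemma gbar_form_assoc:
  assumes "gsupp N \<xi>" "gsupp N \<eta>" "gsupp N \<zeta>"
  shows "gbar_form (gbar_mult \<xi> \<eta>) \<zeta> = gbar_form \<xi> (gbar_mult \<eta> \<zeta>)"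
proof -
  obtain K where "wordbound N K" using ex_wordbound by blast
  with assms show ?thesis by (simp only: gbar_form_mult_left gbar_form_mult_right)
qed

lemma embed_coeff: "u \<in> A k \<Longrightarrow> embed k u i j =
    (if (i, j) \<in> IX \<and> i = k then sp_scale (eps i j * form u (s i (- j))) 1 else 0)"
  by (auto simp: embed_def coord_form IX_def)

lemma embed_other: "u \<in> A k \<Longrightarrow> i \<noteq> k \<Longrightarrow> embed k u i j = 0"
  by (simp add: embed_coeff)

lemma embed_supp: "u \<in> A k \<Longrightarrow> \<exists>N. gsupp N (embed k u)"
proof -
  assume u: "u \<in> A k"
  obtain m where m: "u \<in> wfilt m" using ex_wfilt by blast
  have "gsupp (int (wbound m)) (embed k u)"
    unfolding gsupp_def
  proof (intro allI impI)
    fix a assume "cf (embed k u) a \<noteq> 0"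
    then have a: "a \<in> IX" "form u (el (du a)) \<noteq> 0"
      by (auto simp: embed_coeff[OF u] split: if_splits)
    then have "- int (wbound m) \<le> snd (du a)"
      using form_el_bound[OF m u, of "du a"] by auto
    with a show "a \<in> IX \<and> snd a \<le> int (wbound m)" by auto
  qed
  then show ?thesis by blast
qed

lemma form_embed_embed:
  assumes u: "u \<in> A k" and v: "v \<in> A l"
  shows "gbar_form (embed k u) (embed l v) = sp_scale (form u v) 1"
proof -
  obtain m n where m: "u \<in> wfilt m" and n: "v \<in> wfilt n" using ex_wfilt by blast
  obtain N1 N2 where "gsupp N1 (embed k u)" "gsupp N2 (embed l v)" using embed_supp u v by blast
  define N where "N = max (max N1 N2) (max (int (wbound m)) (int (wbound n)))"
  have s: "gsupp N (embed k u)" "gsupp N (embed l v)"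
    using \<open>gsupp N1 _\<close> \<open>gsupp N2 _\<close> by (auto simp: N_def intro: gsupp_mono)
  show ?thesis
  proof (cases "k = l")
    case False
    have "gbar_form (embed k u) (embed l v) = 0"
      unfolding gbar_form_box[OF s]
    proof (intro sum.neutral ballI)
      fix a
      show "ep a * (cf (embed k u) a * ptw (fst a) (cf (embed l v) (du a))) = 0"
        using False embed_other[OF u, of "fst a"] embed_other[OF v, of "fst a"] by (cases "fst a = k") auto
    qed
    then show ?thesis using form_grade'[OF u v False] by simp
  next
    case True
    let ?c = "\<lambda>j. eps k j * form u (s k (- j)) * form (s k j) v"
    have "gbar_form (embed k u) (embed l v) = (\<Sum>a\<in>box N. sp_scale (if fst a = k then ?c (snd a) else 0) 1)"
      unfolding gbar_form_box[OF s]
    proof (intro sum.cong refl)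
      fix a assume "a \<in> box N"
      then have a: "a \<in> IX" by (simp add: box_iff)
      show "ep a * (cf (embed k u) a * ptw (fst a) (cf (embed l v) (du a))) =
          sp_scale (if fst a = k then ?c (snd a) else 0) 1"
      proof (cases "fst a = k")
        case ak: True
        then obtain j where aj: "a = (k, j)" by (cases a) auto
        with a have j: "(k, j) \<in> IX" "s k j \<in> A k" using el_grade[OF a] by auto
        have "form v (s k j) = zsgn k * form (s k j) v"
          using form_supersymmetric[OF v j(2)] True by simp
        then have "(eps k j * eps k j) * form u (s k (- j)) * (eps k (- j) * form v (s k j)) =
            (eps k j * eps k (- j)) * zsgn k * (eps k j * form u (s k (- j)) * form (s k j) v)"
          by (simp only: mult_ac)
        also have "\<dots> = ?c j" using eps_du[OF j(1), where 'r = 'k] by (simp add: zsgn_square)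
        finally have e: "(eps k j * eps k j) * form u (s k (- j)) * (eps k (- j) * form v (s k j)) = ?c j" .
        have "embed k u k j = sp_scale (eps k j * form u (s k (- j))) 1"
          "embed l v k (- j) = sp_scale (eps k (- j) * form v (s k j)) 1"
          using u v j True by (simp_all add: embed_coeff)
        then have "ep a * (cf (embed k u) a * ptw (fst a) (cf (embed l v) (du a))) =
            sp_scale ((eps k j * eps k j) * form u (s k (- j)) * (eps k (- j) * form v (s k j))) 1"
          by (simp add: aj ptw_scale ptw_one sp_scale_mult_left sp_scale_scale eps_scale mult_ac)
        then show ?thesis unfolding e by (simp add: aj)
      qed (simp add: embed_other[OF u])
    qed
    also have "\<dots> = sp_scale (\<Sum>a\<in>box N. if fst a = k then ?c (snd a) else 0) 1"
      by (rule sp_scale_sum_left[symmetric])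
    also have "(\<Sum>a\<in>box N. if fst a = k then ?c (snd a) else 0) = (\<Sum>a\<in>{k} \<times> {j\<in>ix k. \<bar>j\<bar> \<le> N}. ?c (snd a))"
      by (rule sum.mono_neutral_cong_right[OF finite_box]) (auto simp: box_def)
    also have "\<dots> = (\<Sum>j\<in>{j\<in>ix k. \<bar>j\<bar> \<le> N}. ?c j)"
      by (rule sum.reindex_bij_witness[of _ "\<lambda>j. (k, j)" snd]) auto
    also have "\<dots> = form u v"
      by (rule form_expansion[symmetric, OF u m _ n]) (use v True in \<open>auto simp: N_def\<close>)
    finally show ?thesis .
  qed
qed

lemma embed_unit:
  assumes a: "a \<in> IX"
  shows "cf (embed (fst a) (el a)) b = (if b = a then 1 else 0)"
proof (cases "b \<in> IX \<and> fst b = fst a")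
  case True
  have "ep b * form (el a) (el (du b)) = (if b = a then 1 else 0)"
  proof (cases "snd a > 0")
    case pa: True
    then have ja: "snd a \<in> J (fst a)" using a ix_J by (auto simp: IX_def)
    show ?thesis
    proof (cases "snd b > 0")
      case pb: True
      then have jb: "snd b \<in> J (fst b)" using True ix_J by (auto simp: IX_def)
      have "form (el a) (el (du b)) = zsgn (fst a) * form (el (du b)) (el a)"
        using form_supersymmetric[OF el_grade el_grade, of a "du b"] a True by (metis IX_du(1) bit_mult_self fst_conv)
      then show ?thesis
        using dual[OF jb ja] True pb by (cases a; cases b) (auto simp: eps_def zsgn_zsgn)
    next
      case False
      then have jb: "- snd b \<in> J (fst b)"
        using True ix_J ix_nonzero[of "snd b" "fst b"] by (auto simp: IX_def)
      then show ?thesis using isotropic_pos s_pos ja pa False by auto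
    qed
  next
    case na: False
    then have ja: "- snd a \<in> J (fst a)"
      using a ix_J ix_nonzero[of "snd a" "fst a"] by (auto simp: IX_def)
    show ?thesis
    proof (cases "snd b > 0")
      case pb: True
      then have jb: "snd b \<in> J (fst b)" using True ix_J by (auto simp: IX_def)
      then show ?thesis using isotropic_neg s_neg ja na pb by auto
    next
      case False
      then have jb: "- snd b \<in> J (fst b)"
        using True ix_J ix_nonzero[of "snd b" "fst b"] by (auto simp: IX_def)
      show ?thesis
        using dual[OF ja jb] True False by (cases a; cases b) (auto simp: eps_def)
    qed
  qed
  with True a show ?thesis
    by (cases "b = a") (auto simp: embed_coeff el_grade sp_scale_one)
next
  case False
  with a show ?thesis by (auto simp: embed_coeff el_grade)
qed

text \<open>
  The form is nondegenerate, since it is so against the generators. Associativity of the product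
  follows from associativity of the form by replacing the factors one by one by generators.
\<close>

definition unit :: "bit \<times> int \<Rightarrow> 'k gbar" where
  "unit a = embed (fst a) (el a)"

lemma unit_supp: "a \<in> IX \<Longrightarrow> \<exists>N. gsupp N (unit a)"
  unfolding unit_def by (rule embed_supp, rule el_grade)

text \<open>
  Finiteness of all operations depends on the support alone. The parities and the variables of the
  coefficients only enter in \<open>gH\<close> below.
\<close>

definition gfin :: "'k gbar set" where
  "gfin = {\<xi>. \<exists>N. gsupp N \<xi>}"

lemma gfin_mult [intro, simp]: "\<xi> \<in> gfin \<Longrightarrow> \<eta> \<in> gfin \<Longrightarrow> gbar_mult \<xi> \<eta> \<in> gfin"
proof -
  assume "\<xi> \<in> gfin" "\<eta> \<in> gfin"
  then obtain N N' where "gsupp N \<xi>" "gsupp N' \<eta>" by (auto simp: gfin_def)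
  then have "gsupp (max N N') \<xi>" "gsupp (max N N') \<eta>" using gsupp_common by blast+
  moreover obtain K where "wordbound (max N N') K" using ex_wordbound by blast
  ultimately have "gsupp K (gbar_mult \<xi> \<eta>)" by (rule gbar_mult_supp)
  then show ?thesis by (auto simp: gfin_def)
qed

lemma gfin_unit [intro, simp]: "a \<in> IX \<Longrightarrow> unit a \<in> gfin"
  using unit_supp by (simp add: gfin_def)

lemma gfin_common2: "\<xi> \<in> gfin \<Longrightarrow> \<eta> \<in> gfin \<Longrightarrow> \<exists>N. gsupp N \<xi> \<and> gsupp N \<eta>"
  using gsupp_common by (auto simp: gfin_def) blast

lemma gfin_common3: "\<xi> \<in> gfin \<Longrightarrow> \<eta> \<in> gfin \<Longrightarrow> \<zeta> \<in> gfin \<Longrightarrow> \<exists>N. gsupp N \<xi> \<and> gsupp N \<eta> \<and> gsupp N \<zeta>"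
  using gsupp_common gsupp_mono unfolding gfin_def mem_Collect_eq by (meson max.cobounded1 max.cobounded2)

lemma gform_assoc:
  assumes "\<xi> \<in> gfin" "\<eta> \<in> gfin" "\<zeta> \<in> gfin"
  shows "gbar_form (gbar_mult \<xi> \<eta>) \<zeta> = gbar_form \<xi> (gbar_mult \<eta> \<zeta>)"
  using gfin_common3[OF assms] gbar_form_assoc by blast

lemma gbar_form_unit:
  assumes \<xi>: "\<xi> \<in> gfin" and c: "c \<in> IX"
  shows "gbar_form \<xi> (unit c) = ep (du c) * cf \<xi> (du c)"
proof -
  obtain N where N: "gsupp N \<xi>" "gsupp N (unit c)" using gfin_common2[OF \<xi> gfin_unit[OF c]] by blast
  define M where "M = max N \<bar>snd c\<bar>"
  have s: "gsupp M \<xi>" "gsupp M (unit c)" using N by (auto simp: M_def intro: gsupp_mono)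
  have dc: "du a = c \<longleftrightarrow> a = du c" for a by (auto simp: prod_eq_iff)
  have "gbar_form \<xi> (unit c) = (\<Sum>a\<in>box M. if a = du c then ep (du c) * cf \<xi> (du c) else 0)"
    unfolding gbar_form_box[OF s]
    by (intro sum.cong refl) (simp only: unit_def embed_unit[OF c] dc, simp add: ptw_one)
  moreover have "du c \<in> box M" using c by (simp add: box_iff M_def)
  ultimately show ?thesis by simp
qed

lemma gbar_eqI:
  assumes "\<xi> \<in> gfin" "\<eta> \<in> gfin" "\<And>a. a \<in> IX \<Longrightarrow> gbar_form \<xi> (unit a) = gbar_form \<eta> (unit a)"
  shows "\<xi> = \<eta>"
proof (intro ext)
  fix i j
  show "\<xi> i j = \<eta> i j"
  proof (cases "(i, j) \<in> IX")
    case True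
    then have "eps i j * \<xi> i j = eps i j * \<eta> i j"
      using assms(3)[of "(i, - j)"] by (simp add: gbar_form_unit assms)
    then have "eps i j * (eps i j * \<xi> i j) = eps i j * (eps i j * \<eta> i j)" by simp
    then show ?thesis by (simp add: eps_square flip: mult.assoc)
  next
    case False
    moreover obtain N where "gsupp N \<xi>" "gsupp N \<eta>" using gfin_common2 assms by blast
    ultimately show ?thesis using gsuppD(1)[of N _ "(i, j)"] by (metis fst_conv snd_conv)
  qed
qed

lemma unit_mult: "a \<in> IX \<Longrightarrow> b \<in> IX \<Longrightarrow> gbar_mult (unit a) (unit b) = embed (fst a + fst b) (el a * el b)"
proof -
  assume a: "a \<in> IX" and b: "b \<in> IX"
  have ab: "embed (fst a + fst b) (el a * el b) \<in> gfin"
    using embed_supp[OF el_mult_grade[OF a b]] by (simp add: gfin_def)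
  obtain N where N: "gsupp N (unit a)" "gsupp N (unit b)" "gsupp N (embed (fst a + fst b) (el a * el b))"
    using gfin_common3[OF gfin_unit[OF a] gfin_unit[OF b] ab] by blast
  define M0 where "M0 = max N (max \<bar>snd a\<bar> \<bar>snd b\<bar>)"
  have s: "gsupp M0 (unit a)" "gsupp M0 (unit b)" "gsupp M0 (embed (fst a + fst b) (el a * el b))"
    using N by (auto simp: M0_def intro: gsupp_mono)
  show ?thesis
  proof (rule gbar_mult_ext[OF s])
    fix M K d assume M: "M0 \<le> M" "wordbound M K" "d \<in> IX" "- snd d \<le> M"
    have in_box: "a \<in> box K" "b \<in> box K"
      using M(1,2) a b by (auto simp: M0_def box_iff wordbound_def)
    let ?c = "\<lambda>a b. ep d * form (el a * el b) (el (du d))"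
    have "cf (gbar_mult (unit a) (unit b)) d =
        (\<Sum>x\<in>box K. \<Sum>y\<in>box K. sp_scale (?c x y) (cf (unit a) x * ptw (fst x) (cf (unit b) y)))"
      using s M by (intro gbar_mult_coeff) (auto intro: gsupp_mono)
    also have "\<dots> = (\<Sum>x\<in>box K. \<Sum>y\<in>box K. if y = b then if x = a then sp_scale (?c a b) 1 else 0 else 0)"
      by (intro sum.cong refl) (simp only: unit_def embed_unit[OF a] embed_unit[OF b], simp add: ptw_one)
    also have "\<dots> = sp_scale (?c a b) 1" using in_box by simp
    also have "\<dots> = cf (embed (fst a + fst b) (el a * el b)) d"
    proof -
      have "cf (embed (fst a + fst b) (el a * el b)) d =
          (if fst d = fst a + fst b then sp_scale (?c a b) 1 else 0)"
        unfolding embed_coeff[OF el_mult_grade[OF a b]] using M(3) by simp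
      moreover have "?c a b = 0" if "fst d \<noteq> fst a + fst b"
        using form_el_parity[of a b "du d"] a b M(3) that by auto
      ultimately show ?thesis by auto
    qed
    finally show "cf (gbar_mult (unit a) (unit b)) d = cf (embed (fst a + fst b) (el a * el b)) d" .
  qed
qed

definition gH :: "nat \<Rightarrow> bit \<Rightarrow> 'k gbar set" where
  "gH \<iota> p = {\<xi> \<in> gfin. \<forall>i j. \<xi> i j \<in> superpolys (var_index \<iota>) (i + p)}"

lemma gH_gfin [intro, simp]: "\<xi> \<in> gH \<iota> p \<Longrightarrow> \<xi> \<in> gfin"
  by (simp add: gH_def)

lemma gH_coeff: "\<xi> \<in> gH \<iota> p \<Longrightarrow> \<xi> i j \<in> superpolys (var_index \<iota>) (i + p)"
  unfolding gH_def by blast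

lemma gH_parity: "\<xi> \<in> gH \<iota> p \<Longrightarrow> parity_part (i + p) (\<xi> i j) = \<xi> i j"
  by (drule gH_coeff[of _ _ _ i j]) (simp only: superpolys_iff)

lemma gH_ptw: "\<xi> \<in> gH \<iota> p \<Longrightarrow> ptw k (\<xi> i j) = zsgn (k * (i + p)) * \<xi> i j"
  by (rule ptw_homogeneous) (rule gH_parity)

lemma gH_mult:
  assumes \<xi>: "\<xi> \<in> gH \<iota> p" and \<eta>: "\<eta> \<in> gH \<iota> q"
  shows "gbar_mult \<xi> \<eta> \<in> gH \<iota> (p + q)"
  unfolding gH_def mem_Collect_eq
proof (intro conjI allI)
  show "gbar_mult \<xi> \<eta> \<in> gfin" using assms by auto
  fix i j
  show "gbar_mult \<xi> \<eta> i j \<in> superpolys (var_index \<iota>) (i + (p + q))"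
  proof (cases "(i, j) \<in> IX")
    case False
    then show ?thesis using gbar_mult_outside[of "(i, j)"] by (simp add: superpolys_zero)
  next
    case True
    obtain N where N: "gsupp N \<xi>" "gsupp N \<eta>" using gfin_common2 \<xi> \<eta> by blast
    have s: "gsupp (max N (- j)) \<xi>" "gsupp (max N (- j)) \<eta>" using N by (auto intro: gsupp_mono)
    obtain K where K: "wordbound (max N (- j)) K" using ex_wordbound by blast
    have "gbar_mult \<xi> \<eta> i j = (\<Sum>a\<in>box K. \<Sum>b\<in>box K.
        sp_scale (eps i j * form (el a * el b) (s i (- j))) (cf \<xi> a * ptw (fst a) (cf \<eta> b)))"
      using gbar_mult_coeff[OF s K, of "(i, j)"] True by simp
    moreover have "sp_scale (eps i j * form (el a * el b) (s i (- j))) (cf \<xi> a * ptw (fst a) (cf \<eta> b))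
        \<in> superpolys (var_index \<iota>) (i + (p + q))" if "a \<in> box K" "b \<in> box K" for a b
    proof (cases "form (el a * el b) (s i (- j)) = 0")
      case False
      then have i: "i = fst a + fst b"
        using form_el_parity[of a b "(i, - j)"] that True by (simp add: box_iff)
      have "cf \<xi> a * ptw (fst a) (cf \<eta> b) \<in> superpolys (var_index \<iota>) ((fst a + p) + (fst b + q))"
        unfolding gH_ptw[OF \<eta>] by (intro superpolys_mult superpolys_zsgn gH_coeff \<xi> \<eta>)
      also have "(fst a + p) + (fst b + q) = i + (p + q)" by (simp add: i add_ac)
      finally show ?thesis by (rule superpolys_scale)
    qed (simp add: superpolys_zero)
    ultimately show ?thesis by (auto intro!: superpolys_sum)
  qed
qed

lemma gH_form:
  assumes \<xi>: "\<xi> \<in> gH \<iota> p" and \<eta>: "\<eta> \<in> gH \<iota> q"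
  shows "gbar_form \<xi> \<eta> \<in> superpolys (var_index \<iota>) (p + q)"
proof -
  obtain N where N: "gsupp N \<xi>" "gsupp N \<eta>" using gfin_common2 \<xi> \<eta> by blast
  have "cf \<xi> a * cf \<eta> (du a) \<in> superpolys (var_index \<iota>) (p + q)" for a
    using superpolys_mult[OF gH_coeff[OF \<xi>] gH_coeff[OF \<eta>], of "fst a" "snd a" "fst a" "- snd a"]
    by (simp add: add_ac)
  then show ?thesis
    unfolding gbar_form_box[OF N] eps_scale gH_ptw[OF \<eta>]
    by (intro superpolys_sum superpolys_scale) (simp add: zsgn_left_commute superpolys_zsgn)
qed

lemma gbar_form_super:
  assumes \<xi>: "\<xi> \<in> gH \<iota> p" and \<eta>: "\<eta> \<in> gH \<iota> q"
  shows "gbar_form \<xi> \<eta> = zsgn (p * q) * gbar_form \<eta> \<xi>"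
proof -
  obtain N where N: "gsupp N \<xi>" "gsupp N \<eta>" using gfin_common2 \<xi> \<eta> by blast
  have "gbar_form \<eta> \<xi> = (\<Sum>a\<in>box N. ep (du a) * (cf \<eta> (du a) * ptw (fst a) (cf \<xi> a)))"
    unfolding gbar_form_box[OF N(2,1)]
    by (subst sum_box_du[symmetric]) simp
  then have "zsgn (p * q) * gbar_form \<eta> \<xi> = (\<Sum>a\<in>box N. zsgn (p * q) * (ep (du a) * (cf \<eta> (du a) * ptw (fst a) (cf \<xi> a))))"
    by (simp add: sum_distrib_left)
  also have "\<dots> = gbar_form \<xi> \<eta>"
    unfolding gbar_form_box[OF N]
  proof (intro sum.cong refl)
    fix a assume "a \<in> box N"
    then have e: "ep (du a) = (zsgn (fst a) * ep a :: 'k superpoly)"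
      using ix_nonzero[of "snd a" "fst a"] by (auto simp: eps_def box_iff IX_def zsgn_square)
    have "cf \<xi> a * cf \<eta> (du a) = zsgn ((fst a + p) * (fst a + q)) * (cf \<eta> (du a) * cf \<xi> a)"
      using super_commute[OF gH_parity[OF \<xi>] gH_parity[OF \<eta>], of "fst a" "snd a" "fst a" "- snd a"] by simp
    then show "zsgn (p * q) * (ep (du a) * (cf \<eta> (du a) * ptw (fst a) (cf \<xi> a))) =
        ep a * (cf \<xi> a * ptw (fst a) (cf \<eta> (du a)))"
      unfolding e gH_ptw[OF \<xi>] gH_ptw[OF \<eta>]
      by (cases "fst a"; cases p; cases q) (simp_all add: zsgn_def eps_def)
  qed
  finally show ?thesis ..
qed

lemma gH_embed: "u \<in> A k \<Longrightarrow> embed k u \<in> gH \<iota> k"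
proof -
  assume u: "u \<in> A k"
  have "embed k u i j \<in> superpolys (var_index \<iota>) (i + k)" for i j
    by (cases "(i, j) \<in> IX \<and> i = k") (auto simp: embed_coeff[OF u] superpolys_zero superpolys_const)
  then show ?thesis using embed_supp[OF u] by (simp add: gH_def gfin_def)
qed

lemma gH_unit: "a \<in> IX \<Longrightarrow> unit a \<in> gH \<iota> (fst a)"
  unfolding unit_def by (rule gH_embed, rule el_grade)

lemma unit_assoc:
  assumes abc: "a \<in> IX" "b \<in> IX" "c \<in> IX"
  shows "gbar_mult (gbar_mult (unit a) (unit b)) (unit c) = gbar_mult (unit a) (gbar_mult (unit b) (unit c))"
proof (rule gbar_eqI)
  fix d assume d: "d \<in> IX"
  note H = abc[THEN gH_unit[of _ 0]] gH_unit[OF d, of 0]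
  let ?p = "fst a + fst b + fst c"
  have l: "gbar_form (gbar_mult (gbar_mult (unit a) (unit b)) (unit c)) (unit d) =
      sp_scale (form (el a * el b * el c) (el d)) 1"
  proof -
    have "gbar_form (gbar_mult (gbar_mult (unit a) (unit b)) (unit c)) (unit d) =
        gbar_form (gbar_mult (unit a) (unit b)) (gbar_mult (unit c) (unit d))"
      using abc d by (intro gform_assoc) auto
    then show ?thesis
      using abc d by (simp add: unit_mult form_embed_embed[OF el_mult_grade el_mult_grade] form_assoc mult.assoc)
  qed
  have g: "gbar_mult (unit a) (gbar_mult (unit b) (unit c)) \<in> gH 0 ?p"
    using H by (simp add: gH_mult add.assoc)
  have "gbar_form (gbar_mult (unit a) (gbar_mult (unit b) (unit c))) (unit d) =
      zsgn (?p * fst d) * gbar_form (unit d) (gbar_mult (unit a) (gbar_mult (unit b) (unit c)))"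
    by (rule gbar_form_super[OF g H(4)])
  also have "gbar_form (unit d) (gbar_mult (unit a) (gbar_mult (unit b) (unit c))) =
      gbar_form (gbar_mult (unit d) (unit a)) (gbar_mult (unit b) (unit c))"
    using abc d by (intro gform_assoc[symmetric]) auto
  also have "\<dots> = sp_scale (form (el d) (el a * el b * el c)) 1"
    using abc d by (simp add: unit_mult form_embed_embed[OF el_mult_grade el_mult_grade] form_assoc mult.assoc)
  also have "zsgn (?p * fst d) * sp_scale (form (el d) (el a * el b * el c)) 1 =
      sp_scale (zsgn (?p * fst d) * form (el d) (el a * el b * el c)) (1 :: 'k superpoly)"
    by (simp flip: sp_scale_scale)
  also have "zsgn (?p * fst d) * form (el d) (el a * el b * el c) = form (el a * el b * el c) (el d)"
    using abc d by (intro form_supersymmetric[symmetric] grade_mult el_grade)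
  finally show "gbar_form (gbar_mult (gbar_mult (unit a) (unit b)) (unit c)) (unit d) =
      gbar_form (gbar_mult (unit a) (gbar_mult (unit b) (unit c))) (unit d)"
    by (simp only: l)
qed (use abc in auto)

lemma gbar_mult_assoc:
  assumes "\<xi> \<in> gfin" "\<eta> \<in> gfin" "\<zeta> \<in> gfin"
  shows "gbar_mult (gbar_mult \<xi> \<eta>) \<zeta> = gbar_mult \<xi> (gbar_mult \<eta> \<zeta>)"
proof -
  have 1: "gbar_mult (gbar_mult \<zeta> (unit a)) (unit b) = gbar_mult \<zeta> (gbar_mult (unit a) (unit b))"
    if "\<zeta> \<in> gfin" "a \<in> IX" "b \<in> IX" for \<zeta> a b
    by (rule gbar_eqI) (use that in \<open>auto simp: gform_assoc unit_assoc\<close>)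
  have 2: "gbar_mult (gbar_mult \<eta> \<zeta>) (unit a) = gbar_mult \<eta> (gbar_mult \<zeta> (unit a))"
    if "\<eta> \<in> gfin" "\<zeta> \<in> gfin" "a \<in> IX" for \<eta> \<zeta> a
    by (rule gbar_eqI) (use that in \<open>auto simp: gform_assoc 1\<close>)
  show ?thesis
    by (rule gbar_eqI) (use assms in \<open>auto simp: gform_assoc 2\<close>)
qed

lemma gbar_pos_neg_supp: "gsupp N \<xi> \<Longrightarrow> gsupp N (gbar_pos \<xi>)" "gsupp N \<xi> \<Longrightarrow> gsupp N (gbar_neg \<xi>)"
  by (auto simp: gsupp_def gbar_pos_def gbar_neg_def split: if_splits)

lemma gfin_add: "\<xi> \<in> gfin \<Longrightarrow> \<eta> \<in> gfin \<Longrightarrow> \<xi> + \<eta> \<in> gfin"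
  by (drule (1) gfin_common2) (auto simp: gfin_def intro: gsupp_add)

lemma gHI: "\<xi> \<in> gfin \<Longrightarrow> (\<And>i j. \<xi> i j \<in> superpolys (var_index \<iota>) (i + p)) \<Longrightarrow> \<xi> \<in> gH \<iota> p"
  unfolding gH_def by blast

lemma gH_add: "\<xi> \<in> gH \<iota> p \<Longrightarrow> \<eta> \<in> gH \<iota> p \<Longrightarrow> \<xi> + \<eta> \<in> gH \<iota> p"
  by (rule gHI, rule gfin_add, erule gH_gfin, erule gH_gfin, unfold plus_fun_apply, intro superpolys_add gH_coeff)

lemma gfin_uminus: "\<xi> \<in> gfin \<Longrightarrow> - \<xi> \<in> gfin"
  unfolding gfin_def by (blast intro: gsupp_uminus)

lemma gH_uminus: "\<xi> \<in> gH \<iota> p \<Longrightarrow> - \<xi> \<in> gH \<iota> p"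
  by (rule gHI, rule gfin_uminus, erule gH_gfin, unfold fun_Compl_def, rule superpolys_uminus, erule gH_coeff)

lemma gfin_pos_neg: "\<xi> \<in> gfin \<Longrightarrow> gbar_pos \<xi> \<in> gfin" "\<xi> \<in> gfin \<Longrightarrow> gbar_neg \<xi> \<in> gfin"
  unfolding gfin_def using gbar_pos_neg_supp by blast+

lemma gH_pos_neg: "\<xi> \<in> gH \<iota> p \<Longrightarrow> gbar_pos \<xi> \<in> gH \<iota> p" "\<xi> \<in> gH \<iota> p \<Longrightarrow> gbar_neg \<xi> \<in> gH \<iota> p"
  by (rule gHI, rule gfin_pos_neg, erule gH_gfin, simp add: gbar_pos_def gbar_neg_def superpolys_zero gH_coeff)+

lemma pos_coeff_cases: "cf (gbar_pos \<xi>) a \<noteq> 0 \<Longrightarrow> snd a \<in> J (fst a)"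
  and neg_coeff_cases: "cf (gbar_neg \<xi>) a \<noteq> 0 \<Longrightarrow> - snd a \<in> J (fst a)"
  by (auto simp: gbar_pos_def gbar_neg_def split: if_splits)

lemma pure_product_coeff:
  assumes "\<xi> \<in> gfin" "\<eta> \<in> gfin" "d \<in> IX"
    and z: "\<And>a b. cf \<xi> a \<noteq> 0 \<Longrightarrow> cf \<eta> b \<noteq> 0 \<Longrightarrow> form (el a * el b) (el (du d)) = 0"
  shows "cf (gbar_mult \<xi> \<eta>) d = 0"
proof -
  obtain N where N: "gsupp N \<xi>" "gsupp N \<eta>" using gfin_common2 assms by blast
  have s: "gsupp (max N (- snd d)) \<xi>" "gsupp (max N (- snd d)) \<eta>" using N by (auto intro: gsupp_mono)
  obtain K where K: "wordbound (max N (- snd d)) K" using ex_wordbound by blast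
  show ?thesis
  proof (subst gbar_mult_coeff[OF s K assms(3)], simp, intro sum.neutral ballI)
    fix a b
    show "sp_scale (ep d * form (el a * el b) (el (du d))) (cf \<xi> a * ptw (fst a) (cf \<eta> b)) = 0"
      using z[of a b] by (cases "cf \<xi> a = 0"; cases "cf \<eta> b = 0") auto
  qed
qed

lemma super_trace_gbar: "super_trace_algebra (gH \<iota>) gbar_mult gbar_pos gbar_neg gbar_form"
proof
  fix u v w :: "'k gbar" and p q r
  assume u: "u \<in> gH \<iota> p"
  show "- u \<in> gH \<iota> p" using u by (rule gH_uminus)
  show "gbar_pos u \<in> gH \<iota> p" "gbar_neg u \<in> gH \<iota> p"
    using u by (rule gH_pos_neg)+
  show "gbar_pos u + gbar_neg u = u"
  proof (intro ext)
    fix i j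
    obtain N where "gsupp N u" using gH_gfin[OF u] by (auto simp: gfin_def)
    then show "(gbar_pos u + gbar_neg u) i j = u i j"
      using gsuppD(1)[of N u "(i, j)"] J_pos[of j i] J_pos[of "- j" i]
      by (auto simp: gbar_pos_def gbar_neg_def IX_def ix_def)
  qed
  assume v: "v \<in> gH \<iota> q"
  show "gbar_mult u v \<in> gH \<iota> (p + q)" using u v by (rule gH_mult)
  show "gbar_form u v = zsgn (p * q) * gbar_form v u" using u v by (rule gbar_form_super)
  obtain N where N: "gsupp N u" "gsupp N v" using gfin_common2 u v by blast
  have JJ: "\<not> (j \<in> J i \<and> - j \<in> J i)" for i j using J_pos[of j i] J_pos[of "- j" i] by auto
  show "gbar_form (gbar_pos u) (gbar_pos v) = 0" "gbar_form (gbar_neg u) (gbar_neg v) = 0"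
    unfolding gbar_form_box[OF gbar_pos_neg_supp(1)[OF N(1)] gbar_pos_neg_supp(1)[OF N(2)]]
      gbar_form_box[OF gbar_pos_neg_supp(2)[OF N(1)] gbar_pos_neg_supp(2)[OF N(2)]]
    using JJ by (auto simp: gbar_pos_def gbar_neg_def intro!: sum.neutral)
  have f: "gbar_pos u \<in> gfin" "gbar_pos v \<in> gfin" "gbar_neg u \<in> gfin" "gbar_neg v \<in> gfin"
    using u v by (auto intro: gfin_pos_neg)
  show "gbar_neg (gbar_mult (gbar_pos u) (gbar_pos v)) = 0"
  proof (intro ext)
    fix i j
    have "cf (gbar_mult (gbar_pos u) (gbar_pos v)) (i, j) = 0" if "- j \<in> J i"
    proof (rule pure_product_coeff[OF f(1,2)])
      show "(i, j) \<in> IX" using that by (simp add: IX_def J_ix)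
      show "form (el a * el b) (el (du (i, j))) = 0"
        if "cf (gbar_pos u) a \<noteq> 0" "cf (gbar_pos v) b \<noteq> 0" for a b
        using that[THEN pos_coeff_cases] \<open>- j \<in> J i\<close> by (simp add: isotropic_pos mult_pos s_pos)
    qed
    then show "gbar_neg (gbar_mult (gbar_pos u) (gbar_pos v)) i j = 0 i j"
      by (simp add: gbar_neg_def)
  qed
  show "gbar_pos (gbar_mult (gbar_neg u) (gbar_neg v)) = 0"
  proof (intro ext)
    fix i j
    have "cf (gbar_mult (gbar_neg u) (gbar_neg v)) (i, j) = 0" if "j \<in> J i"
    proof (rule pure_product_coeff[OF f(3,4)])
      show "(i, j) \<in> IX" using that by (simp add: IX_def J_ix)
      show "form (el a * el b) (el (du (i, j))) = 0"
        if "cf (gbar_neg u) a \<noteq> 0" "cf (gbar_neg v) b \<noteq> 0" for a b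
        using that[THEN neg_coeff_cases] \<open>j \<in> J i\<close> by (simp add: isotropic_neg mult_neg s_neg)
    qed
    then show "gbar_pos (gbar_mult (gbar_neg u) (gbar_neg v)) i j = 0 i j"
      by (simp add: gbar_pos_def)
  qed
  assume w: "w \<in> gH \<iota> r"
  show "gbar_mult (gbar_mult u v) w = gbar_mult u (gbar_mult v w)"
    using u v w by (intro gbar_mult_assoc) auto
  show "gbar_form (gbar_mult u v) w = gbar_form u (gbar_mult v w)"
    using u v w by (intro gform_assoc) auto
next
  fix u v w :: "'k gbar" and p q
  assume u: "u \<in> gH \<iota> p" and v: "v \<in> gH \<iota> p"
  show "u + v \<in> gH \<iota> p" using u v by (rule gH_add)
  show "gbar_neg (u + v) = gbar_neg u + gbar_neg v"
    by (auto simp: gbar_neg_def fun_eq_iff)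
  assume w: "w \<in> gH \<iota> q"
  obtain N where N: "gsupp N u" "gsupp N v" "gsupp N w" using gfin_common3[of u v w] u v w by blast
  show "gbar_mult (u + v) w = gbar_mult u w + gbar_mult v w"
    "gbar_mult w (u + v) = gbar_mult w u + gbar_mult w v"
    "gbar_form (u + v) w = gbar_form u w + gbar_form v w"
    "gbar_form w (u + v) = gbar_form w u + gbar_form w v"
    using N by (rule gbar_mult_add_left gbar_mult_add_right gbar_form_add_left gbar_form_add_right)+
qed

end

section \<open>Gradients and the Lax element\<close>

context polarized_bases
begin

declare wfilt.simps(2) [simp del]

text \<open>The basis indices that belong to variables.\<close>

definition VI :: "nat \<Rightarrow> (bit \<times> int) set" where
  "VI \<iota> = {a. snd a \<in> var_index \<iota> (fst a)}"

lemma VI_cases: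
  "(i, j) \<in> VI \<iota> \<longleftrightarrow> - j \<in> J i \<or> j \<in> {1..int (filt_dim i \<iota>)}"
  by (auto simp: VI_def var_index_def intro: image_eqI[of _ _ "- j"])

lemma VI_IX: "a \<in> VI \<iota> \<Longrightarrow> a \<in> IX"
  using filt_subset_J[of "fst a" \<iota>] VI_cases[of "fst a" "snd a" \<iota>] by (auto simp: IX_def J_ix)

lemma grad_add: "grad \<iota> (f + g) = grad \<iota> f + grad \<iota> g"
  by (auto simp: grad_def fun_eq_iff parity_part_plus sp_deriv_add algebra_simps)

lemma grad_supp: "\<exists>N. gsupp N (grad \<iota> f)"
proof -
  have "finite (\<Union>i. {j. sp_deriv i j f \<noteq> 0})" by (simp add: UNIV_bit finite_deriv_support)
  then have fin: "finite (abs ` (\<Union>i. {j. sp_deriv i j f \<noteq> 0}))" by (rule finite_imageI)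
  define M where "M = Max (abs ` (\<Union>i. {j. sp_deriv i j f \<noteq> 0}))"
  have M: "\<bar>j\<bar> \<le> M" if "sp_deriv i j f \<noteq> 0" for i j
    unfolding M_def using fin that by (intro Max_ge) auto
  have z: "sp_deriv i j (parity_part p f) = 0" if "sp_deriv i j f = 0" for i j p
    using that by (simp add: parity_part_deriv)
  have "gsupp M (grad \<iota> f)"
    unfolding gsupp_def
  proof (intro allI impI)
    fix a assume nz: "cf (grad \<iota> f) a \<noteq> 0"
    then have "sp_deriv (fst a) (- snd a) f \<noteq> 0" by (auto simp: grad_def z split: if_splits)
    then have "\<bar>snd a\<bar> \<le> M" using M by force
    moreover have "snd a \<in> J (fst a) \<or> - snd a \<in> {1..int (filt_dim (fst a) \<iota>)}"
      using nz by (auto simp: grad_def split: if_splits)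
    then have "snd a \<in> J (fst a) \<or> - snd a \<in> J (fst a)" using filt_subset_J[of "fst a" \<iota>] by blast
    then have "a \<in> IX" by (auto simp: IX_def J_ix)
    ultimately show "a \<in> IX \<and> snd a \<le> M" by auto
  qed
  then show ?thesis by blast
qed

lemma gfin_grad [intro, simp]: "grad \<iota> f \<in> gfin"
  using grad_supp by (simp add: gfin_def)

lemma gH_grad: "f \<in> superpolys (var_index \<iota>) p \<Longrightarrow> grad \<iota> f \<in> gH \<iota> p"
proof (rule gHI)
  fix i j assume f: "f \<in> superpolys (var_index \<iota>) p"
  have pp: "parity_part q f \<in> superpolys (var_index \<iota>) p" for q
    using f parity_part_other[of p f q] by (cases "p = q") (auto simp: superpolys_iff)
  have "zsgn k * sp_deriv i (- j) (parity_part q f) \<in> superpolys (var_index \<iota>) (i + p)"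
       "sp_deriv i (- j) (parity_part q f) \<in> superpolys (var_index \<iota>) (i + p)" for k q
    using superpolys_deriv[OF pp, of i "- j" q] by (simp_all add: add.commute superpolys_zsgn)
  then show "grad \<iota> f i j \<in> superpolys (var_index \<iota>) (i + p)"
    unfolding grad_def by (auto intro: superpolys_add superpolys_zero)
qed simp

text \<open>The signs in \<open>grad\<close> compensate those in the form.\<close>

lemma eps_ptw_grad:
  "eps i j * ptw i (grad \<iota> f i (- j)) = (if (i, j) \<in> VI \<iota> then sp_deriv i j f else 0)"
proof -
  have e: "sp_deriv i j f = parity_part i (sp_deriv i j f) + parity_part (1 + i) (sp_deriv i j f)"
    using parity_part_add[of "sp_deriv i j f"] by (cases i) (simp_all add: add.commute)
  consider "- j \<in> J i" | "j \<in> {1..int (filt_dim i \<iota>)}" "- j \<notin> J i" | "(i, j) \<notin> VI \<iota>"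
    unfolding VI_cases by blast
  then show ?thesis
  proof cases
    case 1
    then have "\<not> j > 0" using J_pos by force
    with 1 have "eps i j * ptw i (grad \<iota> f i (- j)) =
        parity_part i (sp_deriv i j f) + parity_part (1 + i) (sp_deriv i j f)"
      by (cases i) (simp_all add: grad_def eps_def parity_part_deriv ptw_def parity_part_plus parity_part_diff
          parity_part_minus parity_part_parity_part zsgn_def)
    with 1 e show ?thesis by (simp add: VI_cases)
  next
    case 2
    then have "eps i j * ptw i (grad \<iota> f i (- j)) =
        parity_part i (sp_deriv i j f) + parity_part (1 + i) (sp_deriv i j f)"
      by (cases i) (simp_all add: grad_def eps_def parity_part_deriv ptw_def parity_part_plus parity_part_diff
          parity_part_minus parity_part_parity_part zsgn_def)
    with 2 e show ?thesis by (simp add: VI_cases)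
  next
    case 3
    then show ?thesis by (auto simp: grad_def VI_cases)
  qed
qed

text \<open>Pairing with a gradient is differentiation along a vector field.\<close>

lemma gbar_form_grad:
  assumes "gsupp N \<xi>" "gsupp N (grad \<iota> f)"
  shows "gbar_form \<xi> (grad \<iota> f) = (\<Sum>a\<in>box N \<inter> VI \<iota>. cf \<xi> a * sp_deriv (fst a) (snd a) f)"
proof -
  have "gbar_form \<xi> (grad \<iota> f) = (\<Sum>a\<in>box N. cf \<xi> a * (ep a * ptw (fst a) (cf (grad \<iota> f) (du a))))"
    unfolding gbar_form_box[OF assms] eps_scale sp_scale_mult_right ..
  also have "\<dots> = (\<Sum>a\<in>box N. if a \<in> VI \<iota> then cf \<xi> a * sp_deriv (fst a) (snd a) f else 0)"
    by (intro sum.cong refl) (simp add: eps_ptw_grad)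
  also have "\<dots> = (\<Sum>a\<in>box N \<inter> VI \<iota>. cf \<xi> a * sp_deriv (fst a) (snd a) f)"
    by (rule sum.inter_restrict[symmetric]) simp
  finally show ?thesis .
qed

lemma gbar_form_grad_add:
  "\<xi> \<in> gfin \<Longrightarrow> gbar_form \<xi> (grad \<iota> (f + g)) = gbar_form \<xi> (grad \<iota> f) + gbar_form \<xi> (grad \<iota> g)"
  using gfin_common3[of \<xi> "grad \<iota> f" "grad \<iota> g"] gbar_form_add_right[of _ "grad \<iota> f" "grad \<iota> g" \<xi>]
  by (auto simp: grad_add)

lemma gbar_form_grad_scale:
  assumes "\<xi> \<in> gfin"
  shows "gbar_form \<xi> (grad \<iota> (sp_scale c f)) = sp_scale c (gbar_form \<xi> (grad \<iota> f))"
proof -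
  obtain N where N: "gsupp N \<xi>" "gsupp N (grad \<iota> f)" "gsupp N (grad \<iota> (sp_scale c f))"
    using gfin_common3[OF assms gfin_grad gfin_grad] by blast
  show ?thesis
    unfolding gbar_form_grad[OF N(1,2)] gbar_form_grad[OF N(1,3)] sp_deriv_scale sp_scale_mult_right sp_scale_sum ..
qed

lemma gbar_form_grad_leibniz:
  assumes \<xi>: "\<xi> \<in> gH \<iota> p" and f: "f \<in> superpolys (var_index \<iota>) q"
  shows "gbar_form \<xi> (grad \<iota> (f * g)) = gbar_form \<xi> (grad \<iota> f) * g + zsgn (p * q) * (f * gbar_form \<xi> (grad \<iota> g))"
proof -
  obtain N1 where N1: "gsupp N1 \<xi>" "gsupp N1 (grad \<iota> f)" "gsupp N1 (grad \<iota> g)"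
    using gfin_common3[OF gH_gfin[OF \<xi>] gfin_grad gfin_grad] by blast
  obtain N2 where N2: "gsupp N2 (grad \<iota> (f * g))" using grad_supp by blast
  have N: "gsupp (max N1 N2) \<xi>" "gsupp (max N1 N2) (grad \<iota> f)" "gsupp (max N1 N2) (grad \<iota> g)"
    "gsupp (max N1 N2) (grad \<iota> (f * g))" using N1 N2 by (auto intro: gsupp_mono)
  have fp: "parity_part q f = f" using f by (simp only: superpolys_iff)
  have t: "cf \<xi> a * sp_deriv (fst a) (snd a) (f * g) = cf \<xi> a * sp_deriv (fst a) (snd a) f * g +
      zsgn (p * q) * (f * (cf \<xi> a * sp_deriv (fst a) (snd a) g))" for a
  proof -
    have "cf \<xi> a * f = zsgn ((fst a + p) * q) * (f * cf \<xi> a)"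
      by (rule super_commute[OF gH_parity[OF \<xi>] fp])
    then have "zsgn (fst a * q) * (cf \<xi> a * f) = zsgn (p * q) * (f * cf \<xi> a)"
      by (cases "fst a"; cases p; cases q) (simp_all add: zsgn_def)
    then have "zsgn (fst a * q) * (cf \<xi> a * f) * sp_deriv (fst a) (snd a) g =
        zsgn (p * q) * (f * cf \<xi> a) * sp_deriv (fst a) (snd a) g"
      by (rule arg_cong)
    then have "zsgn (fst a * q) * (cf \<xi> a * (f * sp_deriv (fst a) (snd a) g)) =
        zsgn (p * q) * (f * (cf \<xi> a * sp_deriv (fst a) (snd a) g))"
      by (simp only: mult.assoc)
    then show ?thesis
      unfolding sp_deriv_mult[OF fp] distrib_left zsgn_left_commute[of "cf \<xi> a"] by (simp only: mult.assoc)
  qed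
  show ?thesis
    unfolding gbar_form_grad[OF N(1,2)] gbar_form_grad[OF N(1,3)] gbar_form_grad[OF N(1,4)] t
    by (simp only: sum.distrib sum_distrib_left sum_distrib_right)
qed

lemma gbar_form_grad_var:
  assumes "\<xi> \<in> gfin" "a \<in> VI \<iota>"
  shows "gbar_form \<xi> (grad \<iota> (sp_var (fst a) (snd a))) = cf \<xi> a"
proof -
  let ?g = "grad \<iota> (sp_var (fst a) (snd a)) :: 'k gbar"
  obtain N0 where N0: "gsupp N0 \<xi>" "gsupp N0 ?g" using gfin_common2[OF assms(1) gfin_grad] by blast
  define N where "N = max N0 \<bar>snd a\<bar>"
  have N: "gsupp N \<xi>" "gsupp N ?g" using N0 by (auto simp: N_def intro: gsupp_mono)
  have "gbar_form \<xi> ?g = (\<Sum>b\<in>box N \<inter> VI \<iota>. if b = a then cf \<xi> a else 0)"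
    unfolding gbar_form_grad[OF N] by (intro sum.cong refl) (auto simp: sp_deriv_var prod_eq_iff)
  moreover have "a \<in> box N \<inter> VI \<iota>" using assms VI_IX by (auto simp: box_iff N_def)
  ultimately show ?thesis by simp
qed

text \<open>The space \<open>wfilt (\<iota> + 2)\<close> is \<open>Am + filt (\<iota> + 1)\<close>.\<close>

definition admissible :: "nat \<Rightarrow> 'a \<Rightarrow> bool" where
  "admissible \<iota> u \<longleftrightarrow> u \<in> A 0 \<and> u \<in> wfilt (\<iota> + 2)"

lemma admissibleI:
  assumes "u \<in> (Am \<inter> A 0) + (filt (\<iota> + 1) \<inter> A 0)" shows "admissible \<iota> u"
proof -
  from assms obtain n v where u: "u = n + v" "n \<in> Am \<inter> A 0" "v \<in> filt (\<iota> + 1) \<inter> A 0"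
    by (rule set_plus_elim)
  have "n \<in> wfilt (\<iota> + 2)" using u wfilt_mono[of 0 "\<iota> + 2"] by auto
  moreover have "v \<in> wfilt (\<iota> + 2)"
  proof -
    have "v \<in> wfilt (Suc (\<iota> + 1))" using u(3) unfolding filt_eq by blast
    moreover have "Suc (\<iota> + 1) = \<iota> + 2" by simp
    ultimately show ?thesis by (simp only:)
  qed
  ultimately show ?thesis
    using u subspace_add[OF subspace_wfilt] subspace_add[OF subspace_grade] by (auto simp: admissible_def)
qed

text \<open>
  Unlike \<open>form_beyond_wbound\<close>, this uses the exact dimension in parity \<open>i\<close>, as required for tangency.
\<close>

lemma form_beyond_filt_dim:
  assumes u: "u \<in> wfilt (Suc m)" "u \<in> A k" and j: "- j \<in> J i" "int (filt_dim i m) < - j"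
  shows "form (s i j) u = 0" "form u (s i j) = 0"
proof -
  have si: "s i j \<in> A i" using j by (auto intro!: s_grade J_ix)
  show 0: "form (s i j) u = 0"
  proof (cases "i = k")
    case True
    have "pos_comp u \<in> filt m \<inter> A k"
      using pos_comp_mem pos_comp_wfilt[OF u(1)] comp_grade[OF u(2)] by (simp only: filt_eq Int_iff)
    then have "pos_comp u \<in> span (s k ` {1..int (filt_dim k m)})"
      using filt_basis[of k m] by (simp add: is_basis_family_def)
    then have "form (s i j) (pos_comp u) = 0"
    proof (induction rule: span_induct_alt)
      case (step c x y)
      then obtain l where l: "x = s k l" "l \<in> {1..int (filt_dim k m)}" by blast
      then have "l \<in> J k" using filt_subset_J by blast
      with l j True dual[of "- j" i l k] step show ?case by (simp add: form_add_right form_scale_right)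
    qed simp
    then show ?thesis using form_neg_pos_comp(1)[OF j(1)] by metis
  qed (use form_grade'[OF si u(2)] in simp)
  show "form u (s i j) = 0" using form_supersymmetric[OF u(2) si] 0 by simp
qed

lemma lax_letters:
  assumes L0: "admissible \<iota> L0" and nz: "cf (lax \<iota> L0) a \<noteq> 0"
  shows "a \<in> IX" "el a \<in> wfilt (\<iota> + 2)"
proof -
  have L0': "L0 \<in> A 0" "L0 \<in> wfilt (Suc (Suc \<iota>))" using L0 by (simp_all add: admissible_def)
  have "a \<in> VI \<iota> \<or> cf (embed 0 L0) a \<noteq> 0"
    using nz by (auto simp: lax_def VI_def)
  then have "a \<in> IX \<and> el a \<in> wfilt (\<iota> + 2)"
  proof
    assume a: "a \<in> VI \<iota>"
    show ?thesis
    proof (cases "- snd a \<in> J (fst a)")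
      case True
      then show ?thesis using VI_IX[OF a] neg_s_wfilt by blast
    next
      case False
      with a VI_cases[of "fst a" "snd a" \<iota>] have k: "snd a \<in> {1..int (filt_dim (fst a) \<iota>)}" by auto
      then have "snd a \<in> J (fst a)" using filt_subset_J by blast
      then have "el a \<in> wfilt (Suc \<iota>)" using k by (intro s_wfilt) auto
      then show ?thesis using wfilt_mono[of "Suc \<iota>" "\<iota> + 2"] VI_IX[OF a] by (auto simp del: wfilt.simps)
    qed
  next
    assume "cf (embed 0 L0) a \<noteq> 0"
    then have a: "a \<in> IX" "fst a = 0" "form L0 (el (du a)) \<noteq> 0"
      by (auto simp: embed_coeff[OF L0'(1)] split: if_splits)
    show ?thesis
    proof (cases "- snd a \<in> J (fst a)")
      case True
      then show ?thesis using a neg_s_wfilt by blast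
    next
      case False
      then have j: "snd a \<in> J (fst a)" using a by (auto simp: IX_def elim: ix_cases)
      then have "snd a \<le> int (filt_dim (fst a) (Suc \<iota>))"
        using form_beyond_filt_dim(2)[OF L0'(2,1), of "- snd a" "fst a"] a(3) by force
      then show ?thesis using s_wfilt[OF j, of "Suc \<iota>"] a by (simp del: wfilt.simps)
    qed
  qed
  then show "a \<in> IX" "el a \<in> wfilt (\<iota> + 2)" by auto
qed

lemma gH_lax:
  assumes "L0 \<in> A 0" shows "lax \<iota> L0 \<in> gH \<iota> 0"
proof -
  define V :: "'k gbar" where "V = (\<lambda>i j. if j \<in> var_index \<iota> i then sp_var i j else 0)"
  have "gsupp (int (max (filt_dim 0 \<iota>) (filt_dim 1 \<iota>))) V"
    unfolding gsupp_def
  proof (intro allI impI)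
    fix a assume "cf V a \<noteq> 0"
    then have a: "a \<in> VI \<iota>" by (auto simp: V_def VI_def split: if_splits)
    then have "snd a \<le> int (filt_dim (fst a) \<iota>)"
      using VI_cases[of "fst a" "snd a" \<iota>] J_pos[of "- snd a" "fst a"] by auto
    moreover have "filt_dim (fst a) \<iota> \<le> max (filt_dim 0 \<iota>) (filt_dim 1 \<iota>)" by (cases "fst a") auto
    ultimately show "a \<in> IX \<and> snd a \<le> int (max (filt_dim 0 \<iota>) (filt_dim 1 \<iota>))"
      using VI_IX[OF a] by linarith
  qed
  then have "V \<in> gfin" unfolding gfin_def by blast
  then have "V \<in> gH \<iota> 0"
    by (rule gHI) (simp add: V_def superpolys_var superpolys_zero)
  moreover have "lax \<iota> L0 = embed 0 L0 + V"
    by (simp add: lax_def V_def fun_eq_iff)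
  ultimately show ?thesis using gH_embed[OF assms] by (simp add: gH_add)
qed

text \<open>
  Let \<open>y\<close> be the basis element dual to an index that belongs to no variable. It lies in \<open>Am\<close> and annihilates
  \<open>wfilt (\<iota> + 1)\<close>. Multiplication by \<open>Am\<close> maps the letters of the Lax element from \<open>wfilt (\<iota> + 2)\<close> to
  \<open>wfilt (\<iota> + 1)\<close>; so the products of the Lax element with \<open>y\<close>, on either side, have no positive part,
  and the pairing of the vector field with \<open>y\<close> vanishes.
\<close>

lemma vfield_tangent:
  assumes L0: "admissible \<iota> L0" and X: "X \<in> gH \<iota> p" and a: "a \<notin> VI \<iota>"
  shows "cf (super_trace_algebra.vfield gbar_mult gbar_neg (lax \<iota> L0) X) a = 0"
proof -
  interpret T: super_trace_algebra "gH \<iota>" gbar_mult gbar_pos gbar_neg gbar_form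
    by (rule super_trace_gbar)
  let ?L = "lax \<iota> L0"
  let ?H = "T.vfield ?L X"
  have L: "?L \<in> gH \<iota> 0" using L0 by (intro gH_lax) (simp add: admissible_def)
  have H: "?H \<in> gH \<iota> p" using L X by (rule T.vfield_closed)
  show ?thesis
  proof (cases "a \<in> IX")
    case False
    then show ?thesis using gH_gfin[OF H] gsuppD(1) unfolding gfin_def by blast
  next
    case aI: True
    define y where "y = el (du a)"
    have j: "snd a \<in> J (fst a)" "int (filt_dim (fst a) \<iota>) < snd a"
      using a aI VI_cases[of "fst a" "snd a" \<iota>] J_pos[of "snd a" "fst a"]
      by (auto simp: IX_def elim: ix_cases)
    have yA: "y \<in> A (fst a)"
      using aI el_grade[of "du a"] by (auto simp: y_def)
    have y0: "form y u = 0" "form u y = 0" if "u \<in> wfilt (Suc \<iota>)" "u \<in> A k" for u k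
      using form_beyond_filt_dim[OF that, of "- snd a" "fst a"] j by (simp_all add: y_def)
    have Y: "unit (du a) \<in> gH \<iota> (fst a)" using gH_unit[of "du a"] aI by simp
    have ub: "b = du a" if "cf (unit (du a)) b \<noteq> 0" for b
      using that embed_unit[of "du a" b] aI by (auto simp: unit_def split: if_splits)
    have step: "el b * v \<in> wfilt (Suc \<iota>)" "v * el b \<in> wfilt (Suc \<iota>)"
      if "cf ?L b \<noteq> 0" "v \<in> Am" for b v
      using lax_letters[OF L0 that(1)] that(2) wfilt_mult_neg[of "el b" "Suc \<iota>" v]
        wfilt_neg_mult[of "el b" "Suc \<iota>" v] by simp_all
    have "cf (gbar_mult ?L (unit (du a))) d = 0" if "d \<in> IX" "snd d \<in> J (fst d)" for d
    proof (rule pure_product_coeff)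
      fix b c assume b: "cf ?L b \<noteq> 0" and c: "cf (unit (du a)) c \<noteq> 0"
      have dn: "el (du d) \<in> Am" using that by (simp add: s_neg)
      have bI: "b \<in> IX" using lax_letters[OF L0 b] by simp
      have "form (el b * y) (el (du d)) = zsgn ((fst b + fst a) * fst d) * form (el (du d)) (el b * y)"
        using that bI yA el_grade[of "du d"] by (intro form_supersymmetric grade_mult el_grade) auto
      also have "form (el (du d)) (el b * y) = form (el (du d) * el b) y" by (simp add: form_assoc)
      also have "\<dots> = 0"
        using step(2)[OF b dn] el_mult_grade[of "du d" b] that bI by (intro y0(2)) auto
      finally show "form (el b * el c) (el (du d)) = 0" using ub[OF c] by (simp add: y_def)
    qed (use that L Y in auto)
    then have z1: "gbar_pos (gbar_mult ?L (unit (du a))) = 0"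
      by (auto simp: gbar_pos_def fun_eq_iff IX_def J_ix)
    have "cf (gbar_mult (unit (du a)) ?L) d = 0" if "d \<in> IX" "snd d \<in> J (fst d)" for d
    proof (rule pure_product_coeff)
      fix b c assume b: "cf ?L c \<noteq> 0" and c: "cf (unit (du a)) b \<noteq> 0"
      have dn: "el (du d) \<in> Am" using that by (simp add: s_neg)
      have cI: "c \<in> IX" using lax_letters[OF L0 b] by simp
      have "form (y * el c) (el (du d)) = form y (el c * el (du d))" by (simp add: form_assoc)
      also have "\<dots> = 0"
        using step(1)[OF b dn] el_mult_grade[of c "du d"] that cI by (intro y0(1)) auto
      finally show "form (el b * el c) (el (du d)) = 0" using ub[OF c] by (simp add: y_def)
    qed (use that L Y in auto)
    then have z2: "gbar_pos (gbar_mult (unit (du a)) ?L) = 0"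
      by (auto simp: gbar_pos_def fun_eq_iff IX_def J_ix)
    have z: "gbar_form \<xi> 0 = 0" if "\<xi> \<in> gH \<iota> q" for \<xi> q
      using T.tr_zero(2)[OF that T.H_0[OF that]] .
    have "gbar_form ?H (unit (du a)) = 0"
      unfolding T.tr_vfield[OF L X Y]
      using T.tr_neg_left[of "gbar_mult ?L X" p "gbar_mult ?L (unit (du a))" "fst a"]
        T.tr_neg_left[of "gbar_mult X ?L" p "gbar_mult (unit (du a)) ?L" "fst a"] L X Y z1 z2
        z[of "gbar_mult ?L X" p] z[of "gbar_mult X ?L" p]
      by simp
    then have "eps (fst a) (snd a) * cf ?H a = 0"
      using gbar_form_unit[OF gH_gfin[OF H], of "du a"] aI by simp
    then have "eps (fst a) (snd a) * (eps (fst a) (snd a) * cf ?H a) = 0" by simp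
    then show ?thesis by (simp add: eps_square flip: mult.assoc)
  qed
qed

end

section \<open>The quadratic bracket is a Poisson superbracket\<close>

context polarized_bases
begin

interpretation T: super_trace_algebra "gH \<iota>" gbar_mult gbar_pos gbar_neg gbar_form for \<iota>
  by (rule super_trace_gbar)

lemma gmult_add:
  assumes "\<xi> \<in> gfin" "\<eta> \<in> gfin" "\<zeta> \<in> gfin"
  shows "gbar_mult (\<xi> + \<eta>) \<zeta> = gbar_mult \<xi> \<zeta> + gbar_mult \<eta> \<zeta>"
    and "gbar_mult \<zeta> (\<xi> + \<eta>) = gbar_mult \<zeta> \<xi> + gbar_mult \<zeta> \<eta>"
    and "gbar_form (\<xi> + \<eta>) \<zeta> = gbar_form \<xi> \<zeta> + gbar_form \<eta> \<zeta>"
    and "gbar_form \<zeta> (\<xi> + \<eta>) = gbar_form \<zeta> \<xi> + gbar_form \<zeta> \<eta>"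
  using gfin_common3[OF assms] gbar_mult_add_left gbar_mult_add_right gbar_form_add_left gbar_form_add_right
  by blast+

lemma gfin_diff: "\<xi> \<in> gfin \<Longrightarrow> \<eta> \<in> gfin \<Longrightarrow> \<xi> - \<eta> \<in> gfin"
  using gfin_add[OF _ gfin_uminus] by (metis diff_conv_add_uminus)

lemma gbar_pos_neg_add: "gbar_pos (\<xi> + \<eta>) = gbar_pos \<xi> + gbar_pos \<eta>" "gbar_neg (\<xi> + \<eta>) = gbar_neg \<xi> + gbar_neg \<eta>"
  by (auto simp: gbar_pos_def gbar_neg_def fun_eq_iff)

lemma gfin_vfield: "L \<in> gfin \<Longrightarrow> X \<in> gfin \<Longrightarrow> T.vfield L X \<in> gfin"
  unfolding T.vfield_def by (intro gfin_diff gfin_mult gfin_pos_neg)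

lemma vfield_add:
  assumes "L \<in> gfin" "X \<in> gfin" "Y \<in> gfin"
  shows "T.vfield L (X + Y) = T.vfield L X + T.vfield L Y"
proof -
  note c = gfin_mult[OF assms(1,2)] gfin_mult[OF assms(1,3)] gfin_mult[OF assms(2,1)] gfin_mult[OF assms(3,1)]
  show ?thesis
    unfolding T.vfield_def gmult_add[OF assms(2,3,1)] gbar_pos_neg_add
      gmult_add[OF gfin_pos_neg(2)[OF c(1)] gfin_pos_neg(2)[OF c(2)] assms(1)]
      gmult_add[OF gfin_pos_neg(2)[OF c(3)] gfin_pos_neg(2)[OF c(4)] assms(1)]
    by (simp add: algebra_simps)
qed

lemma bracket2_eq: "bracket2 \<iota> L0 f g = gbar_form (T.vfield (lax \<iota> L0) (grad \<iota> f)) (grad \<iota> g)"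
  by (simp add: bracket2_def T.vfield_def)

lemma superbracket_bracket2:
  assumes "L0 \<in> A 0"
  shows "superbracket (var_index \<iota>) (bracket2 \<iota> L0)"
proof -
  note L = gH_lax[OF assms, of \<iota>] note Lf = gH_gfin[OF L]
  note V = gfin_vfield[OF Lf gfin_grad]
  let ?b = "bracket2 \<iota> L0"
  have add_l: "?b (u + v) w = ?b u w + ?b v w" for u v w
    unfolding bracket2_eq grad_add vfield_add[OF Lf gfin_grad gfin_grad] by (rule gmult_add(3)[OF V V gfin_grad])
  have add_r: "?b w (u + v) = ?b w u + ?b w v" for u v w
    unfolding bracket2_eq by (rule gbar_form_grad_add[OF V])
  have scale_r: "?b u (sp_scale c v) = sp_scale c (?b u v)" for u v c
    unfolding bracket2_eq by (rule gbar_form_grad_scale[OF V])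
  have skew: "?b u v = - (zsgn (p * q) * ?b v u)"
    if "u \<in> superpolys (var_index \<iota>) p" "v \<in> superpolys (var_index \<iota>) q" for u v p q
    unfolding bracket2_eq using T.tr_vfield_skew[OF L gH_grad[OF that(1)] gH_grad[OF that(2)]] by simp
  have hom: "parity_part p u \<in> superpolys (var_index \<iota>) p" if "u \<in> spolys (var_index \<iota>)" for u :: "'k superpoly" and p
    using that by (simp only: superpolys_iff spolys_parity_part parity_part_same)
  \<comment> \<open>Scalars in the first argument are moved to the second by skew symmetry, for homogeneous parts.\<close>
  have scale_l: "?b (sp_scale c u) v = sp_scale c (?b u v)"
    if u: "u \<in> spolys (var_index \<iota>)" and v: "v \<in> spolys (var_index \<iota>)" for u v c
  proof -
    have h: "?b (sp_scale c (parity_part p u)) (parity_part q v) = sp_scale c (?b (parity_part p u) (parity_part q v))" for p q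
    proof -
      have "?b (sp_scale c (parity_part p u)) (parity_part q v) =
          - (zsgn (p * q) * ?b (parity_part q v) (sp_scale c (parity_part p u)))"
        by (rule skew[OF superpolys_scale[OF hom[OF u]] hom[OF v]])
      also have "\<dots> = sp_scale c (- (zsgn (p * q) * ?b (parity_part q v) (parity_part p u)))"
        unfolding scale_r by (cases "p * q") (simp_all add: zsgn_def sp_scale_minus_right)
      also have "- (zsgn (p * q) * ?b (parity_part q v) (parity_part p u)) = ?b (parity_part p u) (parity_part q v)"
        by (rule skew[symmetric, OF hom[OF u] hom[OF v]])
      finally show ?thesis .
    qed
    have "?b (sp_scale c (parity_part 0 u + parity_part 1 u)) (parity_part 0 v + parity_part 1 v) =
        sp_scale c (?b (parity_part 0 u + parity_part 1 u) (parity_part 0 v + parity_part 1 v))"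
      unfolding add_l add_r sp_scale_add_right h ..
    then show ?thesis unfolding parity_part_add .
  qed
  show ?thesis
  proof (rule superbracket.intro)
    show "?b u v \<in> superpolys (var_index \<iota>) (p + q)"
      if "u \<in> superpolys (var_index \<iota>) p" "v \<in> superpolys (var_index \<iota>) q" for u v p q
      unfolding bracket2_eq by (rule gH_form[OF T.vfield_closed[OF L gH_grad[OF that(1)]] gH_grad[OF that(2)]])
    show "?b u (v * w) = ?b u v * w + zsgn (p * q) * (v * ?b u w)"
      if "u \<in> superpolys (var_index \<iota>) p" "v \<in> superpolys (var_index \<iota>) q" for u v w p q
      unfolding bracket2_eq by (rule gbar_form_grad_leibniz[OF T.vfield_closed[OF L gH_grad[OF that(1)]] that(2)])
  qed (rule add_l | rule add_r | rule scale_r | (rule scale_l; assumption) | (rule skew; assumption))+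
qed

text \<open>Superderivations of parity \<open>h\<close> of the algebra of polynomials.\<close>

definition superderiv :: "nat \<Rightarrow> bit \<Rightarrow> ('k superpoly \<Rightarrow> 'k superpoly) \<Rightarrow> bool" where
  "superderiv \<iota> h D \<longleftrightarrow>
    (\<forall>f\<in>spolys (var_index \<iota>). \<forall>g\<in>spolys (var_index \<iota>). D (f + g) = D f + D g) \<and>
    (\<forall>c. \<forall>f\<in>spolys (var_index \<iota>). D (sp_scale c f) = sp_scale c (D f)) \<and>
    (\<forall>p. \<forall>f\<in>superpolys (var_index \<iota>) p. D f \<in> superpolys (var_index \<iota>) (p + h)) \<and>
    (\<forall>p. \<forall>f\<in>superpolys (var_index \<iota>) p. \<forall>g\<in>spolys (var_index \<iota>). D (f * g) = D f * g + zsgn (h * p) * (f * D g))"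

definition dact :: "('k superpoly \<Rightarrow> 'k superpoly) \<Rightarrow> 'k gbar \<Rightarrow> 'k gbar" where
  "dact D \<xi> = (\<lambda>i j. D (\<xi> i j))"

context
  fixes \<iota> :: nat and h :: bit and D :: "'k superpoly \<Rightarrow> 'k superpoly"
  assumes D: "superderiv \<iota> h D"
begin

lemma D_add: "f \<in> spolys (var_index \<iota>) \<Longrightarrow> g \<in> spolys (var_index \<iota>) \<Longrightarrow> D (f + g) = D f + D g"
  and D_scale: "f \<in> spolys (var_index \<iota>) \<Longrightarrow> D (sp_scale c f) = sp_scale c (D f)"
  and D_grade: "f \<in> superpolys (var_index \<iota>) p \<Longrightarrow> D f \<in> superpolys (var_index \<iota>) (p + h)"
  and D_mult: "f \<in> superpolys (var_index \<iota>) p \<Longrightarrow> g \<in> spolys (var_index \<iota>) \<Longrightarrow>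
    D (f * g) = D f * g + zsgn (h * p) * (f * D g)"
  using D unfolding superderiv_def by blast+

lemma D_zero: "D 0 = 0"
  using D_scale[of 0 0] by simp

lemma D_sum: "(\<And>x. x \<in> X \<Longrightarrow> e x \<in> spolys (var_index \<iota>)) \<Longrightarrow> D (\<Sum>x\<in>X. e x) = (\<Sum>x\<in>X. D (e x))"
proof (induction X rule: infinite_finite_induct)
  case (insert x X)
  then show ?case by (simp add: D_add spolys_sum)
qed (simp_all add: D_zero)

lemma dact_supp: "gsupp N \<xi> \<Longrightarrow> gsupp N (dact D \<xi>)"
  unfolding gsupp_def dact_def using D_zero by metis

lemma dact_gH: "\<xi> \<in> gH \<iota> p \<Longrightarrow> dact D \<xi> \<in> gH \<iota> (p + h)"
proof (rule gHI)
  assume \<xi>: "\<xi> \<in> gH \<iota> p"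
  then show "dact D \<xi> \<in> gfin"
    using gH_gfin[OF \<xi>] dact_supp unfolding gfin_def by blast
  show "dact D \<xi> i j \<in> superpolys (var_index \<iota>) (i + (p + h))" for i j
    unfolding dact_def add.assoc[symmetric] by (rule D_grade, rule gH_coeff[OF \<xi>])
qed

lemma gH_spolys: "\<xi> \<in> gH \<iota> p \<Longrightarrow> \<xi> i j \<in> spolys (var_index \<iota>)"
  by (drule gH_coeff[of _ _ _ i j]) (simp only: superpolys_iff)

lemma D_term:
  assumes \<xi>: "\<xi> \<in> gH \<iota> p" and \<eta>: "\<eta> \<in> gH \<iota> q"
  shows "D (sp_scale c (\<xi> i j * ptw i (\<eta> k l))) =
    sp_scale c (dact D \<xi> i j * ptw i (\<eta> k l)) + zsgn (h * p) * sp_scale c (\<xi> i j * ptw i (dact D \<eta> k l))"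
proof -
  have \<eta>s: "ptw i (\<eta> k l) \<in> spolys (var_index \<iota>)" by (intro spolys_ptw gH_spolys[OF \<eta>])
  have "D (sp_scale c (\<xi> i j * ptw i (\<eta> k l))) = sp_scale c (D (\<xi> i j * ptw i (\<eta> k l)))"
    by (intro D_scale spolys_mult gH_spolys[OF \<xi>] \<eta>s)
  also have "D (\<xi> i j * ptw i (\<eta> k l)) = D (\<xi> i j) * ptw i (\<eta> k l) + zsgn (h * (i + p)) * (\<xi> i j * D (ptw i (\<eta> k l)))"
    by (rule D_mult[OF gH_coeff[OF \<xi>] \<eta>s])
  also have "D (ptw i (\<eta> k l)) = zsgn (i * (k + q)) * D (\<eta> k l)"
    unfolding gH_ptw[OF \<eta>] using D_scale[OF gH_spolys[OF \<eta>], of "zsgn (i * (k + q))"] by simp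
  also have "\<dots> = zsgn (i * h) * ptw i (dact D \<eta> k l)"
    unfolding gH_ptw[OF dact_gH[OF \<eta>]] unfolding dact_def
    by (cases i; cases h; cases k; cases q) (simp_all add: zsgn_def)
  finally show ?thesis
    by (cases i; cases h; cases p) (simp_all add: zsgn_def dact_def sp_scale_add_right sp_scale_minus_right sp_scale_diff_right)
qed

lemma sg_apply: "(sg r \<xi> :: 'k gbar) i j = zsgn r * \<xi> i j"
  by (simp add: sg_def zsgn_def)

lemma dact_mult:
  assumes \<xi>: "\<xi> \<in> gH \<iota> p" and \<eta>: "\<eta> \<in> gH \<iota> q"
  shows "dact D (gbar_mult \<xi> \<eta>) = gbar_mult (dact D \<xi>) \<eta> + sg (h * p) (gbar_mult \<xi> (dact D \<eta>))"
proof (intro ext)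
  fix i j
  show "dact D (gbar_mult \<xi> \<eta>) i j = (gbar_mult (dact D \<xi>) \<eta> + sg (h * p) (gbar_mult \<xi> (dact D \<eta>))) i j"
  proof (cases "(i, j) \<in> IX")
    case False
    then show ?thesis
      using gbar_mult_outside[of "(i, j)"] by (simp add: dact_def D_zero sg_apply)
  next
    case True
    obtain N0 where N0: "gsupp N0 \<xi>" "gsupp N0 \<eta>" using gfin_common2 \<xi> \<eta> by blast
    define N where "N = max N0 (- j)"
    have N: "gsupp N \<xi>" "gsupp N \<eta>" using N0 by (auto simp: N_def intro: gsupp_mono)
    obtain K where K: "wordbound N K" using ex_wordbound by blast
    have ij: "- snd (i, j) \<le> N" by (simp add: N_def)
    define c where "c a b = ep (i, j) * form (el a * el b) (el (du (i, j)))" for a b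
    have sp: "sp_scale (c a b) (cf \<xi> a * ptw (fst a) (cf \<eta> b)) \<in> spolys (var_index \<iota>)" for a b
      by (intro spolys_scale spolys_mult spolys_ptw gH_spolys[OF \<xi>] gH_spolys[OF \<eta>])
    have "cf (gbar_mult \<xi> \<eta>) (i, j) = (\<Sum>a\<in>box K. \<Sum>b\<in>box K. sp_scale (c a b) (cf \<xi> a * ptw (fst a) (cf \<eta> b)))"
      unfolding c_def by (rule gbar_mult_coeff[OF N K True ij])
    then have "dact D (gbar_mult \<xi> \<eta>) i j =
        D (\<Sum>a\<in>box K. \<Sum>b\<in>box K. sp_scale (c a b) (cf \<xi> a * ptw (fst a) (cf \<eta> b)))"
      by (simp add: dact_def)
    also have "\<dots> = (\<Sum>a\<in>box K. \<Sum>b\<in>box K. D (sp_scale (c a b) (cf \<xi> a * ptw (fst a) (cf \<eta> b))))"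
      by (simp add: D_sum spolys_sum sp)
    also have "\<dots> = (\<Sum>a\<in>box K. \<Sum>b\<in>box K. sp_scale (c a b) (cf (dact D \<xi>) a * ptw (fst a) (cf \<eta> b))) +
        zsgn (h * p) * (\<Sum>a\<in>box K. \<Sum>b\<in>box K. sp_scale (c a b) (cf \<xi> a * ptw (fst a) (cf (dact D \<eta>) b)))"
      unfolding D_term[OF \<xi> \<eta>] by (simp only: sum.distrib sum_distrib_left)
    also have "\<dots> = cf (gbar_mult (dact D \<xi>) \<eta>) (i, j) + zsgn (h * p) * cf (gbar_mult \<xi> (dact D \<eta>)) (i, j)"
      unfolding c_def gbar_mult_coeff[OF dact_supp[OF N(1)] N(2) K True ij]
        gbar_mult_coeff[OF N(1) dact_supp[OF N(2)] K True ij] ..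
    finally show ?thesis by (simp add: sg_apply)
  qed
qed

lemma dact_form:
  assumes \<xi>: "\<xi> \<in> gH \<iota> p" and \<eta>: "\<eta> \<in> gH \<iota> q"
  shows "D (gbar_form \<xi> \<eta>) = gbar_form (dact D \<xi>) \<eta> + zsgn (h * p) * gbar_form \<xi> (dact D \<eta>)"
proof -
  obtain N where N: "gsupp N \<xi>" "gsupp N \<eta>" using gfin_common2 \<xi> \<eta> by blast
  have sp: "sp_scale c (cf \<xi> a * ptw (fst a) (cf \<eta> (du a))) \<in> spolys (var_index \<iota>)" for a c
    by (intro spolys_scale spolys_mult spolys_ptw gH_spolys[OF \<xi>] gH_spolys[OF \<eta>])
  show ?thesis
    unfolding gbar_form_box[OF N] gbar_form_box[OF dact_supp[OF N(1)] N(2)]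
      gbar_form_box[OF N(1) dact_supp[OF N(2)]] eps_scale D_sum[OF sp] D_term[OF \<xi> \<eta>]
    by (simp only: sum.distrib sum_distrib_left)
qed

lemma dact_add: "\<xi> \<in> gH \<iota> p \<Longrightarrow> \<eta> \<in> gH \<iota> p \<Longrightarrow> dact D (\<xi> + \<eta>) = dact D \<xi> + dact D \<eta>"
  by (intro ext) (simp add: dact_def D_add gH_spolys)

lemma dact_neg: "dact D (gbar_neg \<xi>) = gbar_neg (dact D \<xi>)"
  by (auto simp: dact_def gbar_neg_def D_zero fun_eq_iff)

lemma dact_diff:
  assumes "\<xi> \<in> gH \<iota> p" "\<eta> \<in> gH \<iota> p"
  shows "dact D (\<xi> - \<eta>) = dact D \<xi> - dact D \<eta>"
  using dact_add[OF T.H_diff[OF assms] assms(2)] by (simp add: algebra_simps)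

text \<open>With \<open>X\<close> and \<open>Z\<close> constant, the Leibniz rule only differentiates \<open>L\<close>.\<close>

lemma D_vfield_form:
  assumes L: "L \<in> gH \<iota> 0" and X: "X \<in> gH \<iota> b" and Z: "Z \<in> gH \<iota> c"
    and dX: "dact D X = 0" and dZ: "dact D Z = 0"
  shows "D (gbar_form (T.vfield L X) Z) = T.dquad h b L (dact D L) X Z"
proof -
  have V: "T.vfield L X \<in> gH \<iota> b" using L X by (rule T.vfield_closed)
  have dL: "dact D L \<in> gH \<iota> h" using dact_gH[OF L] by simp
  have z: "gbar_mult 0 L = 0" "gbar_mult L 0 = 0" and zf: "gbar_form (T.vfield L X) 0 = 0"
    using T.mul_zero_left[OF L T.H_0[OF L]] T.mul_zero_right[OF L T.H_0[OF L]] T.tr_zero(2)[OF V T.H_0[OF V]]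
    by auto
  have LX: "gbar_mult L X \<in> gH \<iota> b" "gbar_mult X L \<in> gH \<iota> b" using L X by auto
  have n: "gbar_neg (gbar_mult L X) \<in> gH \<iota> b" "gbar_neg (gbar_mult X L) \<in> gH \<iota> b" using LX by auto
  have 1: "dact D (gbar_mult L X) = gbar_mult (dact D L) X"
    using dact_mult[OF L X] z dX T.mul_zero_right[OF L T.H_0[OF L]] by (simp add: sg_def)
  have 2: "dact D (gbar_mult X L) = sg (h * b) (gbar_mult X (dact D L))"
    using dact_mult[OF X L] z dX by simp
  have 3: "dact D (gbar_mult (gbar_neg (gbar_mult L X)) L) =
      gbar_mult (gbar_neg (gbar_mult (dact D L) X)) L + sg (h * b) (gbar_mult (gbar_neg (gbar_mult L X)) (dact D L))"
    using dact_mult[OF n(1) L] by (simp add: dact_neg 1)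
  have XdL: "gbar_mult X (dact D L) \<in> gH \<iota> (b + h)" using X dL by (rule T.mul_closed)
  have "gbar_neg (sg (h * b) (gbar_mult X (dact D L))) = sg (h * b) (gbar_neg (gbar_mult X (dact D L)))"
    using T.neg_minus[OF XdL] by (simp add: sg_def)
  moreover have "gbar_mult L (sg (h * b) (gbar_neg (gbar_mult X (dact D L)))) =
      sg (h * b) (gbar_mult L (gbar_neg (gbar_mult X (dact D L))))"
    using T.mul_minus_right[OF T.neg_closed[OF XdL] L] by (simp add: sg_def)
  ultimately have 4: "dact D (gbar_mult L (gbar_neg (gbar_mult X L))) =
      gbar_mult (dact D L) (gbar_neg (gbar_mult X L)) + sg (h * b) (gbar_mult L (gbar_neg (gbar_mult X (dact D L))))"
    using dact_mult[OF L n(2)] by (simp add: dact_neg 2 sg_def[of 0])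
  have "dact D (T.vfield L X) = dact D (gbar_mult (gbar_neg (gbar_mult L X)) L) - dact D (gbar_mult L (gbar_neg (gbar_mult X L)))"
    unfolding T.vfield_def by (rule dact_diff[where p = b]) (use L n in auto)
  then have "gbar_form (dact D (T.vfield L X)) Z = T.dquad h b L (dact D L) X Z"
    unfolding 3 4 T.dquad_def by (simp only: diff_diff_eq)
  then show ?thesis
    using dact_form[OF V Z] dZ zf by simp
qed

end

lemma superderiv_bracket:
  assumes "superbracket (var_index \<iota>) br" "u \<in> superpolys (var_index \<iota>) h"
  shows "superderiv \<iota> h (br u)"
proof -
  interpret superbracket "var_index \<iota>" br by fact
  note u = in_spolys[OF assms(2)]
  show ?thesis unfolding superderiv_def
  proof (intro conjI ballI allI)
    show "br u f \<in> superpolys (var_index \<iota>) (p + h)" if "f \<in> superpolys (var_index \<iota>) p" for f p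
      using br_grade[OF assms(2) that] by (simp add: add.commute)
    show "br u (f * g) = br u f * g + zsgn (h * p) * (f * br u g)"
      if "f \<in> superpolys (var_index \<iota>) p" "g \<in> spolys (var_index \<iota>)" for f g p
      using assms(2) that by (rule br_leibniz)
  qed (simp_all add: u br_add_right br_scale_right)
qed

text \<open>
  The gradient of a variable is constant (\<open>dg\<close>), and bracketing with a variable maps the Lax element to the
  vector field of that variable by tangency (\<open>dL\<close>). So the iterated bracket of three variables is given by
  \<open>dquad\<close>, and the Jacobi identity is \<open>jacobi_vfield\<close>.
\<close>

lemma poisson_bracket2:
  assumes L0: "admissible \<iota> L0"
  shows "poisson_superbracket sp_scale (superpolys (var_index \<iota>)) (bracket2 \<iota> L0)"
proof -
  have A0: "L0 \<in> A 0" using L0 by (simp add: admissible_def)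
  let ?b = "bracket2 \<iota> L0" and ?L = "lax \<iota> L0"
  note L = gH_lax[OF A0, of \<iota>]
  interpret superbracket "var_index \<iota>" ?b by (rule superbracket_bracket2[OF A0])
  let ?g = "\<lambda>a. grad \<iota> (sp_var (fst a) (snd a))" and ?x = "\<lambda>a. sp_var (fst a) (snd a) :: 'k superpoly"
  have x: "?x a \<in> superpolys (var_index \<iota>) (fst a)" if "a \<in> VI \<iota>" for a
    using that by (intro superpolys_var) (simp add: VI_def)
  have g: "?g a \<in> gH \<iota> (fst a)" if "a \<in> VI \<iota>" for a
    using that by (intro gH_grad x)
  have const: "?b u (sp_scale c 1) = 0" if "u \<in> superpolys (var_index \<iota>) p" for u p c
    using br_scale_right[of u 1 c] br_one[OF that] in_spolys[OF that] by simp
  have sd: "superderiv \<iota> (fst a) (?b (?x a))" if "a \<in> VI \<iota>" for a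
    by (rule superderiv_bracket[OF superbracket_axioms x[OF that]])
  have dg: "dact (?b (?x a)) (?g c) = 0" if a: "a \<in> VI \<iota>" for a c
  proof -
    have "\<exists>k. ?g c i j = sp_scale k 1" for i j
    proof -
      have d: "\<exists>k. sp_deriv i (- j) (parity_part p (?x c)) = sp_scale k 1" for p
        using sp_scale_one[of 1] sp_scale_zero_left[of 1]
        by (auto simp: parity_part_var sp_deriv_var intro: exI[of _ 1] exI[of _ 0])
      have z: "zsgn i * sp_scale k 1 = sp_scale (zsgn i * k) 1" for k
        by (simp flip: sp_scale_scale)
      from d[of 0] d[of 1] show ?thesis
        unfolding grad_def using sp_scale_zero_left[of 1]
        by (auto simp: z simp flip: sp_scale_add_left intro: exI[of _ 0])
    qed
    then show ?thesis
      unfolding dact_def using const[OF x[OF a]] by (intro ext) (metis zero_fun_def)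
  qed
  have dL: "dact (?b (?x a)) ?L = T.vfield ?L (?g a)" if a: "a \<in> VI \<iota>" for a
  proof (intro ext)
    fix i j
    have H: "T.vfield ?L (?g a) \<in> gH \<iota> (fst a)" using L g[OF a] by (rule T.vfield_closed)
    have e: "embed 0 L0 i j = sp_scale (coord 0 L0 i j) 1" by (simp add: embed_def)
    show "dact (?b (?x a)) ?L i j = T.vfield ?L (?g a) i j"
    proof (cases "(i, j) \<in> VI \<iota>")
      case True
      then have "?L i j = sp_scale (coord 0 L0 i j) 1 + sp_var i j" by (simp add: lax_def e VI_def)
      then have "dact (?b (?x a)) ?L i j = ?b (?x a) (sp_scale (coord 0 L0 i j) 1) + ?b (?x a) (sp_var i j)"
        using x[OF a] x[OF True] by (simp add: dact_def br_add_right in_spolys superpolys_const[THEN in_spolys])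
      also have "?b (?x a) (sp_var i j) = T.vfield ?L (?g a) i j"
        unfolding bracket2_eq using gbar_form_grad_var[OF gH_gfin[OF H] True] by simp
      finally show ?thesis using const[OF x[OF a]] by simp
    next
      case False
      then have "?L i j = sp_scale (coord 0 L0 i j) 1" by (simp add: lax_def e VI_def)
      then have "dact (?b (?x a)) ?L i j = 0"
        using const[OF x[OF a]] by (simp add: dact_def)
      then show ?thesis using vfield_tangent[OF L0 g[OF a] False] by simp
    qed
  qed
  have dq: "?b (?x a) (?b (?x b) (?x c)) = T.dquad (fst a) (fst b) ?L (T.vfield ?L (?g a)) (?g b) (?g c)"
    if abc: "a \<in> VI \<iota>" "b \<in> VI \<iota>" "c \<in> VI \<iota>" for a b c
    using D_vfield_form[OF sd[OF abc(1)] L g[OF abc(2)] g[OF abc(3)] dg[OF abc(1)] dg[OF abc(1)]]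
    unfolding dL[OF abc(1)] bracket2_eq[symmetric] .
  have jac: "jac (fst a) (fst b) (?x a) (?x b) (?x c) = 0"
    if abc: "a \<in> VI \<iota>" "b \<in> VI \<iota>" "c \<in> VI \<iota>" for a b c
  proof -
    note xs = x[OF abc(1)] x[OF abc(2)] x[OF abc(3)]
    note sp = xs[THEN in_spolys]
    have 1: "?b (?b (?x a) (?x b)) (?x c) = - (zsgn ((fst a + fst b) * fst c) * ?b (?x c) (?b (?x a) (?x b)))"
      by (rule br_skew[OF br_grade[OF xs(1,2)] xs(3)])
    have "?b (?x b) (?b (?x a) (?x c)) = ?b (?x b) (- (zsgn (fst a * fst c) * ?b (?x c) (?x a)))"
      by (subst br_skew[OF xs(1,3)]) simp
    also have "\<dots> = - (zsgn (fst a * fst c) * ?b (?x b) (?b (?x c) (?x a)))"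
      using sp by (simp add: br_minus_right br_zsgn spolys_zsgn br_spolys[OF xs(3,1)])
    finally have 2: "?b (?x b) (?b (?x a) (?x c)) = - (zsgn (fst a * fst c) * ?b (?x b) (?b (?x c) (?x a)))" .
    show ?thesis
      unfolding jac_def 1 2 dq[OF abc] dq[OF abc(3,1,2)] dq[OF abc(2,3,1)]
      using T.jacobi_vfield[OF L g[OF abc(1)] g[OF abc(2)] g[OF abc(3)]]
      by (cases "fst a"; cases "fst b"; cases "fst c") (simp_all add: zsgn_def)
  qed
  show ?thesis
  proof (rule poisson_if_jac, rule jac_from_variables)
    fix i j i' j' i'' j''
    assume "j \<in> var_index \<iota> i" "j' \<in> var_index \<iota> i'" "j'' \<in> var_index \<iota> i''"
    then show "jac i i' (sp_var i j) (sp_var i' j') (sp_var i'' j'') = 0"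
      using jac[of "(i, j)" "(i', j')" "(i'', j'')"] by (simp add: VI_def)
  qed
qed

section \<open>The linear bracket as a difference of quadratic brackets\<close>

lemma embed_add:
  assumes "u \<in> A k" "v \<in> A k"
  shows "embed k (u + v) = embed k u + embed k v" and "embed k (u - v) = embed k u - embed k v"
  using assms subspace_add[OF subspace_grade] subspace_diff[OF subspace_grade]
  by (auto simp: fun_eq_iff embed_coeff form_add_left form_diff_left algebra_simps sp_scale_add_left
      simp flip: sp_scale_add_left)

lemma lax_shift:
  assumes "u \<in> A 0" "v \<in> A 0"
  shows "lax \<iota> (u + v) = lax \<iota> u + embed 0 v" and "lax \<iota> (u - v) = lax \<iota> u - embed 0 v"
  by (simp_all add: lax_def embed_add[OF assms] fun_eq_iff algebra_simps)

text \<open>The claim is reduced to generators by pairing with them, where it is centrality in \<open>A\<close>.\<close>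

lemma embed_central:
  assumes \<kappa>: "\<kappa> \<in> A 0" and c: "\<forall>u. \<kappa> * u = u * \<kappa>" and F: "F \<in> gH \<iota> p"
  shows "gbar_mult (embed 0 \<kappa>) F = gbar_mult F (embed 0 \<kappa>)"
proof -
  let ?K = "embed 0 \<kappa>"
  note K = gH_embed[OF \<kappa>, of \<iota>]
  have 1: "gbar_mult ?K (unit a) = gbar_mult (unit a) ?K" if a: "a \<in> IX" for a
  proof (rule gbar_eqI)
    fix b assume b: "b \<in> IX"
    note U = gH_unit[OF a, of \<iota>] gH_unit[OF b, of \<iota>]
    have "gbar_form (gbar_mult ?K (unit a)) (unit b) = gbar_form ?K (gbar_mult (unit a) (unit b))"
      using K U by (intro gform_assoc) auto
    also have "\<dots> = sp_scale (form \<kappa> (el a * el b)) 1"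
      by (simp add: unit_mult a b form_embed_embed[OF \<kappa> el_mult_grade[OF a b]])
    also have "form \<kappa> (el a * el b) = form (el a * \<kappa>) (el b)"
      using form_assoc[of \<kappa> "el a" "el b"] c by simp
    also have "\<dots> = zsgn (fst a * fst b) * form (el b) (el a * \<kappa>)"
      using grade_mult[OF el_grade[OF a] \<kappa>] el_grade[OF b] by (intro form_supersymmetric) simp_all
    also have "sp_scale \<dots> 1 = zsgn (fst a * fst b) * sp_scale (form (el b * el a) \<kappa>) (1 :: 'k superpoly)"
      by (simp add: form_assoc flip: sp_scale_scale)
    also have "sp_scale (form (el b * el a) \<kappa>) (1 :: 'k superpoly) = gbar_form (gbar_mult (unit b) (unit a)) ?K"
      by (simp add: unit_mult a b form_embed_embed[OF el_mult_grade[OF b a] \<kappa>])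
    also have "\<dots> = gbar_form (unit b) (gbar_mult (unit a) ?K)"
      using K U by (intro gform_assoc) auto
    also have "zsgn (fst a * fst b) * \<dots> = gbar_form (gbar_mult (unit a) ?K) (unit b)"
      using T.tr_super[OF T.mul_closed'(2)[OF U(1) K] U(2)] by simp
    finally show "gbar_form (gbar_mult ?K (unit a)) (unit b) = gbar_form (gbar_mult (unit a) ?K) (unit b)" .
  qed (use K a in auto)
  show ?thesis
  proof (rule gbar_eqI)
    fix a assume a: "a \<in> IX"
    note U = gH_unit[OF a, of \<iota>]
    have "gbar_form (gbar_mult ?K F) (unit a) = gbar_form ?K (gbar_mult F (unit a))"
      using K U F by (intro gform_assoc) auto
    also have "\<dots> = gbar_form (gbar_mult F (unit a)) ?K"
      by (rule T.tr_even_commute[OF K T.mul_closed[OF F U]])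
    also have "\<dots> = gbar_form F (gbar_mult (unit a) ?K)"
      using K U F by (intro gform_assoc) auto
    also have "\<dots> = gbar_form (gbar_mult F ?K) (unit a)"
      unfolding 1[OF a, symmetric] using K U F by (intro gform_assoc[symmetric]) auto
    finally show "gbar_form (gbar_mult ?K F) (unit a) = gbar_form (gbar_mult F ?K) (unit a)" .
  qed (use K F in auto)
qed

lemma gbar_part_gH: "\<xi> \<in> gH \<iota> p \<Longrightarrow> gbar_part q \<xi> = (if q = p then \<xi> else 0)"
proof (intro ext)
  fix i j assume \<xi>: "\<xi> \<in> gH \<iota> p"
  have "i + p = i + q \<longleftrightarrow> q = p" by auto
  then show "gbar_part q \<xi> i j = (if q = p then \<xi> else 0) i j"
    using parity_part_other[OF gH_parity[OF \<xi>], of "i + q" i j] by (simp add: gbar_part_def)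
qed

lemma gbar_bracket_gH:
  assumes \<xi>: "\<xi> \<in> gH \<iota> p" and \<eta>: "\<eta> \<in> gH \<iota> q"
  shows "gbar_bracket \<xi> \<eta> = T.sbr p q \<xi> \<eta>"
proof (intro ext)
  fix i j
  have z: "gbar_mult 0 \<eta> = 0" "gbar_mult \<eta> 0 = 0" "gbar_mult \<xi> 0 = 0" "gbar_mult 0 \<xi> = 0" "gbar_mult 0 0 = 0"
    using T.mul_zero_left[OF \<eta> T.H_0[OF \<xi>]] T.mul_zero_right[OF \<eta> T.H_0[OF \<xi>]]
      T.mul_zero_left[OF \<xi> T.H_0[OF \<eta>]] T.mul_zero_right[OF \<xi> T.H_0[OF \<eta>]]
      T.mul_zero_left[OF T.H_0[OF \<xi>] T.H_0[OF \<eta>]] by auto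
  show "gbar_bracket \<xi> \<eta> i j = T.sbr p q \<xi> \<eta> i j"
    unfolding gbar_bracket_def gbar_part_gH[OF \<xi>] gbar_part_gH[OF \<eta>] T.sbr_def
    by (cases p; cases q) (simp_all add: UNIV_bit z sg_def zsgn_def)
qed

lemma gbar_part_add: "gbar_part p (\<xi> + \<eta>) = gbar_part p \<xi> + gbar_part p \<eta>"
  by (auto simp: gbar_part_def fun_eq_iff parity_part_plus)

lemma gfin_part: "\<xi> \<in> gfin \<Longrightarrow> gbar_part p \<xi> \<in> gfin"
proof -
  assume "\<xi> \<in> gfin"
  then obtain N where N: "gsupp N \<xi>" by (auto simp: gfin_def)
  have "gsupp N (gbar_part p \<xi>)"
    unfolding gsupp_def gbar_part_def
  proof (intro allI impI)
    fix a assume "parity_part (fst a + p) (cf \<xi> a) \<noteq> 0"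
    then have "cf \<xi> a \<noteq> 0" by auto
    then show "a \<in> IX \<and> snd a \<le> N" using gsuppD[OF N] by blast
  qed
  then show ?thesis by (auto simp: gfin_def)
qed

lemma gbar_bracket_add:
  assumes "\<xi> \<in> gfin" "\<eta> \<in> gfin" "\<zeta> \<in> gfin"
  shows "gbar_bracket (\<xi> + \<eta>) \<zeta> = gbar_bracket \<xi> \<zeta> + gbar_bracket \<eta> \<zeta>"
    and "gbar_bracket \<zeta> (\<xi> + \<eta>) = gbar_bracket \<zeta> \<xi> + gbar_bracket \<zeta> \<eta>"
  using assms[THEN gfin_part]
  by (auto simp: gbar_bracket_def fun_eq_iff gbar_part_add gmult_add UNIV_bit algebra_simps)

lemma gfin_bracket: "\<xi> \<in> gfin \<Longrightarrow> \<eta> \<in> gfin \<Longrightarrow> gbar_bracket \<xi> \<eta> \<in> gfin"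
proof -
  assume \<xi>: "\<xi> \<in> gfin" and \<eta>: "\<eta> \<in> gfin"
  have z: "zsgn k * \<zeta> i j = sg k \<zeta> i j" for k i j and \<zeta> :: "'k gbar"
    by (simp add: sg_def zsgn_def)
  have s: "sg k \<zeta> \<in> gfin" if "\<zeta> \<in> gfin" for k and \<zeta> :: "'k gbar"
    using that gfin_uminus by (simp add: sg_def)
  have "gbar_bracket \<xi> \<eta> = (\<Sum>p\<in>UNIV. \<Sum>q\<in>UNIV. gbar_mult (gbar_part p \<xi>) (gbar_part q \<eta>) -
      sg (p * q) (gbar_mult (gbar_part q \<eta>) (gbar_part p \<xi>)))"
    by (auto simp: gbar_bracket_def z fun_eq_iff UNIV_bit)
  then show ?thesis
    by (simp add: UNIV_bit) (intro gfin_add gfin_diff s gfin_mult gfin_part \<xi> \<eta>)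
qed

lemma bracket1_add:
  assumes L0: "L0 \<in> A 0" and \<kappa>: "\<kappa> \<in> A 0"
  shows "bracket1 \<iota> L0 \<kappa> (f + f') g = bracket1 \<iota> L0 \<kappa> f g + bracket1 \<iota> L0 \<kappa> f' g"
    and "bracket1 \<iota> L0 \<kappa> f (g + g') = bracket1 \<iota> L0 \<kappa> f g + bracket1 \<iota> L0 \<kappa> f g'"
proof -
  let ?K = "embed 0 \<kappa>" and ?L = "lax \<iota> L0"
  have K: "?K \<in> gfin" and L: "?L \<in> gfin" using gH_embed[OF \<kappa>] gH_lax[OF L0] by auto
  note G = gfin_grad
  have KG: "gbar_pos (gbar_mult ?K (grad \<iota> g)) \<in> gfin" "gbar_neg (gbar_mult ?K (grad \<iota> g)) \<in> gfin" for g
    using K by (auto intro: gfin_pos_neg)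
  have B: "gbar_bracket (grad \<iota> f) (gbar_pos (gbar_mult ?K (grad \<iota> g))) \<in> gfin"
    "gbar_bracket (gbar_neg (gbar_mult ?K (grad \<iota> f))) (grad \<iota> g) \<in> gfin" for f g
    by (intro gfin_bracket G KG)+
  have D: "(a + b) - (c + d) = (a - c) + (b - d)" for a b c d :: "'k gbar"
    by (simp add: algebra_simps)
  show "bracket1 \<iota> L0 \<kappa> (f + f') g = bracket1 \<iota> L0 \<kappa> f g + bracket1 \<iota> L0 \<kappa> f' g"
    unfolding bracket1_def grad_add gmult_add(2)[OF G G K] gbar_pos_neg_add
      gbar_bracket_add(1)[OF G G KG(1)] gbar_bracket_add(1)[OF KG(2) KG(2) G] D
    by (rule gmult_add(4)[OF gfin_diff[OF B] gfin_diff[OF B] L])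
  show "bracket1 \<iota> L0 \<kappa> f (g + g') = bracket1 \<iota> L0 \<kappa> f g + bracket1 \<iota> L0 \<kappa> f g'"
    unfolding bracket1_def grad_add gmult_add(2)[OF G G K] gbar_pos_neg_add
      gbar_bracket_add(2)[OF KG(1) KG(1) G] gbar_bracket_add(2)[OF G G KG(2)] D
    by (rule gmult_add(4)[OF gfin_diff[OF B] gfin_diff[OF B] L])
qed

text \<open>
  For homogeneous \<open>f\<close> and \<open>g\<close> this is \<open>tr_vfield_shift\<close>, since the Lax element is shifted by \<open>\<kappa>\<close>; in general
  both sides are split into homogeneous parts.
\<close>

lemma bracket1_difference:
  assumes L0: "L0 \<in> A 0" and \<kappa>: "\<kappa> \<in> A 0" and c: "\<forall>u. \<kappa> * u = u * \<kappa>"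
    and f: "f \<in> spolys (var_index \<iota>)" and g: "g \<in> spolys (var_index \<iota>)"
  shows "bracket2 \<iota> (L0 + \<kappa>) f g = bracket2 \<iota> L0 f g + bracket1 \<iota> L0 \<kappa> f g"
    and "bracket2 \<iota> (L0 - \<kappa>) f g = bracket2 \<iota> L0 f g - bracket1 \<iota> L0 \<kappa> f g"
proof -
  let ?K = "embed 0 \<kappa>" and ?L = "lax \<iota> L0"
  note K = gH_embed[OF \<kappa>, of \<iota>] and L = gH_lax[OF L0, of \<iota>]
  have hom: "bracket2 \<iota> (L0 + \<kappa>) u v = bracket2 \<iota> L0 u v + bracket1 \<iota> L0 \<kappa> u v \<and>
      bracket2 \<iota> (L0 - \<kappa>) u v = bracket2 \<iota> L0 u v - bracket1 \<iota> L0 \<kappa> u v"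
    if u: "u \<in> superpolys (var_index \<iota>) p" and v: "v \<in> superpolys (var_index \<iota>) q" for u v p q
  proof -
    note F = gH_grad[OF u] and G = gH_grad[OF v]
    note cF = embed_central[OF \<kappa> c F] and cG = embed_central[OF \<kappa> c G]
    have KF: "gbar_neg (gbar_mult ?K (grad \<iota> u)) \<in> gH \<iota> p" and KG: "gbar_pos (gbar_mult ?K (grad \<iota> v)) \<in> gH \<iota> q"
      using K F G by auto
    have S: "T.sbr p q a b \<in> gH \<iota> (p + q)" if "a \<in> gH \<iota> p" "b \<in> gH \<iota> q" for a b
      using T.mul_closed[OF that] T.mul_closed[OF that(2,1)]
      by (simp add: T.sbr_def add.commute[of q p] T.H_diff T.H_sg)
    have "bracket1 \<iota> L0 \<kappa> u v = T.linbr p q ?L ?K (grad \<iota> u) (grad \<iota> v)"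
      unfolding bracket1_def gbar_bracket_gH[OF F KG] gbar_bracket_gH[OF KF G] T.linbr_def
      by (rule T.tr_diff_right[OF S[OF F KG] S[OF KF G] L])
    then show ?thesis
      unfolding bracket2_eq lax_shift[OF L0 \<kappa>]
      using T.tr_vfield_shift[OF L K F G cF cG] by simp
  qed
  have parts: "parity_part p w \<in> superpolys (var_index \<iota>) p" if "w \<in> spolys (var_index \<iota>)" for w :: "'k superpoly" and p
    using that by (simp only: superpolys_iff spolys_parity_part parity_part_same)
  have ps: "parity_part p w \<in> spolys (var_index \<iota>)" if "w \<in> spolys (var_index \<iota>)" for w :: "'k superpoly" and p
    by (rule spolys_parity_part[OF that])
  have A2: "bracket2 \<iota> M (u + u') v = bracket2 \<iota> M u v + bracket2 \<iota> M u' v"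
    "bracket2 \<iota> M v (u + u') = bracket2 \<iota> M v u + bracket2 \<iota> M v u'"
    if "M \<in> A 0" "u \<in> spolys (var_index \<iota>)" "u' \<in> spolys (var_index \<iota>)" "v \<in> spolys (var_index \<iota>)" for M u u' v
  proof -
    interpret superbracket "var_index \<iota>" "bracket2 \<iota> M" by (rule superbracket_bracket2[OF that(1)])
    show "bracket2 \<iota> M (u + u') v = bracket2 \<iota> M u v + bracket2 \<iota> M u' v"
      "bracket2 \<iota> M v (u + u') = bracket2 \<iota> M v u + bracket2 \<iota> M v u'"
      using that by (simp_all add: br_add_left br_add_right)
  qed
  have M: "L0 + \<kappa> \<in> A 0" "L0 - \<kappa> \<in> A 0"
    using L0 \<kappa> subspace_add[OF subspace_grade] subspace_diff[OF subspace_grade] by auto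
  let ?f = "\<lambda>p. parity_part p f" and ?g = "\<lambda>p. parity_part p g"
  note h = hom[OF parts[OF f] parts[OF g], THEN conjunct1] hom[OF parts[OF f] parts[OF g], THEN conjunct2]
  have split: "bracket2 \<iota> M (?f 0 + ?f 1) (?g 0 + ?g 1) = bracket2 \<iota> M (?f 0) (?g 0) + bracket2 \<iota> M (?f 0) (?g 1)
      + (bracket2 \<iota> M (?f 1) (?g 0) + bracket2 \<iota> M (?f 1) (?g 1))" if "M \<in> A 0" for M
    using that f g by (simp add: A2 ps spolys_add)
  have "bracket2 \<iota> (L0 + \<kappa>) (?f 0 + ?f 1) (?g 0 + ?g 1) =
      bracket2 \<iota> L0 (?f 0 + ?f 1) (?g 0 + ?g 1) + bracket1 \<iota> L0 \<kappa> (?f 0 + ?f 1) (?g 0 + ?g 1)"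
    unfolding split[OF M(1)] split[OF L0] bracket1_add[OF L0 \<kappa>] h by (simp add: algebra_simps)
  then show "bracket2 \<iota> (L0 + \<kappa>) f g = bracket2 \<iota> L0 f g + bracket1 \<iota> L0 \<kappa> f g"
    unfolding parity_part_add .
  have "bracket2 \<iota> (L0 - \<kappa>) (?f 0 + ?f 1) (?g 0 + ?g 1) =
      bracket2 \<iota> L0 (?f 0 + ?f 1) (?g 0 + ?g 1) - bracket1 \<iota> L0 \<kappa> (?f 0 + ?f 1) (?g 0 + ?g 1)"
    unfolding split[OF M(2)] split[OF L0] bracket1_add[OF L0 \<kappa>] h by (simp add: algebra_simps)
  then show "bracket2 \<iota> (L0 - \<kappa>) f g = bracket2 \<iota> L0 f g - bracket1 \<iota> L0 \<kappa> f g"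
    unfolding parity_part_add .
qed

theorem poisson_superpair_brackets:
  assumes char: "CHAR('k) \<noteq> 2" and L0: "admissible \<iota> L0" and \<kappa>: "admissible \<iota> \<kappa>"
    and c: "\<forall>u. \<kappa> * u = u * \<kappa>"
  shows "poisson_superpair sp_scale (superpolys (var_index \<iota>)) (bracket1 \<iota> L0 \<kappa>) (bracket2 \<iota> L0)"
proof -
  have A0: "L0 \<in> A 0" "\<kappa> \<in> A 0" using L0 \<kappa> by (simp_all add: admissible_def)
  have adm: "admissible \<iota> (L0 + \<kappa>)" "admissible \<iota> (L0 - \<kappa>)"
    using L0 \<kappa> subspace_add[OF subspace_grade] subspace_diff[OF subspace_grade]
      subspace_add[OF subspace_wfilt] subspace_diff[OF subspace_wfilt] by (auto simp: admissible_def)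
  note diff = bracket1_difference[OF A0 c]
  have sb: "superbracket (var_index \<iota>) (bracket2 \<iota> M)" if "admissible \<iota> M" for M
    using that by (intro superbracket_bracket2) (simp add: admissible_def)
  have b1: "superbracket (var_index \<iota>) (bracket1 \<iota> L0 \<kappa>)"
  proof (rule superbracket_cong[OF superbracket_combination[OF sb[OF adm(1)] sb[OF L0], of 1 "- 1"]])
    fix u v :: "'k superpoly" assume "u \<in> spolys (var_index \<iota>)" "v \<in> spolys (var_index \<iota>)"
    then show "bracket1 \<iota> L0 \<kappa> u v = sp_scale 1 (bracket2 \<iota> (L0 + \<kappa>) u v) + sp_scale (- 1) (bracket2 \<iota> L0 u v)"
      using diff(1) by (simp add: sp_scale_one sp_scale_minus_left)
  qed
  have poisson: "poisson_superbracket sp_scale (superpolys (var_index \<iota>)) br"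
    if M: "admissible \<iota> M"
      and eq: "\<And>u v. u \<in> spolys (var_index \<iota>) \<Longrightarrow> v \<in> spolys (var_index \<iota>) \<Longrightarrow> br u v = bracket2 \<iota> M u v" for M br
  proof -
    note sbr = superbracket_cong[OF sb[OF M] eq]
    interpret B: superbracket "var_index \<iota>" br by (rule sbr)
    interpret P: poisson_superbracket sp_scale "superpolys (var_index \<iota>)" "bracket2 \<iota> M"
      by (rule poisson_bracket2[OF M])
    show ?thesis
    proof (rule B.poisson_if_jac)
      fix u v w :: "'k superpoly" and p q r
      assume h: "u \<in> superpolys (var_index \<iota>) p" "v \<in> superpolys (var_index \<iota>) q" "w \<in> superpolys (var_index \<iota>) r"
      note m = h[THEN B.in_spolys] B.br_spolys[OF h(1,2)] B.br_spolys[OF h(1,3)] B.br_spolys[OF h(2,3)]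
      show "B.jac p q u v w = 0"
        using P.bracket_jacobi[OF h] m by (simp add: B.jac_def eq)
    qed
  qed
  show ?thesis
    by (rule poisson_superpair_from_three[OF char b1 poisson_bracket2[OF L0] sb[OF L0]
          poisson[OF adm(1)] poisson[OF adm(2)]]) (simp_all add: diff)
qed

end

theorem theorem4p3:
  fixes sc :: "'k::field \<Rightarrow> 'a::ring \<Rightarrow> 'a"
    and A :: "bit \<Rightarrow> 'a set" and form :: "'a \<Rightarrow> 'a \<Rightarrow> 'k" and Ap Am :: "'a set"
    and J :: "bit \<Rightarrow> int set" and s :: "bit \<Rightarrow> int \<Rightarrow> 'a"
    and \<iota> :: nat and L0 \<kappa> :: 'a
  assumes "CHAR('k) \<noteq> 2"
    and "semi_finitely_filtered_algebra sc A form Ap Am"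
    and "\<not> (\<exists>S. finite S \<and> module.span sc S = UNIV)"
    and "\<iota> > 0"
    and "polarized_bases sc A form Ap Am J s"
    and "L0 \<in> (Am \<inter> A 0) + (polarized_algebra.filt Ap Am (\<iota> + 1) \<inter> A 0)"
    and "\<forall>u. \<kappa> * u = u * \<kappa>"
    and "\<kappa> \<in> (Am \<inter> A 0) + (polarized_algebra.filt Ap Am (\<iota> + 1) \<inter> A 0)"
  shows "poisson_superpair sp_scale
    (superpolys (polarized_bases.var_index sc A Ap Am J \<iota>))
    (polarized_bases.bracket1 sc A form Ap Am J s \<iota> L0 \<kappa>)
    (polarized_bases.bracket2 sc A form Ap Am J s \<iota> L0)"
proof -
  interpret polarized_bases sc A form Ap Am J s by fact
  show ?thesis
    using assms(1) admissibleI[OF assms(6)] admissibleI[OF assms(8)] assms(7)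
    by (rule poisson_superpair_brackets)
qed

end
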